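(* Let $q$ be a prime power, let $p\neq 2$ be a prime dividing $q-1$, and let $L=\operatorname{PSL}_2(q)$. Let $V$ be the unique (up to isomorphism) nonprincipal irreducible $\mathbb{F}_pL$-module in the principal $p$-block of $L$. Then $$H^1(L,V)\cong H^2(L,V)\cong \mathbb{F}_p.$$
   Context: The principal $\mathbb{F}_pL$-module is the trivial one-dimensional module; "nonprincipal" means not isomorphic to it. The principal $p$-block is the block containing the trivial module. The module $V$ is the one that arises as the kernel of the unique nonsplit extension $0\to V\to G\to L\to 1$ of an elementary abelian $p$-group by $L$ with irreducible induced action of $L$ on $V$; it has order $|V|=p^q$. $H^i(L,V)$ denotes ordinary group cohomology. *)

theory Defs
  imports
    "HOL-Analysis.Determinants"
    "HOL-Algebra.Group_Action"
    "HOL-Algebra.Product_Groups"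
    "HOL-Number_Theory.Residues"
begin

section \<open>The groups \<open>SL\<^sub>2\<close> and \<open>PSL\<^sub>2\<close> over a finite field\<close>

definition SL2 :: "('f::{field,finite} ^ 2 ^ 2) monoid" where
  "SL2 = \<lparr>carrier = {A. det A = 1}, monoid.mult = (**), one = mat 1\<rparr>"

definition SL2_scalars :: "('f::{field,finite} ^ 2 ^ 2) set" where
  "SL2_scalars = {A \<in> carrier SL2. \<exists>c. A = mat c}"

definition PSL2 :: "('f::{field,finite} ^ 2 ^ 2) set monoid" where
  "PSL2 = SL2 Mod SL2_scalars"


section \<open>Linear representations\<close>

text \<open>
  An \<open>RG\<close>-module is a module \<open>V\<close> over \<open>R\<close> with an action \<open>\<rho>\<close> of \<open>G\<close> on its carrier by
  \<open>R\<close>-linear maps. The locale \<open>group_action\<close> makes every \<open>\<rho> g\<close> an extensional bijection.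
\<close>

locale linear_rep = Module.module R V + group_action G "carrier V" \<rho>
  for R (structure) and G (structure) and V (structure) and \<rho> +
  assumes rep_add: "\<lbrakk>g \<in> carrier G; x \<in> carrier V; y \<in> carrier V\<rbrakk> \<Longrightarrow>
      \<rho> g (x \<oplus>\<^bsub>V\<^esub> y) = \<rho> g x \<oplus>\<^bsub>V\<^esub> \<rho> g y"
    and rep_smult: "\<lbrakk>g \<in> carrier G; a \<in> carrier R; x \<in> carrier V\<rbrakk> \<Longrightarrow>
      \<rho> g (a \<odot>\<^bsub>V\<^esub> x) = a \<odot>\<^bsub>V\<^esub> \<rho> g x"

locale irreducible_rep = linear_rep +
  assumes nonzero: "carrier V \<noteq> {\<zero>\<^bsub>V\<^esub>}"
    and irreducible: "\<lbrakk>submodule W R V; \<And>g w. \<lbrakk>g \<in> carrier G; w \<in> W\<rbrakk> \<Longrightarrow> \<rho> g w \<in> W\<rbrakk> \<Longrightarrow>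
      W = {\<zero>\<^bsub>V\<^esub>} \<or> W = carrier V"

definition rep_isomorphic ::
  "('r, 'a) ring_scheme \<Rightarrow> ('g, 'b) monoid_scheme \<Rightarrow>
   ('r, 'v, 'c) module_scheme \<Rightarrow> ('g \<Rightarrow> 'v \<Rightarrow> 'v) \<Rightarrow>
   ('r, 'w, 'd) module_scheme \<Rightarrow> ('g \<Rightarrow> 'w \<Rightarrow> 'w) \<Rightarrow> bool"
where
  "rep_isomorphic R G V \<rho> W \<sigma> \<longleftrightarrow>
    (\<exists>f. bij_betw f (carrier V) (carrier W) \<and>
      (\<forall>x\<in>carrier V. \<forall>y\<in>carrier V. f (x \<oplus>\<^bsub>V\<^esub> y) = f x \<oplus>\<^bsub>W\<^esub> f y) \<and>
      (\<forall>a\<in>carrier R. \<forall>x\<in>carrier V. f (a \<odot>\<^bsub>V\<^esub> x) = a \<odot>\<^bsub>W\<^esub> f x) \<and>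
      (\<forall>g\<in>carrier G. \<forall>x\<in>carrier V. f (\<rho> g x) = \<sigma> g (f x)))"

definition regular_module :: "('r, 'a) ring_scheme \<Rightarrow> ('r, 'r) module" where
  "regular_module R = \<lparr>carrier = carrier R, monoid.mult = (\<otimes>\<^bsub>R\<^esub>), one = \<one>\<^bsub>R\<^esub>,
     ring.zero = \<zero>\<^bsub>R\<^esub>, ring.add = (\<oplus>\<^bsub>R\<^esub>), smult = (\<otimes>\<^bsub>R\<^esub>)\<rparr>"

definition trivial_action :: "'v set \<Rightarrow> 'g \<Rightarrow> 'v \<Rightarrow> 'v" where
  "trivial_action E = (\<lambda>g. \<lambda>x\<in>E. x)"


section \<open>Group algebras and the principal block\<close>

text \<open>
  The group algebra of a finite group: all functions \<open>G \<rightarrow> R\<close>, where \<open>a\<close> stands for the formal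
  sum of the \<open>a g \<cdot> g\<close>. (For infinite \<open>G\<close> one would have to require finite support.)
\<close>

definition group_algebra :: "('r, 'a) ring_scheme \<Rightarrow> ('g, 'b) monoid_scheme \<Rightarrow> ('g \<Rightarrow> 'r) ring" where
  "group_algebra R G = \<lparr>carrier = carrier G \<rightarrow>\<^sub>E carrier R,
     monoid.mult = (\<lambda>a b. \<lambda>g\<in>carrier G. \<Oplus>\<^bsub>R\<^esub>h\<in>carrier G. a h \<otimes>\<^bsub>R\<^esub> b (inv\<^bsub>G\<^esub> h \<otimes>\<^bsub>G\<^esub> g)),
     one = (\<lambda>g\<in>carrier G. if g = \<one>\<^bsub>G\<^esub> then \<one>\<^bsub>R\<^esub> else \<zero>\<^bsub>R\<^esub>),
     ring.zero = (\<lambda>g\<in>carrier G. \<zero>\<^bsub>R\<^esub>),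
     ring.add = (\<lambda>a b. \<lambda>g\<in>carrier G. a g \<oplus>\<^bsub>R\<^esub> b g)\<rparr>"

definition algebra_act ::
  "('g, 'b) monoid_scheme \<Rightarrow> ('r, 'v, 'c) module_scheme \<Rightarrow> ('g \<Rightarrow> 'v \<Rightarrow> 'v) \<Rightarrow> ('g \<Rightarrow> 'r) \<Rightarrow> 'v \<Rightarrow> 'v"
where
  "algebra_act G V \<rho> a v = (\<Oplus>\<^bsub>V\<^esub>g\<in>carrier G. a g \<odot>\<^bsub>V\<^esub> \<rho> g v)"

definition central_idempotent :: "('a, 'b) ring_scheme \<Rightarrow> 'a \<Rightarrow> bool" where
  "central_idempotent A e \<longleftrightarrow>
     e \<in> carrier A \<and> e \<otimes>\<^bsub>A\<^esub> e = e \<and> (\<forall>x\<in>carrier A. e \<otimes>\<^bsub>A\<^esub> x = x \<otimes>\<^bsub>A\<^esub> e)"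

text \<open>
  The blocks of \<open>A\<close> are the ideals \<open>eA\<close> for the primitive central idempotents \<open>e\<close>; a module lies
  in the block \<open>eA\<close> iff \<open>e\<close> acts on it as the identity.
\<close>

definition block_idempotent :: "('a, 'b) ring_scheme \<Rightarrow> 'a \<Rightarrow> bool" where
  "block_idempotent A e \<longleftrightarrow> central_idempotent A e \<and> e \<noteq> \<zero>\<^bsub>A\<^esub> \<and>
     \<not> (\<exists>e1 e2. central_idempotent A e1 \<and> central_idempotent A e2 \<and>
          e1 \<noteq> \<zero>\<^bsub>A\<^esub> \<and> e2 \<noteq> \<zero>\<^bsub>A\<^esub> \<and> e1 \<otimes>\<^bsub>A\<^esub> e2 = \<zero>\<^bsub>A\<^esub> \<and> e = e1 \<oplus>\<^bsub>A\<^esub> e2)"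

definition lies_in_block ::
  "('g, 'b) monoid_scheme \<Rightarrow> ('r, 'v, 'c) module_scheme \<Rightarrow> ('g \<Rightarrow> 'v \<Rightarrow> 'v) \<Rightarrow> ('g \<Rightarrow> 'r) \<Rightarrow> bool"
where
  "lies_in_block G V \<rho> e \<longleftrightarrow> (\<forall>v\<in>carrier V. algebra_act G V \<rho> e v = v)"

definition in_principal_block ::
  "('r, 'a) ring_scheme \<Rightarrow> ('g, 'b) monoid_scheme \<Rightarrow> ('r, 'v, 'c) module_scheme \<Rightarrow>
   ('g \<Rightarrow> 'v \<Rightarrow> 'v) \<Rightarrow> bool"
where
  "in_principal_block R G V \<rho> \<longleftrightarrow>
     (\<exists>e. block_idempotent (group_algebra R G) e \<and>
          lies_in_block G (regular_module R) (trivial_action (carrier R)) e \<and>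
          lies_in_block G V \<rho> e)"


section \<open>Group cohomology\<close>

text \<open>
  Inhomogeneous cochains; an element of \<open>G\<^sup>n\<close> is a list of length \<open>n\<close> over \<open>carrier G\<close>.
\<close>

definition tuples :: "('g, 'b) monoid_scheme \<Rightarrow> nat \<Rightarrow> 'g list set" where
  "tuples G n = {xs \<in> lists (carrier G). length xs = n}"

definition cochains ::
  "('g, 'b) monoid_scheme \<Rightarrow> ('v, 'c) ring_scheme \<Rightarrow> nat \<Rightarrow> ('g list \<Rightarrow> 'v) monoid"
where
  "cochains G V n = product_group (tuples G n) (\<lambda>_. add_monoid V)"

definition merge_at :: "('g, 'b) monoid_scheme \<Rightarrow> nat \<Rightarrow> 'g list \<Rightarrow> 'g list" where
  "merge_at G i xs = take i xs @ (xs ! i \<otimes>\<^bsub>G\<^esub> xs ! Suc i) # drop (i + 2) xs"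

text \<open>
  With tuples indexed from 0, the differential reads
  \<open>(d f)(g\<^sub>0, \<dots>, g\<^sub>n) = g\<^sub>0 f(g\<^sub>1, \<dots>, g\<^sub>n)
    + (\<Sum>i<n. (-1)\<^bsup>i+1\<^esup> f(g\<^sub>0, \<dots>, g\<^sub>i g\<^sub>i\<^sub>+\<^sub>1, \<dots>, g\<^sub>n))
    + (-1)\<^bsup>n+1\<^esup> f(g\<^sub>0, \<dots>, g\<^sub>n\<^sub>-\<^sub>1)\<close>.
\<close>

definition coboundary_map ::
  "('g, 'b) monoid_scheme \<Rightarrow> ('v, 'c) ring_scheme \<Rightarrow> ('g \<Rightarrow> 'v \<Rightarrow> 'v) \<Rightarrow> nat \<Rightarrow>
   ('g list \<Rightarrow> 'v) \<Rightarrow> 'g list \<Rightarrow> 'v"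
where
  "coboundary_map G V \<rho> n f = (\<lambda>xs\<in>tuples G (Suc n).
     \<rho> (hd xs) (f (tl xs))
     \<oplus>\<^bsub>V\<^esub> (\<Oplus>\<^bsub>V\<^esub>i\<in>{..<n}. [((-1) ^ Suc i :: int)] \<cdot>\<^bsub>V\<^esub> f (merge_at G i xs))
     \<oplus>\<^bsub>V\<^esub> [((-1) ^ Suc n :: int)] \<cdot>\<^bsub>V\<^esub> f (butlast xs))"

definition cocycles ::
  "('g, 'b) monoid_scheme \<Rightarrow> ('v, 'c) ring_scheme \<Rightarrow> ('g \<Rightarrow> 'v \<Rightarrow> 'v) \<Rightarrow> nat \<Rightarrow> ('g list \<Rightarrow> 'v) set"
where
  "cocycles G V \<rho> n = kernel (cochains G V n) (cochains G V (Suc n)) (coboundary_map G V \<rho> n)"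

fun coboundaries ::
  "('g, 'b) monoid_scheme \<Rightarrow> ('v, 'c) ring_scheme \<Rightarrow> ('g \<Rightarrow> 'v \<Rightarrow> 'v) \<Rightarrow> nat \<Rightarrow> ('g list \<Rightarrow> 'v) set"
where
  "coboundaries G V \<rho> 0 = {\<one>\<^bsub>cochains G V 0\<^esub>}"
| "coboundaries G V \<rho> (Suc n) = coboundary_map G V \<rho> n ` carrier (cochains G V n)"

definition group_cohomology ::
  "nat \<Rightarrow> ('g, 'b) monoid_scheme \<Rightarrow> ('v, 'c) ring_scheme \<Rightarrow> ('g \<Rightarrow> 'v \<Rightarrow> 'v) \<Rightarrow> ('g list \<Rightarrow> 'v) set monoid"
where
  "group_cohomology n G V \<rho> =
     (cochains G V n)\<lparr>carrier := cocycles G V \<rho> n\<rparr> Mod coboundaries G V \<rho> n"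

end

theory Submission
  imports Defs
begin

text \<open>
  Let \<open>X\<close> be the projective line over the field with \<open>q\<close> elements, \<open>B\<close> the stabilizer in \<open>L\<close> of a point
  \<open>x0\<close>, and \<open>T = \<langle>t\<rangle>\<close> the stabilizer of two points \<open>x0\<close> and \<open>x1\<close>, a cyclic group. Since
  \<open>q \<equiv> 1\<close> modulo \<open>p\<close>, the number \<open>q + 1\<close> of points is \<open>2\<close> modulo \<open>p\<close>, hence invertible, and the permutation
  module \<open>F\<^sub>p[X]\<close> is the direct sum of the constants and of the module of functions with sum \<open>0\<close>. The
  theorem follows from two facts: \<open>V\<close> is this second summand, and the cohomology of the second summand
  in degrees 1 and 2 is that of \<open>F\<^sub>p[X]\<close>, which by Shapiro's lemma is \<open>H\<^sup>n(B, F\<^sub>p) = H\<^sup>n(T, F\<^sub>p) = F\<^sub>p\<close>.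

  Identification of \<open>V\<close>. Let \<open>H\<close> be the largest normal subgroup of \<open>B\<close> of order prime to \<open>p\<close>; the quotient
  \<open>B / H\<close> is a cyclic \<open>p\<close>-group, and \<open>\<theta>\<close> below identifies it with the integers modulo \<open>P\<close>. The sum of the
  elements of all conjugates of \<open>H\<close>, one conjugate for each point, is central in the group algebra, and its
  augmentation \<open>(q + 1) |H|\<close> is not \<open>0\<close> modulo \<open>p\<close>. A central element that acts injectively on one
  module of a block acts injectively on all of them (\<open>block_central_injective\<close>), because otherwise a power of it
  would be a central idempotent splitting the block idempotent. Hence \<open>V\<close> has a nonzero vector fixed by
  \<open>H\<close>, and since \<open>t\<close> acts unipotently on the vectors fixed by \<open>H\<close>, it has a nonzero vector \<open>v0\<close> fixed by \<open>B\<close>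
  (\<open>principal_block_borel_fixed\<close>). Sending a point \<open>g x0\<close> to \<open>g v0\<close> makes the irreducible module \<open>V\<close> a quotient
  of \<open>F\<^sub>p[X]\<close>. The constants are killed because \<open>V\<close> has no fixed vectors, and averaging over \<open>H\<close> shows that
  nothing else is (\<open>comb_eq_zero\<close>).

  Cohomology. A cocycle with values in \<open>F\<^sub>p[X]\<close> is the same thing as a scalar cocycle on the groupoid of
  the action of \<open>L\<close> on \<open>X\<close>. Such a cocycle is a coboundary as soon as its class on \<open>T\<close> vanishes
  (\<open>cocycle1_coboundary\<close>, \<open>cocycle2_coboundary\<close>): it is trivialized on the set of pairs of distinct points,
  where the stabilizer is \<open>T\<close>, and the trivialization is summed over the \<open>q \<equiv> 1\<close> pairs above each point.
  Conversely \<open>\<theta>\<close> gives cocycles with nonzero class (\<open>exists_cocycle1\<close>, \<open>exists_cocycle2\<close>). Their sums over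
  \<open>X\<close> are cocycles with trivial coefficients, and those have class \<open>0\<close> on \<open>T\<close>: an element \<open>w\<close> of \<open>L\<close>
  conjugates \<open>t\<close> to its inverse, which multiplies the class by \<open>-1\<close>, while conjugation does not change it
  (\<open>power_class_zero_of_inverted\<close> in degree 2). So the nonzero class survives in the summand \<open>V\<close>, and evaluating
  the class on \<open>T\<close> is an isomorphism from \<open>H\<^sup>1(L, V)\<close> and from \<open>H\<^sup>2(L, V)\<close> to \<open>F\<^sub>p\<close>.
\<close>

section \<open>Scalar cocycles on a transitive action\<close>

locale gset = group G for G (structure) +
  fixes X :: "'x set" and act :: "'a \<Rightarrow> 'x \<Rightarrow> 'x"
  assumes act_closed [simp]: "\<lbrakk>g \<in> carrier G; x \<in> X\<rbrakk> \<Longrightarrow> act g x \<in> X"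
    and act_one [simp]: "x \<in> X \<Longrightarrow> act \<one> x = x"
    and act_mult: "\<lbrakk>g \<in> carrier G; h \<in> carrier G; x \<in> X\<rbrakk> \<Longrightarrow> act (g \<otimes> h) x = act g (act h x)"
begin

text \<open>
  A cochain \<open>c\<close> with values in the functions on \<open>X\<close> is encoded by the scalars \<open>C g x = c(g)(g x)\<close>, or in
  degree two by \<open>C g h x = c(g, h)(g h x)\<close>. In this form \<open>x\<close> is the source of an arrow \<open>x \<rightarrow> g x\<close> of the
  action groupoid, and the cocycle identities lose the action of the group on the coefficients.
  Scalars in \<open>F\<^sub>p\<close> are represented by integers modulo \<open>m\<close>.
\<close>

definition cocycle1 :: "int \<Rightarrow> ('a \<Rightarrow> 'x \<Rightarrow> int) \<Rightarrow> bool" where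
  "cocycle1 m C \<longleftrightarrow> (\<forall>g\<in>carrier G. \<forall>h\<in>carrier G. \<forall>x\<in>X.
     [C (g \<otimes> h) x = C g (act h x) + C h x] (mod m))"

definition cocycle2 :: "int \<Rightarrow> ('a \<Rightarrow> 'a \<Rightarrow> 'x \<Rightarrow> int) \<Rightarrow> bool" where
  "cocycle2 m C \<longleftrightarrow> (\<forall>g\<in>carrier G. \<forall>h\<in>carrier G. \<forall>k\<in>carrier G. \<forall>x\<in>X.
     [C h k x + C g (h \<otimes> k) x = C (g \<otimes> h) k x + C g h (act k x)] (mod m))"

lemma act_inv_act [simp]: "\<lbrakk>g \<in> carrier G; x \<in> X\<rbrakk> \<Longrightarrow> act (inv g) (act g x) = x"
  by (simp flip: act_mult)

lemma act_act_inv [simp]: "\<lbrakk>g \<in> carrier G; x \<in> X\<rbrakk> \<Longrightarrow> act g (act (inv g) x) = x"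
  by (simp flip: act_mult)

lemma act_eq_iff: "\<lbrakk>g \<in> carrier G; x \<in> X; y \<in> X\<rbrakk> \<Longrightarrow> act g x = act g y \<longleftrightarrow> x = y"
  by (metis act_inv_act)

lemma bij_betw_act: "g \<in> carrier G \<Longrightarrow> bij_betw (act g) X X"
  by (rule bij_betw_byWitness[of _ "act (inv g)"]) auto

lemma act_pow_fixed: "\<lbrakk>g \<in> carrier G; x \<in> X; act g x = x\<rbrakk> \<Longrightarrow> act (g [^] (n::nat)) x = x"
  by (induction n) (auto simp: act_mult)

lemma act_inv_fixed: "\<lbrakk>g \<in> carrier G; x \<in> X; act g x = x\<rbrakk> \<Longrightarrow> act (inv g) x = x"
  by (metis act_inv_act)

lemma sum_act:
  fixes f :: "'x \<Rightarrow> int"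
  shows "g \<in> carrier G \<Longrightarrow> (\<Sum>x\<in>X. f (act g x)) = (\<Sum>x\<in>X. f x)"
  using sum.reindex_bij_betw[OF bij_betw_act] by simp

end

locale transitive_gset = gset +
  fixes x0
  assumes x0 [simp]: "x0 \<in> X"
    and transitive: "x \<in> X \<Longrightarrow> \<exists>g\<in>carrier G. act g x0 = x"
begin

text \<open>
  A choice of coset representatives for the stabilizer of \<open>x0\<close>; \<open>jump g x\<close> measures in the stabilizer
  how far \<open>sect\<close> is from commuting with \<open>g\<close>.
\<close>

definition sect where "sect x = (SOME g. g \<in> carrier G \<and> act g x0 = x)"

lemma sect: "x \<in> X \<Longrightarrow> sect x \<in> carrier G \<and> act (sect x) x0 = x"
  unfolding sect_def by (rule someI_ex) (use transitive in blast)

lemma sect_closed [simp]: "x \<in> X \<Longrightarrow> sect x \<in> carrier G"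
  and act_sect [simp]: "x \<in> X \<Longrightarrow> act (sect x) x0 = x"
  using sect by auto

definition jump where "jump g x = inv (sect (act g x)) \<otimes> (g \<otimes> sect x)"

lemma jump_closed [simp]: "\<lbrakk>g \<in> carrier G; x \<in> X\<rbrakk> \<Longrightarrow> jump g x \<in> carrier G"
  by (simp add: jump_def)

lemma act_inv_sect [simp]: "x \<in> X \<Longrightarrow> act (inv (sect x)) x = x0"
  by (metis act_inv_act act_sect sect_closed x0)

lemma act_jump [simp]: "\<lbrakk>g \<in> carrier G; x \<in> X\<rbrakk> \<Longrightarrow> act (jump g x) x0 = x0"
  by (simp add: jump_def act_mult)

lemma sect_jump: "\<lbrakk>g \<in> carrier G; x \<in> X\<rbrakk> \<Longrightarrow> sect (act g x) \<otimes> jump g x = g \<otimes> sect x"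
  by (simp add: jump_def flip: m_assoc)

lemma jump_mult:
  assumes "g \<in> carrier G" "h \<in> carrier G" "x \<in> X"
  shows "jump (g \<otimes> h) x = jump g (act h x) \<otimes> jump h x"
proof -
  have "sect (act (g \<otimes> h) x) \<otimes> (jump g (act h x) \<otimes> jump h x)
      = sect (act g (act h x)) \<otimes> jump g (act h x) \<otimes> jump h x"
    using assms by (simp add: act_mult m_assoc)
  also have "\<dots> = g \<otimes> (sect (act h x) \<otimes> jump h x)"
    using assms by (simp add: sect_jump m_assoc)
  also have "\<dots> = sect (act (g \<otimes> h) x) \<otimes> jump (g \<otimes> h) x"
    using assms by (simp add: sect_jump m_assoc)
  finally show ?thesis
    using assms by simp
qed

text \<open>
  The injectivity half of Shapiro's lemma in degree one. The function \<open>a\<close> has to be the value of \<open>C\<close> on the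
  chosen arrow \<open>x0 \<rightarrow> x\<close>, and the identity \<open>g \<otimes> sect x = sect (g x) \<otimes> jump g x\<close> compares these arrows.
\<close>

lemma cocycle1_trivial_on_stabilizer:
  assumes C: "cocycle1 m C"
    and stab: "\<And>b. \<lbrakk>b \<in> carrier G; act b x0 = x0\<rbrakk> \<Longrightarrow> [C b x0 = 0] (mod m)"
  shows "\<exists>a. \<forall>g\<in>carrier G. \<forall>x\<in>X. [C g x = a (act g x) - a x] (mod m)"
proof (intro exI ballI)
  fix g x assume gx: "g \<in> carrier G" "x \<in> X"
  have 1: "[C (g \<otimes> sect x) x0 = C g x + C (sect x) x0] (mod m)"
    using C gx unfolding cocycle1_def by (metis act_sect sect_closed x0)
  have 2: "[C (g \<otimes> sect x) x0 = C (sect (act g x)) x0 + C (jump g x) x0] (mod m)"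
    using C gx unfolding cocycle1_def
    by (metis act_closed act_jump jump_closed sect_closed sect_jump x0)
  have 3: "[C (jump g x) x0 = 0] (mod m)" using stab gx by simp
  from 1 2 3 show "[C g x = C (sect (act g x)) x0 - C (sect x) x0] (mod m)"
    unfolding cong_iff_dvd_diff
    using dvd_diff[OF dvd_add[of m "C (g \<otimes> sect x) x0 - (C (sect (act g x)) x0 + C (jump g x) x0)"
       "C (jump g x) x0 - 0"], of "C (g \<otimes> sect x) x0 - (C g x + C (sect x) x0)"]
    by (simp add: algebra_simps)
qed

text \<open>
  The injectivity half of Shapiro's lemma in degree two. In the groupoid extension defined by \<open>C\<close>, a splitting
  \<open>\<alpha>\<close> over the stabilizer extends to the whole groupoid by declaring the chosen arrows \<open>x0 \<rightarrow> x\<close>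
  to be split and writing an arbitrary arrow as \<open>sect (g x) \<otimes> jump g x \<otimes> inv (sect x)\<close>.
\<close>

lemma cocycle2_trivial_on_stabilizer:
  assumes C: "cocycle2 m C"
    and stab: "\<And>b c. \<lbrakk>b \<in> carrier G; act b x0 = x0; c \<in> carrier G; act c x0 = x0\<rbrakk> \<Longrightarrow>
      [C b c x0 = \<alpha> c - \<alpha> (b \<otimes> c) + \<alpha> b] (mod m)"
  shows "\<exists>A. \<forall>g\<in>carrier G. \<forall>h\<in>carrier G. \<forall>x\<in>X.
    [C g h x = A h x - A (g \<otimes> h) x + A g (act h x)] (mod m)"
proof (intro exI ballI)
  define A where "A g x = \<alpha> (jump g x) - C (sect (act g x)) (jump g x) x0 + C g (sect x) x0" for g x
  fix g h x assume gx: "g \<in> carrier G" "h \<in> carrier G" "x \<in> X"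
  define s0 s1 s2 j1 j2 where defs: "s0 = sect x" "s1 = sect (act h x)" "s2 = sect (act g (act h x))"
    "j1 = jump h x" "j2 = jump g (act h x)"
  have cl: "s0 \<in> carrier G" "s1 \<in> carrier G" "s2 \<in> carrier G" "j1 \<in> carrier G" "j2 \<in> carrier G"
    "act j1 x0 = x0" "act j2 x0 = x0" "act s0 x0 = x"
    using gx by (simp_all add: defs)
  have eqs: "s2 \<otimes> j2 = g \<otimes> s1" "s1 \<otimes> j1 = h \<otimes> s0" "jump (g \<otimes> h) x = j2 \<otimes> j1"
    using gx by (simp_all add: defs sect_jump jump_mult)
  have coc: "m dvd (C b c x0 + C a (b \<otimes> c) x0) - (C (a \<otimes> b) c x0 + C a b (act c x0))"
    if "a \<in> carrier G" "b \<in> carrier G" "c \<in> carrier G" for a b c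
    using C that unfolding cocycle2_def cong_iff_dvd_diff by simp
  have 0: "m dvd C j2 j1 x0 - (\<alpha> j1 - \<alpha> (j2 \<otimes> j1) + \<alpha> j2)"
    using stab[of j2 j1] cl by (simp add: cong_iff_dvd_diff)
  have 1: "m dvd (C j2 j1 x0 + C s2 (j2 \<otimes> j1) x0) - (C (g \<otimes> s1) j1 x0 + C s2 j2 x0)"
    using coc[of s2 j2 j1] cl by (simp add: eqs)
  have 2: "m dvd (C h s0 x0 + C g (h \<otimes> s0) x0) - (C (g \<otimes> h) s0 x0 + C g h x)"
    using coc[of g h s0] cl gx by simp
  have 3: "m dvd (C s1 j1 x0 + C g (h \<otimes> s0) x0) - (C (g \<otimes> s1) j1 x0 + C g s1 x0)"
    using coc[of g s1 j1] cl gx by (simp add: eqs)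
  have A: "A h x = \<alpha> j1 - C s1 j1 x0 + C h s0 x0" "A g (act h x) = \<alpha> j2 - C s2 j2 x0 + C g s1 x0"
    "A (g \<otimes> h) x = \<alpha> (j2 \<otimes> j1) - C s2 (j2 \<otimes> j1) x0 + C (g \<otimes> h) s0 x0"
    using gx by (simp_all add: A_def eqs) (simp_all add: defs act_mult)
  (* The claim is the alternating sum of the splitting on the stabilizer and of the cocycle
     identity at three triples that share the arrows of the square g s1 = s2 j2. *)
  have "m dvd (C j2 j1 x0 - (\<alpha> j1 - \<alpha> (j2 \<otimes> j1) + \<alpha> j2))
      - ((C j2 j1 x0 + C s2 (j2 \<otimes> j1) x0) - (C (g \<otimes> s1) j1 x0 + C s2 j2 x0))
      - ((C h s0 x0 + C g (h \<otimes> s0) x0) - (C (g \<otimes> h) s0 x0 + C g h x))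
      + ((C s1 j1 x0 + C g (h \<otimes> s0) x0) - (C (g \<otimes> s1) j1 x0 + C g s1 x0))"
    by (intro dvd_add dvd_diff 0 1 2 3)
  then show "[C g h x = A h x - A (g \<otimes> h) x + A g (act h x)] (mod m)"
    unfolding A cong_iff_dvd_diff by (simp add: algebra_simps)
qed

end

section \<open>Two-cocycles with trivial coefficients\<close>

context group
begin

definition trivial_cocycle2_on :: "'a set \<Rightarrow> int \<Rightarrow> ('a \<Rightarrow> 'a \<Rightarrow> int) \<Rightarrow> bool" where
  "trivial_cocycle2_on S m D \<longleftrightarrow> (\<forall>g\<in>S. \<forall>h\<in>S. \<forall>k\<in>S.
     [D h k + D g (h \<otimes> k) = D (g \<otimes> h) k + D g h] (mod m))"

text \<open>
  If \<open>D\<close> is a two-cocycle, then \<open>cyc D t\<close> is, as a function of the exponent, a cochain with coboundary \<open>D\<close> on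
  the powers of \<open>t\<close>. Modulo \<open>m\<close> it depends only on the power, not on the exponent, exactly when the sum
  \<open>\<Sum>k<n. D (t [^] k) t\<close> over a full period vanishes. This sum is the class of \<open>D\<close> on the cyclic group
  generated by \<open>t\<close>: it is the \<open>n\<close>-th power of a lift of \<open>t\<close> to the central extension defined by \<open>D\<close>.
\<close>

definition cyc :: "('a \<Rightarrow> 'a \<Rightarrow> int) \<Rightarrow> 'a \<Rightarrow> nat \<Rightarrow> int" where
  "cyc D t i = D \<one> t - (\<Sum>k<i. D (t [^] k) t)"

lemma cocycle2_on_powers:
  fixes i j :: nat
  assumes D: "trivial_cocycle2_on (range (\<lambda>i::nat. t [^] i)) m D" and t: "t \<in> carrier G"
  shows "[D (t [^] i) (t [^] j) = cyc D t i + cyc D t j - cyc D t (i + j)] (mod m)"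
proof -
  have coc: "m dvd (D (t [^] b) (t [^] c) + D (t [^] a) (t [^] (b + c)))
      - (D (t [^] (a + b)) (t [^] c) + D (t [^] a) (t [^] b))" for a b c :: nat
    using D t unfolding trivial_cocycle2_on_def cong_iff_dvd_diff by (auto simp: nat_pow_mult)
  show ?thesis
  proof (induction j)
    case 0
    have 1: "m dvd D \<one> \<one> - D (t [^] i) \<one>" using coc[of 0 0 i] by simp
    have 2: "m dvd D \<one> t - D \<one> \<one>" using coc[of 0 1 0] t by simp
    have "m dvd D \<one> t - D (t [^] i) \<one>"
      using dvd_add[OF 1 2] by simp
    then show ?case by (simp add: cong_iff_dvd_diff cyc_def dvd_diff_commute)
  next
    case (Suc j)
    show ?case
      using dvd_add[OF Suc.IH[unfolded cong_iff_dvd_diff] coc[of j 1 i]] t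
      by (simp add: cong_iff_dvd_diff cyc_def algebra_simps)
  qed
qed

lemma cyc_periodic:
  assumes D: "trivial_cocycle2_on (range (\<lambda>i::nat. t [^] i)) m D" and t: "t \<in> carrier G"
    and n: "t [^] n = \<one>"
  shows "[cyc D t (i + a * n) = cyc D t i - int a * (\<Sum>k<n. D (t [^] k) t)] (mod m)"
proof (induction a)
  case (Suc a)
  have 1: "m dvd D (t [^] (i + a * n)) \<one> - (cyc D t (i + a * n) + cyc D t n - cyc D t (i + Suc a * n))"
    using cocycle2_on_powers[OF D t, of "i + a * n" n] n by (simp add: cong_iff_dvd_diff algebra_simps)
  have 2: "m dvd D (t [^] (i + a * n)) \<one> - cyc D t 0"
    using cocycle2_on_powers[OF D t, of "i + a * n" 0] by (simp add: cong_iff_dvd_diff)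
  have 3: "m dvd cyc D t (i + a * n) - (cyc D t i - int a * (\<Sum>k<n. D (t [^] k) t))"
    using Suc.IH by (simp add: cong_iff_dvd_diff)
  show ?case
    using dvd_add[OF dvd_diff[OF 1 2] 3] by (simp add: cong_iff_dvd_diff cyc_def algebra_simps)
qed simp

text \<open>
  The \<open>n\<close>-th power of a lift of \<open>t [^] a\<close> is the \<open>a\<close>-th power of the \<open>n\<close>-th power of a lift of \<open>t\<close>; the choice
  of the lifts does not matter because \<open>m\<close> divides \<open>n\<close>.
\<close>

lemma power_class_pow:
  fixes n a :: nat
  assumes D: "trivial_cocycle2_on (range (\<lambda>i::nat. t [^] i)) m D" and t: "t \<in> carrier G"
    and n: "t [^] n = \<one>" and m: "m dvd int n"
  shows "[(\<Sum>i<n. D ((t [^] a) [^] i) (t [^] a)) = int a * (\<Sum>k<n. D (t [^] k) t)] (mod m)"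
proof -
  have "[(\<Sum>i<n. D ((t [^] a) [^] i) (t [^] a))
       = (\<Sum>i<n. cyc D t a + (cyc D t (a * i) - cyc D t (a * Suc i)))] (mod m)"
  proof (rule cong_sum)
    fix i
    show "[D ((t [^] a) [^] i) (t [^] a) = cyc D t a + (cyc D t (a * i) - cyc D t (a * Suc i))] (mod m)"
      using cocycle2_on_powers[OF D t, of "a * i" a] t by (simp add: nat_pow_pow algebra_simps)
  qed
  also have "(\<Sum>i<n. cyc D t a + (cyc D t (a * i) - cyc D t (a * Suc i)))
      = int n * cyc D t a + (cyc D t 0 - cyc D t (a * n))"
    using sum_lessThan_telescope'[of "\<lambda>i. cyc D t (a * i)" n] by (simp add: sum.distrib)
  also have "[\<dots> = int a * (\<Sum>k<n. D (t [^] k) t)] (mod m)"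
  proof -
    have "m dvd cyc D t (0 + a * n) - (cyc D t 0 - int a * (\<Sum>k<n. D (t [^] k) t))"
      using cyc_periodic[OF D t n, of 0 a] by (simp only: cong_iff_dvd_diff)
    moreover have "m dvd int n * cyc D t a" using m by simp
    ultimately show ?thesis
      unfolding cong_iff_dvd_diff
      using dvd_diff[of m "int n * cyc D t a" "cyc D t (0 + a * n) - (cyc D t 0 - int a * (\<Sum>k<n. D (t [^] k) t))"]
      by (simp add: algebra_simps)
  qed
  finally show ?thesis .
qed

lemma conj_pow:
  "\<lbrakk>w \<in> carrier G; t \<in> carrier G\<rbrakk> \<Longrightarrow> (w \<otimes> t \<otimes> inv w) [^] (i::nat) = w \<otimes> t [^] i \<otimes> inv w"
proof (induction i)
  case (Suc i)
  then have "(w \<otimes> t \<otimes> inv w) [^] Suc i = w \<otimes> t [^] i \<otimes> inv w \<otimes> (w \<otimes> t \<otimes> inv w)"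
    by simp
  also have "\<dots> = w \<otimes> t [^] i \<otimes> (inv w \<otimes> w) \<otimes> t \<otimes> inv w"
    using Suc.prems by (simp only: m_assoc m_closed inv_closed nat_pow_closed)
  finally have "(w \<otimes> t \<otimes> inv w) [^] Suc i = w \<otimes> t [^] i \<otimes> (inv w \<otimes> w) \<otimes> t \<otimes> inv w" .
  then show ?case using Suc.prems by (simp add: m_assoc)
qed simp

text \<open>
  Conjugation acts trivially on cohomology: \<open>D\<close> and its conjugate differ by the coboundary of \<open>\<eta>\<close>, whose sum
  over a full period is \<open>n\<close> times \<open>\<eta> t\<close>.
\<close>

lemma power_class_conj:
  fixes n :: nat
  assumes D: "trivial_cocycle2_on (carrier G) m D" and t: "t \<in> carrier G" and w: "w \<in> carrier G"
    and n: "t [^] n = \<one>" and m: "m dvd int n"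
  defines "t' \<equiv> w \<otimes> t \<otimes> inv w"
  shows "[(\<Sum>i<n. D (t' [^] i) t') = (\<Sum>i<n. D (t [^] i) t)] (mod m)"
proof -
  define \<eta> where "\<eta> g = D w g - D (w \<otimes> g \<otimes> inv w) w" for g
  have coc: "m dvd (D b c + D a (b \<otimes> c)) - (D (a \<otimes> b) c + D a b)"
    if "a \<in> carrier G" "b \<in> carrier G" "c \<in> carrier G" for a b c
    using D that unfolding trivial_cocycle2_on_def cong_iff_dvd_diff by simp
  have conj: "[D (w \<otimes> g \<otimes> inv w) (w \<otimes> h \<otimes> inv w) = D g h - (\<eta> h - \<eta> (g \<otimes> h) + \<eta> g)] (mod m)"
    if gh: "g \<in> carrier G" "h \<in> carrier G" for g h
  proof -
    define g' h' where "g' = w \<otimes> g \<otimes> inv w" and "h' = w \<otimes> h \<otimes> inv w"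
    have cl: "g' \<in> carrier G" "h' \<in> carrier G" using gh w by (auto simp: g'_def h'_def)
    have e: "g' \<otimes> w = w \<otimes> g" "h' \<otimes> w = w \<otimes> h" "g' \<otimes> h' = w \<otimes> (g \<otimes> h) \<otimes> inv w"
    proof -
      show "g' \<otimes> w = w \<otimes> g" "h' \<otimes> w = w \<otimes> h"
        using gh w by (simp_all add: g'_def h'_def m_assoc)
      have "g' \<otimes> h' = w \<otimes> g \<otimes> (inv w \<otimes> w) \<otimes> h \<otimes> inv w"
        using gh w unfolding g'_def h'_def by (simp only: m_assoc m_closed inv_closed)
      then show "g' \<otimes> h' = w \<otimes> (g \<otimes> h) \<otimes> inv w" using gh w by (simp add: m_assoc)
    qed
    have 1: "m dvd (D h' w + D g' (w \<otimes> h)) - (D (g' \<otimes> h') w + D g' h')"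
      using coc[of g' h' w] cl w e(2) by simp
    have 2: "m dvd (D w h + D g' (w \<otimes> h)) - (D (w \<otimes> g) h + D g' w)"
      using coc[of g' w h] cl w gh e(1) by simp
    have 3: "m dvd (D g h + D w (g \<otimes> h)) - (D (w \<otimes> g) h + D w g)"
      using coc[of w g h] w gh by simp
    show ?thesis
      using dvd_diff[OF dvd_diff[OF 2 1] 3]
      by (simp add: cong_iff_dvd_diff \<eta>_def g'_def[symmetric] h'_def[symmetric] e(3)[symmetric] algebra_simps)
  qed
  have "[(\<Sum>i<n. D (t' [^] i) t') = (\<Sum>i<n. D (t [^] i) t - \<eta> t - (\<eta> (t [^] i) - \<eta> (t [^] Suc i)))] (mod m)"
  proof (rule cong_sum)
    fix i
    show "[D (t' [^] i) t' = D (t [^] i) t - \<eta> t - (\<eta> (t [^] i) - \<eta> (t [^] Suc i))] (mod m)"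
      using conj[of "t [^] i" t] t w by (simp add: t'_def conj_pow algebra_simps)
  qed
  also have "(\<Sum>i<n. D (t [^] i) t - \<eta> t - (\<eta> (t [^] i) - \<eta> (t [^] Suc i)))
      = (\<Sum>i<n. D (t [^] i) t) - int n * \<eta> t - (\<eta> (t [^] (0::nat)) - \<eta> (t [^] n))"
    using sum_lessThan_telescope'[of "\<lambda>i. \<eta> (t [^] i)" n] by (simp add: sum_subtractf)
  also have "[\<dots> = (\<Sum>i<n. D (t [^] i) t)] (mod m)"
    using m n by (simp add: cong_iff_dvd_diff)
  finally show ?thesis .
qed

text \<open>
  Conjugation by \<open>w\<close> preserves the class of \<open>D\<close> on \<open>\<langle>t\<rangle>\<close>, while passing from \<open>t\<close> to \<open>inv t = t [^] (n - 1)\<close>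
  multiplies it by \<open>-1\<close>; so twice the class is \<open>0\<close>.
\<close>

lemma power_class_zero_of_inverted:
  fixes n p :: nat
  assumes D: "trivial_cocycle2_on (carrier G) (int p) D" and t: "t \<in> carrier G" and w: "w \<in> carrier G"
    and n: "t [^] n = \<one>" and p: "p dvd n" "prime p" "p \<noteq> 2" and n0: "0 < n"
    and inv: "w \<otimes> t \<otimes> inv w = inv t"
  shows "[(\<Sum>i<n. D (t [^] i) t) = 0] (mod int p)"
proof -
  define F where "F = (\<Sum>i<n. D (t [^] i) t)"
  have "t [^] (n - 1) \<otimes> t = \<one>"
    using n n0 by (metis Suc_diff_1 nat_pow_Suc)
  then have i: "inv t = t [^] (n - 1)"
    using t by (metis inv_equality nat_pow_closed)
  have "trivial_cocycle2_on (range (\<lambda>i::nat. t [^] i)) (int p) D"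
    using D t unfolding trivial_cocycle2_on_def by auto
  then have "[(\<Sum>i<n. D ((inv t) [^] i) (inv t)) = int (n - 1) * F] (mod int p)"
    unfolding F_def i using t n p by (intro power_class_pow) auto
  moreover have "[(\<Sum>i<n. D ((inv t) [^] i) (inv t)) = F] (mod int p)"
    using power_class_conj[OF D t w n] p unfolding inv F_def by simp
  ultimately have "[int (n - 1) * F = F] (mod int p)"
    by (meson cong_sym cong_trans)
  moreover have "int p dvd int n * F" using p by simp
  ultimately have "int p dvd int n * F - (int (n - 1) * F - F)"
    by (simp only: cong_iff_dvd_diff dvd_diff)
  also have "int n * F - (int (n - 1) * F - F) = 2 * F"
    using n0 by (simp add: of_nat_diff algebra_simps)
  finally have "int p dvd 2 \<or> int p dvd F"
    using p prime_dvd_mult_iff[of "int p" 2 F] by simp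
  moreover have "\<not> int p dvd 2"
  proof
    assume "int p dvd 2"
    then have "p dvd 2" using int_dvd_int_iff[of p 2] by simp
    then show False using p by (metis primes_dvd_imp_eq two_is_prime_nat)
  qed
  ultimately show ?thesis by (simp add: F_def cong_0_iff)
qed

end

section \<open>Doubly transitive actions with a cyclic torus\<close>

text \<open>
  What the proof uses of \<open>PSL\<^sub>2(q)\<close> acting on the projective line. The stabilizer of the two points \<open>x0\<close>, \<open>x1\<close>
  is the cyclic torus generated by \<open>t\<close>, inverted by \<open>w\<close>; \<open>P\<close> is the \<open>p\<close>-part of its order, and \<open>\<theta>\<close> is a
  homomorphism from the stabilizer of \<open>x0\<close> to the integers modulo \<open>P\<close>, the discrete logarithm of an
  eigenvalue in the case of \<open>PSL\<^sub>2(q)\<close>.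
\<close>

locale doubly_transitive_gset = gset G X act for G (structure) and X :: "'x set" and act +
  fixes p P :: nat and x0 x1 and t w and \<theta> :: "_ \<Rightarrow> int"
  assumes finite_G: "finite (carrier G)" and finite_X: "finite X"
    and prime_p: "prime p" and p_ne_2: "p \<noteq> 2"
    and card_X: "[card X = 2] (mod p)"
    and base [simp]: "x0 \<in> X" "x1 \<in> X" "x0 \<noteq> x1"
    and doubly_transitive: "\<lbrakk>x \<in> X; y \<in> X; x \<noteq> y\<rbrakk> \<Longrightarrow> \<exists>g\<in>carrier G. act g x0 = x \<and> act g x1 = y"
    and t [simp]: "t \<in> carrier G" "act t x0 = x0" "act t x1 = x1"
    and torus: "\<lbrakk>g \<in> carrier G; act g x0 = x0; act g x1 = x1\<rbrakk> \<Longrightarrow> \<exists>i::nat. g = t [^] i"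
    and P: "\<exists>k>0. P = p ^ k" "P dvd ord t" "\<not> p dvd ord t div P"
    and w [simp]: "w \<in> carrier G" "w \<otimes> t \<otimes> inv w = inv t"
    and \<theta>_mult: "\<lbrakk>b \<in> carrier G; act b x0 = x0; c \<in> carrier G; act c x0 = x0\<rbrakk> \<Longrightarrow>
      [\<theta> (b \<otimes> c) = \<theta> b + \<theta> c] (mod int P)"
    and \<theta>_t: "[\<theta> t = 1] (mod int P)"
    and kernel_transitive: "\<lbrakk>x \<in> X; x \<noteq> x0\<rbrakk> \<Longrightarrow>
      \<exists>h\<in>carrier G. act h x0 = x0 \<and> int P dvd \<theta> h \<and> act h x1 = x"
begin

lemma p_dvd_P: "p dvd P"
  using P(1) by (auto intro: dvd_power)

lemma P_gt_1: "1 < P"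
  using P(1) one_less_power[OF prime_gt_1_nat[OF prime_p]] by auto

lemma ord_pos: "0 < ord t"
  using ord_ge_1[OF finite_G] by (simp add: Suc_le_eq)

lemma p_dvd_ord: "p dvd ord t"
  using p_dvd_P P(2) dvd_trans by blast

lemma card_X_minus_1: "x \<in> X \<Longrightarrow> [int (card (X - {x})) = 1] (mod int p)"
proof -
  assume x: "x \<in> X"
  have "[int (card X) = int 2] (mod int p)" using card_X by (simp only: cong_int_iff)
  moreover have "int (card X) = int (card (X - {x})) + 1"
    using card_Suc_Diff1[OF finite_X x] by simp
  ultimately have "[int (card (X - {x})) + 1 = 1 + 1] (mod int p)" by simp
  then show ?thesis by (simp only: cong_add_rcancel)
qed

lemma transitive_X: "x \<in> X \<Longrightarrow> \<exists>g\<in>carrier G. act g x0 = x"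
  using doubly_transitive[of x0 x1] doubly_transitive[of x x0] base by (cases "x = x0") auto

sublocale transitive_gset G X act x0
  by unfold_locales (auto intro: transitive_X)

text \<open>
  The stabilizer of a pair of distinct points is a conjugate of the torus, and there are \<open>card X - 1 \<equiv> 1\<close>
  pairs above each point. Modulo \<open>p\<close>, summing over these fibres is therefore a left inverse of the pullback from
  points to pairs.
\<close>

definition pairs where "pairs = {(x, x'). x \<in> X \<and> x' \<in> X \<and> x \<noteq> x'}"

definition act2 where "act2 g y = (act g (fst y), act g (snd y))"

sublocale pairs: transitive_gset G pairs act2 "(x0, x1)"
proof unfold_locales
  fix y assume "y \<in> pairs"
  then show "\<exists>g\<in>carrier G. act2 g (x0, x1) = y"
    using doubly_transitive by (auto simp: pairs_def act2_def)
qed (auto simp: pairs_def act2_def act_mult act_eq_iff)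

lemma sum_fibre:
  fixes f :: "'x \<times> 'x \<Rightarrow> int"
  assumes "g \<in> carrier G" "x \<in> X"
  shows "(\<Sum>x'\<in>X - {x}. f (act g x, act g x')) = (\<Sum>x'\<in>X - {act g x}. f (act g x, x'))"
proof -
  have "bij_betw (act g) (X - {x}) (X - {act g x})"
    using bij_betw_act[OF assms(1)] assms bij_betw_DiffI[of "act g" X X "{x}" "{act g x}"]
    by (simp add: bij_betw_def)
  from sum.reindex_bij_betw[OF this, of "\<lambda>x'. f (act g x, x')"] show ?thesis by simp
qed

lemma sum_fibre_const:
  assumes "x \<in> X" shows "[(\<Sum>x'\<in>X - {x}. c) = c] (mod int p)"
  using cong_mult[OF card_X_minus_1[OF assms] cong_refl[of c]] by simp

text \<open>
  Pulled back to pairs, the cocycle is trivial on the stabilizer \<open>\<langle>t\<rangle>\<close>, hence a coboundary; the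
  trivialization is brought back to \<open>X\<close> by summing over the fibres.
\<close>

lemma cocycle1_coboundary:
  assumes C: "cocycle1 (int p) C" and Ct: "[C t x0 = 0] (mod int p)"
  shows "\<exists>a. \<forall>g\<in>carrier G. \<forall>x\<in>X. [C g x = a (act g x) - a x] (mod int p)"
proof -
  have pow: "[C (t [^] i) x0 = 0] (mod int p)" for i :: nat
  proof (induction i)
    case 0
    have "[C (\<one> \<otimes> \<one>) x0 = C \<one> x0 + C \<one> x0] (mod int p)"
      using C[unfolded cocycle1_def, rule_format, of \<one> \<one> x0] by simp
    then show ?case by (simp add: cong_iff_dvd_diff)
  next
    case (Suc i)
    have "[C (t [^] i \<otimes> t) x0 = C (t [^] i) x0 + C t x0] (mod int p)"
      using C[unfolded cocycle1_def, rule_format, of "t [^] i" t x0] by simp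
    also have "[C (t [^] i) x0 + C t x0 = 0 + 0] (mod int p)" by (intro cong_add Suc.IH Ct)
    finally show ?case by simp
  qed
  have "pairs.cocycle1 (int p) (\<lambda>g y. C g (fst y))"
    using C unfolding cocycle1_def pairs.cocycle1_def by (auto simp: act2_def pairs_def)
  then obtain a where a: "\<And>g y. \<lbrakk>g \<in> carrier G; y \<in> pairs\<rbrakk> \<Longrightarrow>
      [C g (fst y) = a (act2 g y) - a y] (mod int p)"
    using pairs.cocycle1_trivial_on_stabilizer[of "int p" "\<lambda>g y. C g (fst y)"] torus pow
    by (fastforce simp: act2_def)
  show ?thesis
  proof (intro exI ballI)
    fix g x assume gx: "g \<in> carrier G" "x \<in> X"
    have "[C g x = (\<Sum>x'\<in>X - {x}. C g x)] (mod int p)"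
      using sum_fibre_const[OF gx(2)] by (rule cong_sym)
    also have "[(\<Sum>x'\<in>X - {x}. C g x) = (\<Sum>x'\<in>X - {x}. a (act g x, act g x') - a (x, x'))] (mod int p)"
      using a gx by (intro cong_sum) (force simp: act2_def pairs_def)
    also have "(\<Sum>x'\<in>X - {x}. a (act g x, act g x') - a (x, x'))
        = (\<Sum>x'\<in>X - {act g x}. a (act g x, x')) - (\<Sum>x'\<in>X - {x}. a (x, x'))"
      using gx by (simp add: sum_subtractf sum_fibre)
    finally show "[C g x = (\<Sum>x'\<in>X - {act g x}. a (act g x, x')) - (\<Sum>x'\<in>X - {x}. a (x, x'))] (mod int p)" .
  qed
qed

lemma pow_ord_cong: "t [^] (i::nat) = t [^] (j::nat) \<longleftrightarrow> [i = j] (mod ord t)"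
proof -
  have "t [^] i = t [^] j \<longleftrightarrow> t [^] int i = t [^] int j" by (simp add: int_pow_int)
  also have "\<dots> \<longleftrightarrow> [int i = int j] (mod int (ord t))"
    by (simp add: int_pow_eq cong_iff_dvd_diff dvd_diff_commute)
  finally show ?thesis by (simp add: cong_int_iff)
qed

text \<open>
  As in degree one, with \<open>cyc\<close> providing the splitting over the torus. The hypothesis says that \<open>cyc\<close>
  is periodic, so that it is a function on the torus.
\<close>

lemma cocycle2_coboundary:
  assumes C: "cocycle2 (int p) C" and Ct: "[(\<Sum>i<ord t. C (t [^] i) t x0) = 0] (mod int p)"
  shows "\<exists>A. \<forall>g\<in>carrier G. \<forall>h\<in>carrier G. \<forall>x\<in>X.
    [C g h x = A h x - A (g \<otimes> h) x + A g (act h x)] (mod int p)"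
proof -
  define D where "D g h = C g h x0" for g h
  have D: "trivial_cocycle2_on (range (\<lambda>i::nat. t [^] i)) (int p) D"
    unfolding trivial_cocycle2_on_def
  proof clarify
    fix i j k :: nat
    show "[D (t [^] j) (t [^] k) + D (t [^] i) (t [^] j \<otimes> t [^] k)
        = D (t [^] i \<otimes> t [^] j) (t [^] k) + D (t [^] i) (t [^] j)] (mod int p)"
      using C[unfolded cocycle2_def, rule_format, of "t [^] i" "t [^] j" "t [^] k" x0]
      by (simp add: D_def act_pow_fixed)
  qed
  have add: "[cyc D t (i + a * ord t) = cyc D t i] (mod int p)" for i a
  proof -
    have "int p dvd int a * (\<Sum>k<ord t. D (t [^] k) t)"
      using Ct by (simp add: D_def cong_0_iff)
    then have "[cyc D t i - int a * (\<Sum>k<ord t. D (t [^] k) t) = cyc D t i] (mod int p)"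
      by (simp add: cong_iff_dvd_diff)
    with cyc_periodic[OF D t(1) pow_ord_eq_1[OF t(1)], of i a] show ?thesis
      by (rule cong_trans)
  qed
  have per: "[cyc D t i = cyc D t j] (mod int p)" if "[i = j] (mod ord t)" for i j
  proof -
    have "[cyc D t i = cyc D t (i mod ord t)] (mod int p)" for i
      using add[of "i mod ord t" "i div ord t"] by (simp only: mod_div_mult_eq)
    from this[of i] this[of j] show ?thesis
      using that unfolding cong_def by simp
  qed
  define dl where "dl g = (SOME i::nat. g = t [^] i)" for g
  have dl: "t [^] dl (t [^] (i::nat)) = t [^] i" for i
    unfolding dl_def by (rule someI2[of _ i]) auto
  have stab: "[D b c = cyc D t (dl c) - cyc D t (dl (b \<otimes> c)) + cyc D t (dl b)] (mod int p)"
    if "b = t [^] i" "c = t [^] j" for b c and i j :: nat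
  proof -
    have bc: "t [^] dl b = b" "t [^] dl c = c" using that dl by auto
    have "b \<otimes> c = t [^] (i + j)" using that by (simp add: nat_pow_mult)
    then have "t [^] dl (b \<otimes> c) = b \<otimes> c" using dl[of "i + j"] by simp
    then have "t [^] dl (b \<otimes> c) = t [^] (dl b + dl c)"
      using bc nat_pow_mult[OF t(1), of "dl b" "dl c"] by simp
    then have "[cyc D t (dl (b \<otimes> c)) = cyc D t (dl b + dl c)] (mod int p)"
      by (intro per) (simp add: pow_ord_cong)
    then have "[cyc D t (dl b) + cyc D t (dl c) - cyc D t (dl b + dl c)
        = cyc D t (dl b) + cyc D t (dl c) - cyc D t (dl (b \<otimes> c))] (mod int p)"
      by (intro cong_diff cong_refl cong_sym[of "cyc D t (dl (b \<otimes> c))"])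
    moreover have "[D b c = cyc D t (dl b) + cyc D t (dl c) - cyc D t (dl b + dl c)] (mod int p)"
      using cocycle2_on_powers[OF D, of "dl b" "dl c"] bc by simp
    ultimately have "[D b c = cyc D t (dl b) + cyc D t (dl c) - cyc D t (dl (b \<otimes> c))] (mod int p)"
      by (rule cong_trans[rotated])
    then show ?thesis by (simp add: algebra_simps)
  qed
  have stab': "[C b c (fst (x0, x1)) = cyc D t (dl c) - cyc D t (dl (b \<otimes> c)) + cyc D t (dl b)] (mod int p)"
    if "b \<in> carrier G" "act2 b (x0, x1) = (x0, x1)" "c \<in> carrier G" "act2 c (x0, x1) = (x0, x1)" for b c
  proof -
    have "\<exists>i::nat. b = t [^] i" "\<exists>j::nat. c = t [^] j" using that torus by (simp_all add: act2_def)
    then show ?thesis using stab by (auto simp: D_def)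
  qed
  have "pairs.cocycle2 (int p) (\<lambda>g h y. C g h (fst y))"
    using C unfolding cocycle2_def pairs.cocycle2_def by (auto simp: act2_def pairs_def)
  then obtain A where A: "\<And>g h y. \<lbrakk>g \<in> carrier G; h \<in> carrier G; y \<in> pairs\<rbrakk> \<Longrightarrow>
      [C g h (fst y) = A h y - A (g \<otimes> h) y + A g (act2 h y)] (mod int p)"
    using pairs.cocycle2_trivial_on_stabilizer[of "int p" "\<lambda>g h y. C g h (fst y)" "\<lambda>b. cyc D t (dl b)", OF _ stab']
    by blast
  show ?thesis
  proof (intro exI ballI)
    fix g h x assume gx: "g \<in> carrier G" "h \<in> carrier G" "x \<in> X"
    let ?A = "\<lambda>g x. \<Sum>x'\<in>X - {x}. A g (x, x')"
    have "[C g h x = (\<Sum>x'\<in>X - {x}. C g h x)] (mod int p)"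
      using sum_fibre_const[OF gx(3)] by (rule cong_sym)
    also have "[(\<Sum>x'\<in>X - {x}. C g h x) = (\<Sum>x'\<in>X - {x}. A h (x, x') - A (g \<otimes> h) (x, x') + A g (act h x, act h x'))] (mod int p)"
    proof (rule cong_sum)
      fix x' assume "x' \<in> X - {x}"
      then show "[C g h x = A h (x, x') - A (g \<otimes> h) (x, x') + A g (act h x, act h x')] (mod int p)"
        using A[of g h "(x, x')"] gx unfolding act2_def fst_conv snd_conv pairs_def by blast
    qed
    also have "(\<Sum>x'\<in>X - {x}. A h (x, x') - A (g \<otimes> h) (x, x') + A g (act h x, act h x'))
        = ?A h x - ?A (g \<otimes> h) x + ?A g (act h x)"
      using gx sum_fibre[of h x "A g"] by (simp add: sum_subtractf sum.distrib)
    finally show "[C g h x = ?A h x - ?A (g \<otimes> h) x + ?A g (act h x)] (mod int p)" .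
  qed
qed

lemma \<theta>_one: "[\<theta> \<one> = 0] (mod int P)"
  using \<theta>_mult[of \<one> \<one>] by (simp add: cong_iff_dvd_diff)

lemma \<theta>_inv:
  assumes "b \<in> carrier G" "act b x0 = x0"
  shows "[\<theta> (inv b) = - \<theta> b] (mod int P)"
proof -
  have "int P dvd \<theta> \<one> - (\<theta> b + \<theta> (inv b))" "int P dvd \<theta> \<one>"
    using \<theta>_mult[of b "inv b"] \<theta>_one assms by (simp_all add: act_inv_fixed cong_iff_dvd_diff)
  from dvd_diff[OF this(2,1)] show ?thesis by (simp add: cong_iff_dvd_diff add.commute)
qed

lemma \<theta>_conj:
  assumes "b \<in> carrier G" "act b x0 = x0" "c \<in> carrier G" "act c x0 = x0"
  shows "[\<theta> (inv b \<otimes> (c \<otimes> b)) = \<theta> c] (mod int P)"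
proof -
  have "[\<theta> (inv b \<otimes> (c \<otimes> b)) = \<theta> (inv b) + \<theta> (c \<otimes> b)] (mod int P)"
    using assms by (intro \<theta>_mult) (auto simp: act_mult act_inv_fixed)
  also have "[\<theta> (inv b) + \<theta> (c \<otimes> b) = - \<theta> b + (\<theta> c + \<theta> b)] (mod int P)"
    using assms by (intro cong_add \<theta>_mult \<theta>_inv)
  finally show ?thesis by simp
qed

lemma \<theta>_pow: "[\<theta> (t [^] (i::nat)) = int i] (mod int P)"
proof (induction i)
  case (Suc i)
  have "[\<theta> (t [^] i \<otimes> t) = \<theta> (t [^] i) + \<theta> t] (mod int P)"
    by (intro \<theta>_mult) (auto simp: act_pow_fixed)
  also have "[\<theta> (t [^] i) + \<theta> t = int i + 1] (mod int P)"
    by (intro cong_add Suc.IH \<theta>_t)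
  finally show ?case by (simp add: add.commute)
qed (simp add: \<theta>_one)

lemma \<theta>_jump_mult:
  assumes "g \<in> carrier G" "h \<in> carrier G" "x \<in> X"
  shows "[\<theta> (jump (g \<otimes> h) x) = \<theta> (jump g (act h x)) + \<theta> (jump h x)] (mod int P)"
  using assms by (simp add: jump_mult \<theta>_mult)

lemma \<theta>_jump_base:
  assumes "b \<in> carrier G" "act b x0 = x0"
  shows "[\<theta> (jump b x0) = \<theta> b] (mod int P)"
  using \<theta>_conj[of "sect x0" b] assms by (simp add: jump_def)

lemma inverted_zero:
  assumes "[- a = a] (mod int p)" shows "[a = 0] (mod int p)"
proof -
  have "int p dvd 2 * a" using assms by (simp add: cong_iff_dvd_diff)
  then have "int p dvd 2 \<or> int p dvd a" using prime_p prime_dvd_mult_iff[of "int p" 2 a] by simp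
  moreover have "\<not> int p dvd 2"
    using prime_p p_ne_2 by (metis int_dvd_int_iff of_nat_numeral primes_dvd_imp_eq two_is_prime_nat)
  ultimately show ?thesis by (simp add: cong_0_iff)
qed

lemma not_p_dvd_double: "\<not> int p dvd k \<Longrightarrow> \<not> int p dvd 2 * k"
  using inverted_zero[of k] by (auto simp: cong_iff_dvd_diff)

text \<open>
  The homomorphism \<open>\<theta>\<close> modulo \<open>p\<close>, coinduced from the stabilizer of \<open>x0\<close> to the whole group. Its sum over
  \<open>X\<close> is a homomorphism from \<open>G\<close> to \<open>F\<^sub>p\<close>, which vanishes at \<open>t\<close> because \<open>t\<close> is conjugate to its inverse.
\<close>

lemma exists_cocycle1:
  "\<exists>C. cocycle1 (int p) C \<and> [C t x0 = 1] (mod int p) \<and> [(\<Sum>x\<in>X. C t x) = 0] (mod int p)"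
proof (intro exI conjI)
  define C where "C g x = \<theta> (jump g x)" for g x
  have Pp: "int p dvd int P" using p_dvd_P by simp
  have mult: "[C (g \<otimes> h) x = C g (act h x) + C h x] (mod int p)"
    if "g \<in> carrier G" "h \<in> carrier G" "x \<in> X" for g h x
    using \<theta>_jump_mult[OF that] cong_dvd_modulus[OF _ Pp] by (simp add: C_def)
  show "cocycle1 (int p) (\<lambda>g x. \<theta> (jump g x))"
    using mult by (simp add: cocycle1_def C_def)
  have "[\<theta> (jump t x0) = 1] (mod int P)"
    using \<theta>_jump_base[of t] \<theta>_t by (auto intro: cong_trans)
  then show "[\<theta> (jump t x0) = 1] (mod int p)"
    using cong_dvd_modulus[OF _ Pp] by blast
  define S where "S g = (\<Sum>x\<in>X. C g x)" for g
  have S: "[S (g \<otimes> h) = S g + S h] (mod int p)" if "g \<in> carrier G" "h \<in> carrier G" for g h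
  proof -
    have "[S (g \<otimes> h) = (\<Sum>x\<in>X. C g (act h x) + C h x)] (mod int p)"
      unfolding S_def using mult that by (intro cong_sum) auto
    also have "(\<Sum>x\<in>X. C g (act h x) + C h x) = S g + S h"
      using that sum_act[of h "C g"] by (simp add: S_def sum.distrib)
    finally show ?thesis .
  qed
  have S1: "[S \<one> = 0] (mod int p)" using S[of \<one> \<one>] by (simp add: cong_iff_dvd_diff)
  have inv: "[S (inv g) = - S g] (mod int p)" if g: "g \<in> carrier G" for g
  proof -
    have "[S g + S (inv g) = S g + - S g] (mod int p)"
      using cong_trans[OF cong_sym[OF S[of g "inv g"]]] S1 g by simp
    then show ?thesis by (simp only: cong_add_lcancel)
  qed
  have "[S (w \<otimes> t \<otimes> inv w) = S (w \<otimes> t) + S (inv w)] (mod int p)"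
    by (intro S) simp_all
  also have "[S (w \<otimes> t) + S (inv w) = S w + S t + - S w] (mod int p)"
    by (intro cong_add S inv w t)
  finally have "[S (inv t) = S t] (mod int p)" by simp
  then have "[- S t = S t] (mod int p)" using inv[of t] by (meson cong_sym cong_trans t(1))
  then show "[(\<Sum>x\<in>X. \<theta> (jump t x)) = 0] (mod int p)"
    using inverted_zero by (simp add: S_def C_def)
qed

text \<open>
  The cocycle that records carries in the addition of integers modulo \<open>P\<close>, that is, the class of the
  extension of \<open>\<int>/P\<close> by \<open>\<int>\<close>, pulled back along \<open>\<theta>\<close> and coinduced. On the torus a
  carry occurs once in \<open>P\<close> steps, so that its class there is \<open>ord t div P\<close>, which is prime to \<open>p\<close>.
\<close>

lemma exists_cocycle2:
  "\<exists>C. cocycle2 (int p) C \<and> \<not> int p dvd (\<Sum>i<ord t. C (t [^] i) t x0) \<and>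
     [(\<Sum>i<ord t. \<Sum>x\<in>X. C (t [^] i) t x) = 0] (mod int p)"
proof (intro exI conjI)
  define r where "r g x = \<theta> (jump g x) mod int P" for g x
  define carry where "carry a b = (a + b) div int P" for a b
  define C where "C g h x = carry (r g (act h x)) (r h x)" for g h x
  have Pc: "int P * carry a b = a + b - (a + b) mod int P" for a b
    by (simp add: carry_def minus_mod_eq_mult_div)
  have r: "r (g \<otimes> h) x = (r g (act h x) + r h x) mod int P"
    if "g \<in> carrier G" "h \<in> carrier G" "x \<in> X" for g h x
    using \<theta>_jump_mult[OF that] by (simp add: r_def cong_def mod_add_eq)
  have C: "C h k x + C g (h \<otimes> k) x = C (g \<otimes> h) k x + C g h (act k x)"
    if cl: "g \<in> carrier G" "h \<in> carrier G" "k \<in> carrier G" "x \<in> X" for g h k x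
  proof -
    have "int P * (C h k x + C g (h \<otimes> k) x) = int P * (C (g \<otimes> h) k x + C g h (act k x))"
      using cl by (simp add: C_def distrib_left Pc r act_mult mod_add_left_eq mod_add_right_eq add.assoc)
    then show ?thesis using P_gt_1 by simp
  qed
  show "cocycle2 (int p) C" unfolding cocycle2_def using C by simp
  have "r (t [^] i) x0 = int i mod int P" for i :: nat
  proof -
    have "[\<theta> (jump (t [^] i) x0) = int i] (mod int P)"
      using \<theta>_jump_base[of "t [^] i"] \<theta>_pow[of i] by (auto simp: act_pow_fixed intro: cong_trans)
    then show ?thesis by (simp add: r_def cong_def)
  qed
  from this this[of 1] have "int P * C (t [^] i) t x0 = 1 - (int (Suc i) mod int P - int i mod int P)" for i :: nat
    using P_gt_1 by (simp add: C_def Pc mod_add_right_eq add.commute[of _ 1])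
  then have "int P * (\<Sum>i<ord t. C (t [^] i) t x0) = (\<Sum>i<ord t. 1 - (int (Suc i) mod int P - int i mod int P))"
    by (simp add: sum_distrib_left)
  also have "\<dots> = int (ord t) - (int (ord t) mod int P - int 0 mod int P)"
    unfolding sum_subtractf[of "\<lambda>i. 1"] sum_lessThan_telescope[of "\<lambda>i. int i mod int P"] by simp
  also have "\<dots> = int P * int (ord t div P)"
    using P(2) by (simp flip: of_nat_mod of_nat_mult)
  finally have "(\<Sum>i<ord t. C (t [^] i) t x0) = int (ord t div P)"
    using P_gt_1 by simp
  then show "\<not> int p dvd (\<Sum>i<ord t. C (t [^] i) t x0)"
    using P(3) by (simp only: int_dvd_int_iff) simp
  have "trivial_cocycle2_on (carrier G) (int p) (\<lambda>g h. \<Sum>x\<in>X. C g h x)"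
    unfolding trivial_cocycle2_on_def
  proof (intro ballI)
    fix g h k assume cl: "g \<in> carrier G" "h \<in> carrier G" "k \<in> carrier G"
    have "(\<Sum>x\<in>X. C h k x + C g (h \<otimes> k) x) = (\<Sum>x\<in>X. C (g \<otimes> h) k x + C g h (act k x))"
      using C cl by (intro sum.cong) auto
    then show "[(\<Sum>x\<in>X. C h k x) + (\<Sum>x\<in>X. C g (h \<otimes> k) x)
        = (\<Sum>x\<in>X. C (g \<otimes> h) k x) + (\<Sum>x\<in>X. C g h x)] (mod int p)"
      using cl sum_act[of k "C g h"] by (simp add: sum.distrib)
  qed
  then show "[(\<Sum>i<ord t. \<Sum>x\<in>X. C (t [^] i) t x) = 0] (mod int p)"
    using power_class_zero_of_inverted[of p "\<lambda>g h. \<Sum>x\<in>X. C g h x" t w "ord t"]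
      prime_p p_ne_2 p_dvd_ord ord_pos by simp
qed

text \<open>
  In the case of \<open>PSL\<^sub>2(q)\<close> this is the unipotent radical of the Borel subgroup extended by the part of the torus
  of order prime to \<open>p\<close>.
\<close>

definition H where "H = {h \<in> carrier G. act h x0 = x0 \<and> int P dvd \<theta> h}"

text \<open>
  \<open>H\<close> acts transitively on the points other than \<open>x0\<close>, and the stabilizer of \<open>x1\<close> in \<open>H\<close> consists of the powers
  of \<open>t [^] P\<close>. So the order of \<open>H\<close> is \<open>(card X - 1) * (ord t div P)\<close>.
\<close>

lemma card_H: "\<not> p dvd card H"
proof -
  define u where "u x = (SOME h. h \<in> H \<and> act h x1 = x)" for x
  have u: "u x \<in> H" "act (u x) x1 = x" if "x \<in> X - {x0}" for x
  proof -
    have "\<exists>h. h \<in> H \<and> act h x1 = x" using kernel_transitive that by (auto simp: H_def)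
    from someI_ex[OF this] show "u x \<in> H" "act (u x) x1 = x" by (auto simp: u_def)
  qed
  have PN: "P * (ord t div P) = ord t" using P(2) by simp
  have ucl: "u x \<in> carrier G" "act (u x) x0 = x0" "[\<theta> (u x) = 0] (mod int P)" if "x \<in> X - {x0}" for x
    using u that by (auto simp: H_def cong_0_iff)
  have tx: "act (t [^] (P * i)) x0 = x0" "act (t [^] (P * i)) x1 = x1" for i
    by (auto intro: act_pow_fixed)
  have ux: "act (u x \<otimes> t [^] (P * i)) x1 = x" if "x \<in> X - {x0}" for x i
    using ucl that u by (simp add: act_mult tx)
  have "bij_betw (\<lambda>(x, i). u x \<otimes> t [^] (P * i)) ((X - {x0}) \<times> {..<ord t div P}) H"
  proof (rule bij_betw_imageI)
    show "inj_on (\<lambda>(x, i). u x \<otimes> t [^] (P * i)) ((X - {x0}) \<times> {..<ord t div P})"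
    proof (rule inj_onI)
      fix a b assume ab: "a \<in> (X - {x0}) \<times> {..<ord t div P}" "b \<in> (X - {x0}) \<times> {..<ord t div P}"
        and eq: "(\<lambda>(x, i). u x \<otimes> t [^] (P * i)) a = (\<lambda>(x, i). u x \<otimes> t [^] (P * i)) b"
      obtain x i y j where a: "a = (x, i)" and b: "b = (y, j)" by fastforce
      have x: "x \<in> X" "x \<noteq> x0" "y \<in> X" "y \<noteq> x0" and ij: "i < ord t div P" "j < ord t div P"
        and e: "u x \<otimes> t [^] (P * i) = u y \<otimes> t [^] (P * j)"
        using ab eq by (auto simp: a b)
      have xy: "x = y" using ux[of x i] ux[of y j] e x by simp
      with e x have "t [^] (P * i) = t [^] (P * j)" using ucl[of y] by simp
      then have "[P * i = P * j] (mod P * (ord t div P))" unfolding PN by (simp only: pow_ord_cong)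
      moreover have "P * i < ord t" "P * j < ord t"
        using ij PN P_gt_1 by (metis mult_less_mono2 order_less_trans zero_less_one)+
      ultimately have "P * i = P * j" unfolding PN by (simp add: cong_def)
      then show "a = b" using xy P_gt_1 by (simp add: a b)
    qed
    show "(\<lambda>(x, i). u x \<otimes> t [^] (P * i)) ` ((X - {x0}) \<times> {..<ord t div P}) = H"
    proof (intro equalityI subsetI)
      fix g assume "g \<in> (\<lambda>(x, i). u x \<otimes> t [^] (P * i)) ` ((X - {x0}) \<times> {..<ord t div P})"
      then obtain x i where x: "x \<in> X - {x0}" and g: "g = u x \<otimes> t [^] (P * i)" by auto
      have "[\<theta> g = \<theta> (u x) + \<theta> (t [^] (P * i))] (mod int P)"
        unfolding g using ucl[OF x] tx by (intro \<theta>_mult) auto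
      also have "[\<theta> (u x) + \<theta> (t [^] (P * i)) = 0 + int (P * i)] (mod int P)"
        by (intro cong_add ucl(3)[OF x] \<theta>_pow)
      also have "[0 + int (P * i) = 0] (mod int P)" by (simp add: cong_0_iff)
      finally show "g \<in> H" using ucl[OF x] tx by (simp add: H_def g act_mult cong_0_iff)
    next
      fix g assume g: "g \<in> H"
      define x where "x = act g x1"
      have gcl: "g \<in> carrier G" "act g x0 = x0" "[\<theta> g = 0] (mod int P)"
        using g by (auto simp: H_def cong_0_iff)
      have x: "x \<in> X - {x0}" using gcl act_eq_iff[of g x1 x0] base(3) by (auto simp: x_def)
      note ux' = ucl[OF x]
      have "act (inv (u x)) x = x1" using u(2)[OF x] ux'(1) by (metis act_inv_act base(2))
      then obtain i :: nat where i: "inv (u x) \<otimes> g = t [^] i"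
        using torus[of "inv (u x) \<otimes> g"] gcl ux' by (auto simp: act_mult act_inv_fixed x_def[symmetric])
      have "[\<theta> (inv (u x) \<otimes> g) = \<theta> (inv (u x)) + \<theta> g] (mod int P)"
        using gcl ux' by (intro \<theta>_mult) (auto simp: act_inv_fixed)
      also have "[\<theta> (inv (u x)) + \<theta> g = - \<theta> (u x) + 0] (mod int P)"
        by (intro cong_add \<theta>_inv gcl ux')
      also have "[- \<theta> (u x) + 0 = - 0 + 0] (mod int P)"
        by (intro cong_add cong_minus_minus_iff[THEN iffD2] ux' cong_refl)
      finally have "[int i = 0] (mod int P)" using \<theta>_pow[of i] unfolding i by (simp add: cong_def)
      then have "P dvd i mod ord t"
        using P(2) by (simp add: cong_0_iff int_dvd_int_iff dvd_mod_iff)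
      then obtain k where k: "i mod ord t = P * k" by blast
      have "i mod ord t < P * (ord t div P)" using ord_pos PN by simp
      then have "k < ord t div P" unfolding k using P_gt_1 by simp
      moreover have "g = u x \<otimes> t [^] (P * k)"
      proof -
        have "t [^] (P * k) = t [^] i" using k by (metis cong_mod_left cong_refl pow_ord_cong)
        then have "u x \<otimes> t [^] (P * k) = u x \<otimes> (inv (u x) \<otimes> g)" using i by simp
        also have "\<dots> = g" using gcl ux' by (simp flip: m_assoc)
        finally show ?thesis by simp
      qed
      ultimately show "g \<in> (\<lambda>(x, i). u x \<otimes> t [^] (P * i)) ` ((X - {x0}) \<times> {..<ord t div P})"
        using x by force
    qed
  qed
  then have "card H = card (X - {x0}) * (ord t div P)"
    using bij_betw_same_card[of _ "(X - {x0}) \<times> {..<ord t div P}" H] by (simp add: card_cartesian_product)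
  moreover have "\<not> p dvd card (X - {x0})"
  proof
    assume "p dvd card (X - {x0})"
    then have "[int (card (X - {x0})) = 0] (mod int p)" by (simp add: cong_0_iff)
    then have "[1 = 0] (mod int p)" using card_X_minus_1[OF base(1)] by (meson cong_sym cong_trans)
    then show False using prime_gt_1_nat[OF prime_p] by (simp add: cong_def)
  qed
  ultimately show ?thesis using P(3) prime_p by (simp add: prime_dvd_mult_iff)
qed

lemma H_mult: "\<lbrakk>h \<in> H; k \<in> H\<rbrakk> \<Longrightarrow> h \<otimes> k \<in> H"
  using \<theta>_mult[of h k] cong_dvd_iff[of "\<theta> (h \<otimes> k)"] by (auto simp: H_def act_mult)

lemma H_inv: "h \<in> H \<Longrightarrow> inv h \<in> H"
  using \<theta>_inv[of h] cong_dvd_iff[of "\<theta> (inv h)"] by (auto simp: H_def act_inv_fixed)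

lemma H_conj: "\<lbrakk>b \<in> carrier G; act b x0 = x0; h \<in> H\<rbrakk> \<Longrightarrow> inv b \<otimes> (h \<otimes> b) \<in> H"
  using \<theta>_conj[of b h] cong_dvd_iff[of "\<theta> (inv b \<otimes> (h \<otimes> b))"] by (auto simp: H_def act_mult act_inv_fixed)

lemma t_pow_P_H: "t [^] P \<in> H"
  using \<theta>_pow[of P] by (auto simp: H_def act_pow_fixed cong_0_iff cong_dvd_iff)

end

section \<open>Integral combinations in an abelian group\<close>

context abelian_group
begin

text \<open>
  Integer linear combinations of a family. Coefficients are functions into the integers, so that their
  arithmetic is that of a type class, and equality of combinations can be checked modulo the exponent of
  the group (\<open>lc_torsion\<close>).
\<close>

definition lc :: "('i \<Rightarrow> 'a) \<Rightarrow> 'i set \<Rightarrow> ('i \<Rightarrow> int) \<Rightarrow> 'a" where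
  "lc e I f = (\<Oplus>i\<in>I. [f i] \<cdot> e i)"

lemma lc_closed [simp]: "e \<in> I \<rightarrow> carrier G \<Longrightarrow> lc e I f \<in> carrier G"
  by (auto simp: lc_def Pi_iff intro!: finsum_closed)

lemma lc_cong: "\<lbrakk>\<And>i. i \<in> I \<Longrightarrow> [f i] \<cdot> e i = [g i] \<cdot> e' i; e' \<in> I \<rightarrow> carrier G\<rbrakk> \<Longrightarrow> lc e I f = lc e' I g"
  unfolding lc_def by (intro finsum_cong') (auto simp: Pi_iff)

lemma lc_empty [simp]: "lc e {} f = \<zero>"
  by (simp add: lc_def)

lemma lc_insert: "\<lbrakk>finite I; i \<notin> I; e \<in> insert i I \<rightarrow> carrier G\<rbrakk> \<Longrightarrow>
    lc e (insert i I) f = [f i] \<cdot> e i \<oplus> lc e I f"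
  unfolding lc_def by (subst finsum_insert) (auto simp: Pi_iff)

lemma int_mult_0 [simp]: "[(0::int)] \<cdot> x = \<zero>"
  by (simp add: add_pow_def int_pow_def nat_pow_def)

lemma minus_eq_zero_iff: "\<lbrakk>x \<in> carrier G; y \<in> carrier G\<rbrakk> \<Longrightarrow> x \<ominus> y = \<zero> \<longleftrightarrow> x = y"
  by (metis a_inv_closed minus_eq minus_equality minus_minus r_neg)

lemma lc_zero [simp]: "lc e I (\<lambda>i. 0) = \<zero>"
  unfolding lc_def by (simp add: finsum_zero)

lemma lc_add: "e \<in> I \<rightarrow> carrier G \<Longrightarrow> lc e I (\<lambda>i. f i + g i) = lc e I f \<oplus> lc e I g"
proof -
  assume e: "e \<in> I \<rightarrow> carrier G"
  have "lc e I (\<lambda>i. f i + g i) = (\<Oplus>i\<in>I. [f i] \<cdot> e i \<oplus> [g i] \<cdot> e i)"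
    unfolding lc_def using e by (intro finsum_cong') (auto simp: Pi_iff add.int_pow_mult)
  then show ?thesis using e by (simp add: lc_def finsum_addf Pi_iff)
qed

lemma lc_uminus: "e \<in> I \<rightarrow> carrier G \<Longrightarrow> lc e I (\<lambda>i. - f i) = \<ominus> lc e I f"
  using lc_add[of e I "\<lambda>i. - f i" f] by (simp add: minus_equality)

lemma lc_diff: "e \<in> I \<rightarrow> carrier G \<Longrightarrow> lc e I (\<lambda>i. f i - g i) = lc e I f \<ominus> lc e I g"
  using lc_add[of e I f "\<lambda>i. - g i"] by (simp add: lc_uminus minus_eq)

lemma lc_mult: "e \<in> I \<rightarrow> carrier G \<Longrightarrow> lc e I (\<lambda>i. k * f i) = [k] \<cdot> lc e I f"
proof -
  assume e: "e \<in> I \<rightarrow> carrier G"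
  have nat: "lc e I (\<lambda>i. int n * f i) = [int n] \<cdot> lc e I f" for n
  proof (induction n)
    case (Suc n)
    have "lc e I (\<lambda>i. int (Suc n) * f i) = lc e I (\<lambda>i. int n * f i) \<oplus> lc e I f"
      using lc_add[OF e, of "\<lambda>i. int n * f i" f] by (simp add: algebra_simps)
    then show ?case using e Suc.IH add.int_pow_mult[of "lc e I f" "int n" 1] by (simp add: add.commute)
  qed simp
  show ?thesis
  proof (cases "0 \<le> k")
    case True
    then show ?thesis using nat[of "nat k"] by simp
  next
    case False
    then have "k = - int (nat (- k))" by simp
    then obtain n where k: "k = - int n" by blast
    have "lc e I (\<lambda>i. - (int n * f i)) = \<ominus> ([int n] \<cdot> lc e I f)"
      using e nat[of n] by (simp add: lc_uminus)
    then show ?thesis using e by (simp add: k add.int_pow_neg)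
  qed
qed

lemma lc_single: "\<lbrakk>finite I; j \<in> I; e \<in> I \<rightarrow> carrier G\<rbrakk> \<Longrightarrow> lc e I (\<lambda>i. if i = j then k else 0) = [k] \<cdot> e j"
proof -
  assume *: "finite I" "j \<in> I" "e \<in> I \<rightarrow> carrier G"
  have "lc e (insert j (I - {j})) (\<lambda>i. if i = j then k else 0)
      = [k] \<cdot> e j \<oplus> lc e (I - {j}) (\<lambda>i. if i = j then k else 0)"
    using * by (subst lc_insert) (auto simp: Pi_iff)
  moreover have "lc e (I - {j}) (\<lambda>i. if i = j then k else 0) = lc e (I - {j}) (\<lambda>i. 0)"
    using * by (intro lc_cong) auto
  ultimately show ?thesis using * by (simp add: insert_absorb Pi_iff)
qed

lemma lc_sum:
  "\<lbrakk>finite J; e \<in> I \<rightarrow> carrier G\<rbrakk> \<Longrightarrow> lc e I (\<lambda>i. \<Sum>j\<in>J. f j i) = (\<Oplus>j\<in>J. lc e I (f j))"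
  by (induction J rule: finite_induct) (auto simp: lc_add finsum_insert)

lemma lc_sum_zero:
  "\<lbrakk>e \<in> I \<rightarrow> carrier G; \<And>j. j \<in> J \<Longrightarrow> lc e I (f j) = \<zero>\<rbrakk> \<Longrightarrow> lc e I (\<lambda>i. \<Sum>j\<in>J. f j i) = \<zero>"
  by (cases "finite J") (simp_all add: lc_sum finsum_zero cong: finsum_cong)

lemma lc_shift:
  "(\<And>i. e i \<in> carrier G) \<Longrightarrow>
    lc (\<lambda>i. e (Suc i)) {..<n} f = lc e {..n} (\<lambda>i. case i of 0 \<Rightarrow> 0 | Suc k \<Rightarrow> f k)"
proof (induction n)
  case 0
  then show ?case by (subst lc_def) (simp add: lc_def)
next
  case (Suc n)
  then show ?case by (simp add: lessThan_Suc atMost_Suc lc_insert)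
qed

lemma lc_torsion:
  assumes "e \<in> I \<rightarrow> carrier G" and "\<And>v. v \<in> carrier G \<Longrightarrow> [m] \<cdot> v = \<zero>"
    and "\<And>i. i \<in> I \<Longrightarrow> [f i = g i] (mod m)"
  shows "lc e I f = lc e I g"
proof (rule lc_cong)
  fix i assume i: "i \<in> I"
  then obtain k where k: "f i = g i + m * k" using assms(3) by (metis cong_iff_lin cong_sym)
  have "[(m * k)] \<cdot> e i = [m] \<cdot> ([k] \<cdot> e i)" using assms(1) i by (simp add: Pi_iff add.int_pow_pow mult.commute)
  then have "[(m * k)] \<cdot> e i = \<zero>" using assms(1,2) i by (simp add: Pi_iff)
  then show "[f i] \<cdot> e i = [g i] \<cdot> e i" using assms(1) i by (simp add: k Pi_iff add.int_pow_mult)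
qed (use assms in auto)

lemma lc_reindex:
  assumes "inj_on h I" "e \<in> h ` I \<rightarrow> carrier G"
  shows "lc e (h ` I) f = lc (\<lambda>i. e (h i)) I (\<lambda>i. f (h i))"
  unfolding lc_def using assms by (subst finsum_reindex) (auto simp: Pi_iff)

end

section \<open>Representations on groups of prime exponent\<close>

locale torsion_rep = group G + V: abelian_group V for G (structure) and V (structure) +
  fixes p :: nat and \<rho> :: "_ \<Rightarrow> _ \<Rightarrow> _"
  assumes prime_p: "prime p"
    and torsion: "v \<in> carrier V \<Longrightarrow> [int p] \<cdot>\<^bsub>V\<^esub> v = \<zero>\<^bsub>V\<^esub>"
    and \<rho>_closed [simp]: "\<lbrakk>g \<in> carrier G; v \<in> carrier V\<rbrakk> \<Longrightarrow> \<rho> g v \<in> carrier V"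
    and \<rho>_one [simp]: "v \<in> carrier V \<Longrightarrow> \<rho> \<one> v = v"
    and \<rho>_mult: "\<lbrakk>g \<in> carrier G; h \<in> carrier G; v \<in> carrier V\<rbrakk> \<Longrightarrow> \<rho> (g \<otimes> h) v = \<rho> g (\<rho> h v)"
    and \<rho>_add: "\<lbrakk>g \<in> carrier G; u \<in> carrier V; v \<in> carrier V\<rbrakk> \<Longrightarrow>
      \<rho> g (u \<oplus>\<^bsub>V\<^esub> v) = \<rho> g u \<oplus>\<^bsub>V\<^esub> \<rho> g v"
begin

lemma \<rho>_hom: "g \<in> carrier G \<Longrightarrow> group_hom (add_monoid V) (add_monoid V) (\<rho> g)"
  by unfold_locales (auto simp: hom_def \<rho>_add intro: V.add.Units_closed)

lemma \<rho>_zero [simp]: "g \<in> carrier G \<Longrightarrow> \<rho> g \<zero>\<^bsub>V\<^esub> = \<zero>\<^bsub>V\<^esub>"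
  using group_hom.hom_one[OF \<rho>_hom] by simp

lemma \<rho>_int_pow: "\<lbrakk>g \<in> carrier G; v \<in> carrier V\<rbrakk> \<Longrightarrow> \<rho> g ([(k::int)] \<cdot>\<^bsub>V\<^esub> v) = [k] \<cdot>\<^bsub>V\<^esub> \<rho> g v"
  using hom_int_pow[of "\<rho> g" "add_monoid V" "add_monoid V" v k] group_hom.homh[OF \<rho>_hom, of g]
  by (simp add: add_pow_def V.a_group)

lemma \<rho>_lc: "\<lbrakk>g \<in> carrier G; e \<in> I \<rightarrow> carrier V\<rbrakk> \<Longrightarrow> \<rho> g (V.lc e I f) = V.lc (\<lambda>i. \<rho> g (e i)) I f"
proof (induction I rule: infinite_finite_induct)
  case (insert i I)
  then show ?case by (simp add: V.lc_insert \<rho>_add \<rho>_int_pow Pi_iff)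
qed (auto simp: V.lc_def)

lemma torsion_dvd:
  assumes "u \<in> carrier V" "u \<noteq> \<zero>\<^bsub>V\<^esub>" "[(k::int)] \<cdot>\<^bsub>V\<^esub> u = \<zero>\<^bsub>V\<^esub>" shows "int p dvd k"
proof (rule ccontr)
  assume "\<not> int p dvd k"
  then have "coprime (int p) k" using prime_p by (simp add: prime_imp_coprime)
  then obtain a b where ab: "a * int p + b * k = 1" using bezout_int[of "int p" k] by auto
  have pp: "[m] \<cdot>\<^bsub>V\<^esub> ([n] \<cdot>\<^bsub>V\<^esub> u) = [(m * n)] \<cdot>\<^bsub>V\<^esub> u" for m n :: int
    using assms by (simp add: V.add.int_pow_pow mult.commute)
  from ab have "u = [(a * int p + b * k)] \<cdot>\<^bsub>V\<^esub> u" using assms by simp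
  also have "\<dots> = [a] \<cdot>\<^bsub>V\<^esub> ([int p] \<cdot>\<^bsub>V\<^esub> u) \<oplus>\<^bsub>V\<^esub> [b] \<cdot>\<^bsub>V\<^esub> ([k] \<cdot>\<^bsub>V\<^esub> u)"
    using assms(1) by (simp only: V.add.int_pow_mult pp)
  also have "\<dots> = \<zero>\<^bsub>V\<^esub>" using assms by (simp add: torsion)
  finally show False using assms by simp
qed

text \<open>
  Modulo \<open>p\<close> the binomial formula gives \<open>(s - 1)\<^sup>p = s\<^sup>p - 1\<close>, so \<open>s - 1\<close> is nilpotent on \<open>v\<close>; the last nonzero
  vector in the sequence \<open>(s - 1)\<^sup>j v\<close> is fixed by \<open>s\<close>.
\<close>

lemma unipotent_of_prime_order:
  assumes s: "s \<in> carrier G" and W: "subgroup W (add_monoid V)" and Ws: "\<And>v. v \<in> W \<Longrightarrow> \<rho> s v \<in> W"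
    and v: "v \<in> W" "v \<noteq> \<zero>\<^bsub>V\<^esub>" "\<rho> (s [^] p) v = v" and p2: "p \<noteq> 2"
  shows "\<exists>u\<in>W. u \<noteq> \<zero>\<^bsub>V\<^esub> \<and> \<rho> s u = u"
proof -
  have WV: "u \<in> carrier V" if "u \<in> W" for u using subgroup.subset[OF W] that by auto
  define u where "u j = ((\<lambda>x. \<rho> s x \<ominus>\<^bsub>V\<^esub> x) ^^ j) v" for j
  have u0: "u 0 = v" and uS: "u (Suc j) = \<rho> s (u j) \<ominus>\<^bsub>V\<^esub> u j" for j by (simp_all add: u_def)
  have uW: "u j \<in> W" for j
  proof (induction j)
    case (Suc j)
    have "inv\<^bsub>add_monoid V\<^esub> (u j) \<in> W" using subgroup.m_inv_closed[OF W Suc.IH] .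
    then have "\<ominus>\<^bsub>V\<^esub> (u j) \<in> W" by (simp add: a_inv_def)
    then show ?case
      using subgroup.m_closed[OF W Ws[OF Suc.IH]] by (simp add: uS a_minus_def)
  qed (simp add: u0 v)
  define e where "e i = \<rho> (s [^] i) v" for i :: nat
  have e [simp]: "e i \<in> carrier V" for i using s v WV by (simp add: e_def)
  have eS: "\<rho> s (e i) = e (Suc i)" for i
  proof -
    have "s [^] Suc i = s \<otimes> s [^] i" using s by (metis nat_pow_Suc2)
    then show ?thesis using s v WV by (simp add: e_def \<rho>_mult)
  qed
  (* The coefficient of the i-th power in the j-th power of (s - 1). *)
  define c where "c j i = (-1) ^ (j + i) * int (j choose i)" for j i
  have ulc: "u j = V.lc e {..p} (c j)" if "j \<le> p" for j
    using that
  proof (induction j)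
    case 0
    have "V.lc e {..p} (c 0) = V.lc e {..p} (\<lambda>i. if i = 0 then 1 else 0)"
      by (intro V.lc_cong) (auto simp: c_def binomial_eq_0)
    also have "\<dots> = e 0" by (subst V.lc_single) auto
    also have "e 0 = v" using v WV by (simp add: e_def)
    finally show ?case by (simp add: u0)
  next
    case (Suc j)
    have IH: "u j = V.lc e {..p} (c j)" using Suc by simp
    have "\<rho> s (u j) = V.lc (\<lambda>i. e (Suc i)) {..p} (c j)"
      using s by (simp add: IH \<rho>_lc eS)
    also have "\<dots> = V.lc (\<lambda>i. e (Suc i)) {..<p} (c j)"
    proof -
      have "{..p} = insert p {..<p}" by auto
      moreover have "c j p = 0" using Suc.prems by (simp add: c_def binomial_eq_0)
      ultimately show ?thesis by (simp add: V.lc_insert)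
    qed
    also have "\<dots> = V.lc e {..p} (\<lambda>i. case i of 0 \<Rightarrow> 0 | Suc k \<Rightarrow> c j k)"
      by (simp add: V.lc_shift)
    finally have "u (Suc j) = V.lc e {..p} (\<lambda>i. (case i of 0 \<Rightarrow> 0 | Suc k \<Rightarrow> c j k) - c j i)"
      by (simp add: uS IH V.lc_diff)
    also have "\<dots> = V.lc e {..p} (c (Suc j))"
    proof (rule V.lc_cong)
      fix i
      have "(case i of 0 \<Rightarrow> 0 | Suc k \<Rightarrow> c j k) - c j i = c (Suc j) i"
        by (cases i) (auto simp: c_def algebra_simps)
      then show "[((case i of 0 \<Rightarrow> 0 | Suc k \<Rightarrow> c j k) - c j i)] \<cdot>\<^bsub>V\<^esub> e i = [c (Suc j) i] \<cdot>\<^bsub>V\<^esub> e i" by simp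
    qed auto
    finally show ?case .
  qed
  have "u p = V.lc e {..p} (c p)" by (rule ulc) simp
  also have "\<dots> = V.lc e {..p} (\<lambda>i. (if i = p then 1 else 0) - (if i = 0 then 1 else 0))"
  proof (rule V.lc_torsion[of e _ "int p"])
    fix i assume i: "i \<in> {..p}"
    have odd: "odd p" using prime_odd_nat[OF prime_p] p2 prime_ge_2_nat[OF prime_p] by simp
    show "[c p i = (if i = p then 1 else 0) - (if i = 0 then 1 else 0)] (mod int p)"
    proof (cases "i = 0 \<or> i = p")
      case True
      then show ?thesis using odd prime_gt_0_nat[OF prime_p] by (auto simp: c_def)
    next
      case False
      then have "p dvd p choose i" using i prime_p by (intro dvd_choose_prime) auto
      then have "int p dvd c p i" unfolding c_def by (intro dvd_mult) simp
      then show ?thesis using False by (simp add: cong_0_iff)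
    qed
  qed (use torsion in auto)
  also have "\<dots> = e p \<ominus>\<^bsub>V\<^esub> e 0"
    by (subst V.lc_diff) (simp_all add: V.lc_single)
  also have "\<dots> = \<zero>\<^bsub>V\<^esub>" using v WV by (simp add: V.minus_eq_zero_iff) (simp add: e_def)
  finally have up: "u p = \<zero>\<^bsub>V\<^esub>" .
  define j where "j = (LEAST j. u j = \<zero>\<^bsub>V\<^esub>)"
  have uj: "u j = \<zero>\<^bsub>V\<^esub>" unfolding j_def using up by (rule LeastI)
  with u0 v have "j \<noteq> 0" by (metis)
  then obtain k where k: "j = Suc k" by (cases j) auto
  have "u k \<noteq> \<zero>\<^bsub>V\<^esub>" using not_less_Least[of k "\<lambda>j. u j = \<zero>\<^bsub>V\<^esub>"] k by (auto simp: j_def)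
  moreover have "\<rho> s (u k) = u k"
    using uj uW[of k] s WV by (simp add: k uS V.minus_eq_zero_iff)
  ultimately show ?thesis using uW by blast
qed

lemma unipotent_of_prime_power_order:
  assumes s: "s \<in> carrier G" and W: "subgroup W (add_monoid V)" and Ws: "\<And>v. v \<in> W \<Longrightarrow> \<rho> s v \<in> W"
    and v: "v \<in> W" "v \<noteq> \<zero>\<^bsub>V\<^esub>" "\<rho> (s [^] (p ^ k)) v = v" and p2: "p \<noteq> 2"
  shows "\<exists>u\<in>W. u \<noteq> \<zero>\<^bsub>V\<^esub> \<and> \<rho> s u = u"
  using v
proof (induction k arbitrary: v)
  case 0
  then show ?case using s by auto
next
  case (Suc k)
  have WV: "u \<in> carrier V" if "u \<in> W" for u using subgroup.subset[OF W] that by auto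
  have pow: "\<rho> (s [^] n) x \<in> W" if "x \<in> W" for n :: nat and x
  proof (induction n)
    case (Suc n)
    have "s [^] Suc n = s \<otimes> s [^] n" using s by (metis nat_pow_Suc2)
    then show ?case using s that WV Suc Ws by (simp add: \<rho>_mult)
  qed (use that WV in simp)
  have "\<exists>u\<in>W. u \<noteq> \<zero>\<^bsub>V\<^esub> \<and> \<rho> (s [^] (p ^ k)) u = u"
    using Suc.prems s W pow p2
    by (intro unipotent_of_prime_order[where v = v]) (auto simp: nat_pow_pow mult.commute)
  then show ?case using Suc.IH by blast
qed

end

section \<open>Irreducible quotients of the permutation module\<close>

text \<open>
  An irreducible module without nonzero fixed vectors in which the stabilizer of \<open>x0\<close> fixes some \<open>v0 \<noteq> 0\<close>. By
  Frobenius reciprocity it is a quotient of the permutation module on \<open>X\<close>.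
\<close>

locale principal_series_rep = doubly_transitive_gset G X act p P x0 x1 t w \<theta> + torsion_rep G V p \<rho>
  for G (structure) and X act p P x0 x1 t w \<theta> and V (structure) and \<rho> +
  fixes v0
  assumes v0: "v0 \<in> carrier V" "v0 \<noteq> \<zero>\<^bsub>V\<^esub>"
    and v0_fixed: "\<lbrakk>b \<in> carrier G; act b x0 = x0\<rbrakk> \<Longrightarrow> \<rho> b v0 = v0"
    and irreducible: "\<lbrakk>subgroup W (add_monoid V); \<And>g u. \<lbrakk>g \<in> carrier G; u \<in> W\<rbrakk> \<Longrightarrow> \<rho> g u \<in> W\<rbrakk> \<Longrightarrow>
      W = {\<zero>\<^bsub>V\<^esub>} \<or> W = carrier V"
    and no_fixed: "\<lbrakk>u \<in> carrier V; \<And>g. g \<in> carrier G \<Longrightarrow> \<rho> g u = u\<rbrakk> \<Longrightarrow> u = \<zero>\<^bsub>V\<^esub>"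
begin

text \<open>
  The equivariant map from \<open>X\<close> to \<open>V\<close> with \<open>x0 \<mapsto> v0\<close>, and its linear extension to the permutation module.
\<close>

definition vec where "vec x = \<rho> (sect x) v0"

definition comb where "comb f = V.lc vec X f"

lemma vec_closed [simp]: "x \<in> X \<Longrightarrow> vec x \<in> carrier V"
  using v0 by (simp add: vec_def)

lemma vec_Pi [simp]: "vec \<in> X \<rightarrow> carrier V" by auto

lemma \<rho>_vec: "\<lbrakk>g \<in> carrier G; x \<in> X\<rbrakk> \<Longrightarrow> \<rho> g (vec x) = vec (act g x)"
  using v0 \<rho>_mult[of g "sect x" v0] \<rho>_mult[of "sect (act g x)" "jump g x" v0] v0_fixed[of "jump g x"]
  by (simp add: vec_def sect_jump)

lemma vec_x0: "vec x0 = v0"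
  by (simp add: vec_def v0_fixed)

lemma comb_closed [simp]: "comb f \<in> carrier V"
  by (simp add: comb_def)

lemma comb_add: "comb (\<lambda>x. f x + g x) = comb f \<oplus>\<^bsub>V\<^esub> comb g"
  by (simp add: comb_def V.lc_add)

lemma comb_diff: "comb (\<lambda>x. f x - g x) = comb f \<ominus>\<^bsub>V\<^esub> comb g"
  by (simp add: comb_def V.lc_diff)

lemma comb_mult: "comb (\<lambda>x. k * f x) = [k] \<cdot>\<^bsub>V\<^esub> comb f"
  by (simp add: comb_def V.lc_mult)

lemma comb_cong: "(\<And>x. x \<in> X \<Longrightarrow> [f x = g x] (mod int p)) \<Longrightarrow> comb f = comb g"
  unfolding comb_def by (rule V.lc_torsion[of _ _ "int p"]) (auto simp: torsion)

lemma comb_single: "x \<in> X \<Longrightarrow> comb (\<lambda>y. if y = x then k else 0) = [k] \<cdot>\<^bsub>V\<^esub> vec x"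
  by (simp add: comb_def V.lc_single finite_X)

lemma \<rho>_comb: 
  assumes g: "g \<in> carrier G" shows "\<rho> g (comb f) = comb (\<lambda>x. f (act (inv g) x))"
proof -
  have im: "act g ` X = X" and inj: "inj_on (act g) X"
    using bij_betw_act[OF g] by (auto simp: bij_betw_def)
  have "comb (\<lambda>x. f (act (inv g) x)) = V.lc vec (act g ` X) (\<lambda>x. f (act (inv g) x))"
    by (simp add: comb_def im)
  also have "\<dots> = V.lc (\<lambda>x. vec (act g x)) X (\<lambda>x. f (act (inv g) (act g x)))"
    using g inj by (subst V.lc_reindex) (auto simp: im)
  also have "\<dots> = V.lc (\<lambda>x. \<rho> g (vec x)) X f"
    using g by (intro V.lc_cong) (auto simp: \<rho>_vec)
  finally show ?thesis using g by (simp add: comb_def \<rho>_lc)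
qed

lemma comb_surj: 
  assumes "u \<in> carrier V" shows "\<exists>f. u = comb f"
proof -
  have "subgroup (range comb) (add_monoid V)"
  proof (rule V.add.subgroupI)
    show "range comb \<subseteq> carrier V" "range comb \<noteq> {}" by auto
    fix a assume "a \<in> range comb"
    then obtain f where "a = comb f" by auto
    then have "\<ominus>\<^bsub>V\<^esub> a = comb (\<lambda>x. - f x)" by (simp add: comb_def V.lc_uminus)
    then show "\<ominus>\<^bsub>V\<^esub> a \<in> range comb" by simp
    fix b assume "b \<in> range comb"
    then show "a \<oplus>\<^bsub>V\<^esub> b \<in> range comb" using \<open>a = comb f\<close> by (auto simp flip: comb_add)
  qed
  moreover have "\<rho> g a \<in> range comb" if "g \<in> carrier G" "a \<in> range comb" for g a
    using that \<rho>_comb by auto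
  moreover have "v0 \<in> range comb"
    using comb_single[of x0 1] v0 by (simp add: vec_x0) (metis rangeI)
  ultimately have "range comb = carrier V" using irreducible[of "range comb"] v0 by blast
  then show ?thesis using assms by auto
qed

text \<open>
  A constant function is invariant, and \<open>V\<close> has no nonzero fixed vectors.
\<close>

lemma comb_const: "comb (\<lambda>x. c) = \<zero>\<^bsub>V\<^esub>"
  by (rule no_fixed) (auto simp: \<rho>_comb)

text \<open>
  Summing the translates of \<open>f\<close> under \<open>H\<close> gives a function \<open>F\<close> that is constant outside \<open>x0\<close>, because \<open>H\<close> is
  transitive there. Since constants are killed, \<open>comb F\<close> is \<open>F x0 - F x1\<close> times \<open>v0\<close>; so \<open>F x0 = F x1\<close> modulo \<open>p\<close>.
  In terms of \<open>f\<close>, this says that \<open>f x0\<close> is the sum of the other values of \<open>f\<close>.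
\<close>

lemma comb_eq_zero_base:
  assumes f: "comb f = \<zero>\<^bsub>V\<^esub>" shows "[2 * f x0 = (\<Sum>x\<in>X. f x)] (mod int p)"
proof -
  define F where "F x = (\<Sum>h\<in>H. f (act h x))" for x
  have Hcl: "h \<in> carrier G" "act h x0 = x0" if "h \<in> H" for h using that by (auto simp: H_def)
  have F0: "F x0 = int (card H) * f x0" using Hcl by (simp add: F_def)
  have FH: "F (act k x) = F x" if k: "k \<in> H" and x: "x \<in> X" for k x
  proof -
    have "bij_betw (\<lambda>h. h \<otimes> k) H H"
      using k H_mult H_inv Hcl by (intro bij_betw_byWitness[of _ "\<lambda>h. h \<otimes> inv k"]) (auto simp: m_assoc)
    from sum.reindex_bij_betw[OF this, of "\<lambda>h. f (act h x)"] have
      "F x = (\<Sum>h\<in>H. f (act (h \<otimes> k) x))" by (simp add: F_def)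
    also have "\<dots> = F (act k x)" using k x Hcl by (simp add: F_def act_mult)
    finally show ?thesis by simp
  qed
  have F1: "F x = F x1" if x: "x \<in> X - {x0}" for x
  proof -
    obtain h where "h \<in> carrier G" "act h x0 = x0" "int P dvd \<theta> h" "act h x1 = x"
      using kernel_transitive[of x] x by auto
    then have "h \<in> H" "act h x1 = x" by (auto simp: H_def)
    then show ?thesis using FH[of h x1] by simp
  qed
  have comb0: "comb (\<lambda>x. f (act h x)) = \<zero>\<^bsub>V\<^esub>" if "h \<in> H" for h
    using \<rho>_comb[of "inv h" f] that Hcl f by simp
  have "comb F = \<zero>\<^bsub>V\<^esub>"
    unfolding F_def comb_def by (rule V.lc_sum_zero) (use comb0 in \<open>auto simp: comb_def\<close>)
  moreover have "comb F = comb (\<lambda>x. F x1 + (if x = x0 then F x0 - F x1 else 0))"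
    using F1 by (intro comb_cong) auto
  ultimately have "[(F x0 - F x1)] \<cdot>\<^bsub>V\<^esub> v0 = \<zero>\<^bsub>V\<^esub>"
    using v0 by (simp add: comb_add comb_const comb_single vec_x0)
  then have d: "int p dvd F x0 - F x1" using torsion_dvd v0 by blast
  have "[F x1 = (\<Sum>x\<in>X - {x0}. F x1)] (mod int p)" 
    using sum_fibre_const[of x0 "F x1"] by (simp add: cong_sym_eq)
  also have "(\<Sum>x\<in>X - {x0}. F x1) = (\<Sum>x\<in>X - {x0}. F x)"
    by (intro sum.cong refl F1[symmetric])
  also have "(\<Sum>x\<in>X - {x0}. F x) = (\<Sum>x\<in>X. F x) - F x0"
    using finite_X base(1) by (simp only: sum_diff1 if_True)
  also have "(\<Sum>x\<in>X. F x) = int (card H) * (\<Sum>x\<in>X. f x)"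
  proof -
    have "(\<Sum>x\<in>X. F x) = (\<Sum>h\<in>H. \<Sum>x\<in>X. f (act h x))" unfolding F_def by (rule sum.swap)
    also have "\<dots> = (\<Sum>h\<in>H. \<Sum>x\<in>X. f x)" using Hcl sum_act by simp
    finally show ?thesis by simp
  qed
  finally have "int p dvd F x1 - (int (card H) * (\<Sum>x\<in>X. f x) - F x0)" by (simp add: cong_iff_dvd_diff)
  from dvd_add[OF this d] have "int p dvd int (card H) * (2 * f x0 - (\<Sum>x\<in>X. f x))"
    by (simp add: F0 algebra_simps)
  then have "int p dvd int (card H) \<or> int p dvd 2 * f x0 - (\<Sum>x\<in>X. f x)"
    using prime_p by (simp add: prime_dvd_mult_iff)
  then show ?thesis using card_H by (simp add: cong_iff_dvd_diff int_dvd_int_iff)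
qed

lemma comb_eq_zero:
  assumes f: "comb f = \<zero>\<^bsub>V\<^esub>" and x: "x \<in> X" shows "[2 * f x = (\<Sum>y\<in>X. f y)] (mod int p)"
proof -
  have "comb (\<lambda>y. f (act (sect x) y)) = \<zero>\<^bsub>V\<^esub>"
    using \<rho>_comb[of "inv (sect x)" f] f x by simp
  from comb_eq_zero_base[OF this] show ?thesis using x sum_act[of "sect x" f] by simp
qed

text \<open>
  By \<open>comb_eq_zero\<close> the kernel of \<open>comb\<close> consists of functions that are constant modulo \<open>p\<close>. Since the
  number of points is \<open>2\<close> modulo \<open>p\<close>, the function \<open>2 f x - \<Sum>y. f y\<close> depends modulo \<open>p\<close> only on \<open>comb f\<close>.
  It is, up to the factor \<open>2\<close>, the embedding of \<open>V\<close> as the functions with sum \<open>0\<close> in the permutation module.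
\<close>

definition coord :: "_ \<Rightarrow> _ \<Rightarrow> int" where
  "coord u x = (let f = (SOME f. u = comb f) in 2 * f x - (\<Sum>y\<in>X. f y))"

lemma coord_comb:
  assumes x: "x \<in> X" shows "[coord (comb f) x = 2 * f x - (\<Sum>y\<in>X. f y)] (mod int p)"
proof -
  define f' where "f' = (SOME f'. comb f = comb f')"
  have "comb f = comb f'" unfolding f'_def by (rule someI[of _ f]) simp
  then have "comb (\<lambda>x. f' x - f x) = \<zero>\<^bsub>V\<^esub>"
    using V.r_neg[of "comb f'"] by (simp add: comb_diff V.minus_eq)
  from comb_eq_zero[OF this x] have "int p dvd 2 * (f' x - f x) - (\<Sum>y\<in>X. f' y - f y)"
    by (simp add: cong_iff_dvd_diff)
  then show ?thesis
    by (simp add: coord_def f'_def[symmetric] cong_iff_dvd_diff sum_subtractf algebra_simps)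
qed

lemma comb_coord: 
  assumes "u \<in> carrier V" shows "comb (coord u) = [(2::int)] \<cdot>\<^bsub>V\<^esub> u"
proof -
  obtain f where u: "u = comb f" using comb_surj assms by blast
  have "comb (coord u) = comb (\<lambda>x. 2 * f x - (\<Sum>y\<in>X. f y))"
    unfolding u by (intro comb_cong coord_comb)
  then show ?thesis by (simp add: comb_diff comb_mult comb_const u V.minus_eq)
qed

lemma coord_add:
  assumes "u \<in> carrier V" "v \<in> carrier V" "x \<in> X"
  shows "[coord (u \<oplus>\<^bsub>V\<^esub> v) x = coord u x + coord v x] (mod int p)"
proof -
  obtain f g where u: "u = comb f" "v = comb g" using comb_surj assms by metis
  have "[coord (comb (\<lambda>x. f x + g x)) x = 2 * (f x + g x) - (\<Sum>y\<in>X. f y + g y)] (mod int p)"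
    by (rule coord_comb) fact
  also have "2 * (f x + g x) - (\<Sum>y\<in>X. f y + g y) = (2 * f x - (\<Sum>y\<in>X. f y)) + (2 * g x - (\<Sum>y\<in>X. g y))"
    by (simp add: sum.distrib)
  also have "[(2 * f x - (\<Sum>y\<in>X. f y)) + (2 * g x - (\<Sum>y\<in>X. g y)) = coord u x + coord v x] (mod int p)"
    unfolding u using assms by (intro cong_add cong_sym[OF coord_comb])
  finally show ?thesis by (simp add: u comb_add)
qed

lemma coord_\<rho>:
  assumes "g \<in> carrier G" "u \<in> carrier V" "x \<in> X"
  shows "[coord (\<rho> g u) (act g x) = coord u x] (mod int p)"
proof -
  obtain f where u: "u = comb f" using comb_surj assms by blast
  have "[coord (\<rho> g u) (act g x) = 2 * f x - (\<Sum>y\<in>X. f (act (inv g) y))] (mod int p)"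
    using coord_comb[of "act g x" "\<lambda>x. f (act (inv g) x)"] assms by (simp add: u \<rho>_comb)
  also have "(\<Sum>y\<in>X. f (act (inv g) y)) = (\<Sum>y\<in>X. f y)"
    using assms by (intro sum_act) simp
  also have "[2 * f x - (\<Sum>y\<in>X. f y) = coord u x] (mod int p)"
    unfolding u using assms by (intro cong_sym[OF coord_comb])
  finally show ?thesis .
qed

end

section \<open>Cohomology\<close>

context torsion_rep
begin

lemma carrier_cochains: "carrier (cochains G V n) = tuples G n \<rightarrow>\<^sub>E carrier V"
  by (simp add: cochains_def)

lemma mult_cochains: "f \<otimes>\<^bsub>cochains G V n\<^esub> g = (\<lambda>xs\<in>tuples G n. f xs \<oplus>\<^bsub>V\<^esub> g xs)"
  by (simp add: cochains_def)

lemma one_cochains: "\<one>\<^bsub>cochains G V n\<^esub> = (\<lambda>xs\<in>tuples G n. \<zero>\<^bsub>V\<^esub>)"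
  by (simp add: cochains_def)

lemma group_cochains: "group (cochains G V n)"
  by (simp add: cochains_def V.a_group)

lemma tuples_0: "tuples G 0 = {[]}"
  by (auto simp: tuples_def)

lemma tuples_Suc: "xs \<in> tuples G (Suc n) \<longleftrightarrow> (\<exists>g ys. xs = g # ys \<and> g \<in> carrier G \<and> ys \<in> tuples G n)"
  by (auto simp: tuples_def length_Suc_conv)

lemma tuples_1: "xs \<in> tuples G 1 \<longleftrightarrow> (\<exists>g\<in>carrier G. xs = [g])"
  using tuples_Suc[of xs 0] by (auto simp: tuples_0)

lemma tuples_2: "xs \<in> tuples G 2 \<longleftrightarrow> (\<exists>g\<in>carrier G. \<exists>h\<in>carrier G. xs = [g, h])"
  using tuples_Suc[of xs 1] tuples_1 by (auto simp: numeral_2_eq_2)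

lemma tuples_3: "xs \<in> tuples G 3 \<longleftrightarrow> (\<exists>g\<in>carrier G. \<exists>h\<in>carrier G. \<exists>k\<in>carrier G. xs = [g, h, k])"
  using tuples_Suc[of xs 2] tuples_2 by (auto simp: numeral_3_eq_3 numeral_2_eq_2)

lemma merge_at_closed: "\<lbrakk>xs \<in> tuples G (Suc n); i < n\<rbrakk> \<Longrightarrow> merge_at G i xs \<in> tuples G n"
  by (auto simp: tuples_def merge_at_def subset_iff dest: in_set_takeD in_set_dropD intro!: m_closed)

lemma tl_closed: "xs \<in> tuples G (Suc n) \<Longrightarrow> tl xs \<in> tuples G n"
  by (auto simp: tuples_Suc)

lemma hd_closed: "xs \<in> tuples G (Suc n) \<Longrightarrow> hd xs \<in> carrier G"
  by (auto simp: tuples_Suc)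

lemma butlast_closed: "xs \<in> tuples G (Suc n) \<Longrightarrow> butlast xs \<in> tuples G n"
  by (auto simp: tuples_def dest: in_set_butlastD)

lemma cochain_closed: "\<lbrakk>f \<in> carrier (cochains G V n); xs \<in> tuples G n\<rbrakk> \<Longrightarrow> f xs \<in> carrier V"
  by (auto simp: carrier_cochains)

lemma coboundary_map_hom: "coboundary_map G V \<rho> n \<in> hom (cochains G V n) (cochains G V (Suc n))"
proof (rule homI)
  fix f assume f: "f \<in> carrier (cochains G V n)"
  note cl = cochain_closed[OF f]
  have "(\<Oplus>\<^bsub>V\<^esub>i\<in>{..<n}. [((-1) ^ Suc i :: int)] \<cdot>\<^bsub>V\<^esub> f (merge_at G i xs)) \<in> carrier V"
    if "xs \<in> tuples G (Suc n)" for xs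
    using that by (intro V.finsum_closed) (auto intro!: cl merge_at_closed)
  then show "coboundary_map G V \<rho> n f \<in> carrier (cochains G V (Suc n))"
    unfolding carrier_cochains coboundary_map_def
    by (auto intro!: V.add.m_closed V.add.int_pow_closed cl \<rho>_closed hd_closed tl_closed butlast_closed)
  fix g assume g: "g \<in> carrier (cochains G V n)"
  note cl' = cochain_closed[OF g]
  have "coboundary_map G V \<rho> n (\<lambda>xs\<in>tuples G n. f xs \<oplus>\<^bsub>V\<^esub> g xs) xs =
      coboundary_map G V \<rho> n f xs \<oplus>\<^bsub>V\<^esub> coboundary_map G V \<rho> n g xs" if xs: "xs \<in> tuples G (Suc n)" for xs
  proof -
    let ?m = "\<lambda>f i. [((-1) ^ Suc i :: int)] \<cdot>\<^bsub>V\<^esub> f (merge_at G i xs)"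
    have m: "(\<Oplus>\<^bsub>V\<^esub>i\<in>{..<n}. ?m (\<lambda>xs\<in>tuples G n. f xs \<oplus>\<^bsub>V\<^esub> g xs) i)
        = (\<Oplus>\<^bsub>V\<^esub>i\<in>{..<n}. ?m f i) \<oplus>\<^bsub>V\<^esub> (\<Oplus>\<^bsub>V\<^esub>i\<in>{..<n}. ?m g i)"
    proof -
      have "(\<Oplus>\<^bsub>V\<^esub>i\<in>{..<n}. ?m (\<lambda>xs\<in>tuples G n. f xs \<oplus>\<^bsub>V\<^esub> g xs) i)
        = (\<Oplus>\<^bsub>V\<^esub>i\<in>{..<n}. ?m f i \<oplus>\<^bsub>V\<^esub> ?m g i)"
        by (intro V.finsum_cong') (auto simp: merge_at_closed[OF xs] V.add.int_pow_distrib cl cl')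
      also have "\<dots> = (\<Oplus>\<^bsub>V\<^esub>i\<in>{..<n}. ?m f i) \<oplus>\<^bsub>V\<^esub> (\<Oplus>\<^bsub>V\<^esub>i\<in>{..<n}. ?m g i)"
        by (intro V.finsum_addf) (auto simp: merge_at_closed[OF xs] cl cl')
      finally show ?thesis .
    qed
    have mc: "(\<Oplus>\<^bsub>V\<^esub>i\<in>{..<n}. ?m f i) \<in> carrier V" "(\<Oplus>\<^bsub>V\<^esub>i\<in>{..<n}. ?m g i) \<in> carrier V"
      using xs by (auto intro!: V.finsum_closed cl cl' merge_at_closed)
    show ?thesis
      using xs mc hd_closed[OF xs] tl_closed[OF xs] butlast_closed[OF xs]
        cl[OF tl_closed[OF xs]] cl[OF butlast_closed[OF xs]] cl'[OF tl_closed[OF xs]] cl'[OF butlast_closed[OF xs]]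
      unfolding coboundary_map_def restrict_apply'[OF xs] m
      by (simp add: \<rho>_add V.add.int_pow_distrib V.a_ac)
  qed
  then show "coboundary_map G V \<rho> n (f \<otimes>\<^bsub>cochains G V n\<^esub> g) =
    coboundary_map G V \<rho> n f \<otimes>\<^bsub>cochains G V (Suc n)\<^esub> coboundary_map G V \<rho> n g"
    unfolding mult_cochains by (intro ext) (auto simp: coboundary_map_def)
qed

lemma cochains_group_hom: "group_hom (cochains G V n) (cochains G V (Suc n)) (coboundary_map G V \<rho> n)"
  using coboundary_map_hom group_cochains
  by (simp add: group_hom_def group_hom_axioms_def)

lemma cocycles_subgroup: "subgroup (cocycles G V \<rho> n) (cochains G V n)"
  unfolding cocycles_def by (rule group_hom.subgroup_kernel[OF cochains_group_hom])

text \<open>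
  A homomorphism \<open>\<phi>\<close> from the cocycles to \<open>F\<^sub>p\<close> that is not zero is surjective, and if its kernel consists of the
  coboundaries, the first isomorphism theorem computes the cohomology group.
\<close>

lemma cohomology_iso_Zp:
  fixes \<phi> :: "(_ list \<Rightarrow> _) \<Rightarrow> int"
  assumes add: "\<And>c d. \<lbrakk>c \<in> cocycles G V \<rho> n; d \<in> cocycles G V \<rho> n\<rbrakk> \<Longrightarrow>
      [\<phi> (c \<otimes>\<^bsub>cochains G V n\<^esub> d) = \<phi> c + \<phi> d] (mod int p)"
    and nontrivial: "\<exists>c\<in>cocycles G V \<rho> n. \<not> int p dvd \<phi> c"
    and cob: "coboundaries G V \<rho> n = {c \<in> cocycles G V \<rho> n. int p dvd \<phi> c}"
  shows "group (group_cohomology n G V \<rho>)"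
    and "group_cohomology n G V \<rho> \<cong> add_monoid (residue_ring (int p))"
proof -
  let ?Z = "(cochains G V n)\<lparr>carrier := cocycles G V \<rho> n\<rparr>"
  let ?R = "residue_ring (int p)"
  interpret R: residues "int p" ?R
    using prime_gt_1_nat[OF prime_p] by unfold_locales auto
  interpret R: abelian_group ?R by (rule R.abelian_group)
  interpret Z: group ?Z
    by (rule group.subgroup_imp_group[OF group_cochains cocycles_subgroup])
  define h where "h c = \<phi> c mod int p" for c
  have hom: "h \<in> hom ?Z (add_monoid ?R)"
  proof (rule homI)
    fix c assume c: "c \<in> carrier ?Z"
    show "h c \<in> carrier (add_monoid ?R)"
      using prime_gt_0_nat[OF prime_p] by (simp add: R.res_carrier_eq h_def)
    fix d assume "d \<in> carrier ?Z"
    then show "h (c \<otimes>\<^bsub>?Z\<^esub> d) = h c \<otimes>\<^bsub>add_monoid ?R\<^esub> h d"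
      using add[of c d] c by (simp add: h_def R.res_add_eq cong_def mod_add_eq)
  qed
  interpret h: group_hom ?Z "add_monoid ?R" h
    using hom R.a_group by unfold_locales
  obtain c where c: "c \<in> cocycles G V \<rho> n" "\<not> int p dvd \<phi> c" using nontrivial by blast
  have pow: "c [^]\<^bsub>?Z\<^esub> k \<in> cocycles G V \<rho> n" for k :: nat
    using Z.nat_pow_closed[of c k] c by simp
  have \<phi>_pow: "[\<phi> (c [^]\<^bsub>?Z\<^esub> k) = int k * \<phi> c] (mod int p)" for k :: nat
  proof (induction k)
    case 0
    have "h \<one>\<^bsub>?Z\<^esub> = 0" using h.hom_one by (simp add: R.res_zero_eq)
    then show ?case by (simp add: h_def cong_def)
  next
    case (Suc k)
    have "[\<phi> (c [^]\<^bsub>?Z\<^esub> Suc k) = \<phi> (c [^]\<^bsub>?Z\<^esub> k) + \<phi> c] (mod int p)"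
      using add[OF pow[of k] c(1)] by simp
    also have "[\<phi> (c [^]\<^bsub>?Z\<^esub> k) + \<phi> c = int k * \<phi> c + \<phi> c] (mod int p)"
      by (intro cong_add Suc.IH cong_refl)
    finally show ?case by (simp add: algebra_simps)
  qed
  have surj: "h ` carrier ?Z = carrier (add_monoid ?R)"
  proof (intro equalityI subsetI)
    fix r assume r: "r \<in> carrier (add_monoid ?R)"
    have "coprime (\<phi> c) (int p)" using c prime_p by (simp add: prime_imp_coprime coprime_commute)
    then obtain x where x: "[\<phi> c * x = 1] (mod int p)" using cong_solve_coprime_int by blast
    define k where "k = nat ((x * r) mod int p)"
    have "int k = (x * r) mod int p" using prime_gt_0_nat[OF prime_p] by (simp add: k_def)
    then have "[int k = x * r] (mod int p)" by (simp add: cong_def)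
    then have "[int k * \<phi> c = x * r * \<phi> c] (mod int p)" by (rule cong_scalar_right)
    also have "x * r * \<phi> c = \<phi> c * x * r" by simp
    also have "[\<phi> c * x * r = 1 * r] (mod int p)" by (rule cong_scalar_right[OF x])
    finally have "[\<phi> (c [^]\<^bsub>?Z\<^esub> k) = 1 * r] (mod int p)" using \<phi>_pow cong_trans by blast
    then have "h (c [^]\<^bsub>?Z\<^esub> k) = r" using r by (simp add: h_def cong_def R.res_carrier_eq)
    then show "r \<in> h ` carrier ?Z" using pow[of k] by force
  qed (use h.hom_closed in auto)
  have ker: "kernel ?Z (add_monoid ?R) h = coboundaries G V \<rho> n"
    unfolding cob by (auto simp: kernel_def h_def R.res_zero_eq dvd_eq_mod_eq_0)
  have "?Z Mod kernel ?Z (add_monoid ?R) h \<cong> add_monoid ?R"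
    by (rule h.FactGroup_iso[OF surj])
  then show "group_cohomology n G V \<rho> \<cong> add_monoid ?R"
    by (simp only: ker group_cohomology_def)
  have "group (?Z Mod kernel ?Z (add_monoid ?R) h)"
    by (rule normal.factorgroup_is_group[OF h.normal_kernel])
  then show "group (group_cohomology n G V \<rho>)"
    by (simp only: ker group_cohomology_def)
qed

lemma int_neg1 [simp]: "v \<in> carrier V \<Longrightarrow> [(-1::int)] \<cdot>\<^bsub>V\<^esub> v = \<ominus>\<^bsub>V\<^esub> v"
  using V.add.int_pow_neg[of v 1] by simp

lemma coboundary_map_0:
  "\<lbrakk>f \<in> carrier (cochains G V 0); g \<in> carrier G\<rbrakk> \<Longrightarrow>
    coboundary_map G V \<rho> 0 f [g] = \<rho> g (f []) \<ominus>\<^bsub>V\<^esub> f []"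
  using cochain_closed[of f 0 "[]"] by (simp add: coboundary_map_def tuples_Suc tuples_0 V.minus_eq)

lemma coboundary_map_1:
  assumes f: "f \<in> carrier (cochains G V 1)" and gh: "g \<in> carrier G" "h \<in> carrier G"
  shows "coboundary_map G V \<rho> 1 f [g, h] = \<rho> g (f [h]) \<ominus>\<^bsub>V\<^esub> f [g \<otimes> h] \<oplus>\<^bsub>V\<^esub> f [g]"
proof -
  have "[g, h] \<in> tuples G (Suc 1)" using gh by (auto simp: tuples_def)
  moreover have "f [x] \<in> carrier V" if "x \<in> carrier G" for x
    using cochain_closed[OF f, of "[x]"] that by (auto simp: tuples_Suc tuples_0)
  ultimately show ?thesis using gh
    by (simp add: coboundary_map_def merge_at_def lessThan_Suc V.minus_eq)
qed

lemma coboundary_map_2: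
  assumes f: "f \<in> carrier (cochains G V 2)" and gh: "g \<in> carrier G" "h \<in> carrier G" "k \<in> carrier G"
  shows "coboundary_map G V \<rho> 2 f [g, h, k] = (\<rho> g (f [h, k]) \<oplus>\<^bsub>V\<^esub> f [g, h \<otimes> k])
      \<ominus>\<^bsub>V\<^esub> (f [g \<otimes> h, k] \<oplus>\<^bsub>V\<^esub> f [g, h])"
proof -
  have "[g, h, k] \<in> tuples G (Suc 2)" using gh by (auto simp: tuples_def)
  moreover have "f [x, y] \<in> carrier V" if "x \<in> carrier G" "y \<in> carrier G" for x y
    using cochain_closed[OF f, of "[x, y]"] that by (auto simp: tuples_2)
  moreover have "{..<2::nat} = {0, 1}" by auto
  ultimately show ?thesis using gh
    by (simp add: coboundary_map_def merge_at_def V.minus_eq V.minus_add V.a_ac numeral_2_eq_2)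
qed

lemma cocycles_1:
  "c \<in> cocycles G V \<rho> 1 \<longleftrightarrow> c \<in> carrier (cochains G V 1) \<and>
    (\<forall>g\<in>carrier G. \<forall>h\<in>carrier G. c [g \<otimes> h] = \<rho> g (c [h]) \<oplus>\<^bsub>V\<^esub> c [g])"
proof (cases "c \<in> carrier (cochains G V 1)")
  case True
  have cl: "c [x] \<in> carrier V" if "x \<in> carrier G" for x
    using cochain_closed[OF True, of "[x]"] that by (auto simp: tuples_Suc tuples_0)
  have iff: "coboundary_map G V \<rho> 1 c [g, h] = \<zero>\<^bsub>V\<^esub> \<longleftrightarrow> c [g \<otimes> h] = \<rho> g (c [h]) \<oplus>\<^bsub>V\<^esub> c [g]"
    if "g \<in> carrier G" "h \<in> carrier G" for g h
  proof -
    have "coboundary_map G V \<rho> 1 c [g, h] = (\<rho> g (c [h]) \<oplus>\<^bsub>V\<^esub> c [g]) \<ominus>\<^bsub>V\<^esub> c [g \<otimes> h]"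
      using True that cl by (simp add: coboundary_map_1 V.minus_eq V.a_ac del: One_nat_def)
    then show ?thesis
      using that cl V.minus_eq_zero_iff[of "\<rho> g (c [h]) \<oplus>\<^bsub>V\<^esub> c [g]" "c [g \<otimes> h]"] by auto
  qed
  have "c \<in> cocycles G V \<rho> 1 \<longleftrightarrow> (\<forall>xs\<in>tuples G (Suc 1). coboundary_map G V \<rho> 1 c xs = \<zero>\<^bsub>V\<^esub>)"
    using True hom_in_carrier[OF coboundary_map_hom True]
    by (auto simp: cocycles_def kernel_def one_cochains carrier_cochains fun_eq_iff PiE_def extensional_def)
  then show ?thesis using True iff tuples_2 by (auto simp: numeral_2_eq_2)
qed (auto simp: cocycles_def kernel_def)

lemma cocycles_1_closed:
  assumes "c \<in> cocycles G V \<rho> 1" "g \<in> carrier G" shows "c [g] \<in> carrier V"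
proof (rule cochain_closed)
  show "c \<in> carrier (cochains G V 1)" using assms(1) unfolding cocycles_1 by blast
  show "[g] \<in> tuples G 1" using assms(2) unfolding tuples_1 by blast
qed

lemma cocycles_2:
  "c \<in> cocycles G V \<rho> 2 \<longleftrightarrow> c \<in> carrier (cochains G V 2) \<and>
    (\<forall>g\<in>carrier G. \<forall>h\<in>carrier G. \<forall>k\<in>carrier G.
      \<rho> g (c [h, k]) \<oplus>\<^bsub>V\<^esub> c [g, h \<otimes> k] = c [g \<otimes> h, k] \<oplus>\<^bsub>V\<^esub> c [g, h])"
proof (cases "c \<in> carrier (cochains G V 2)")
  case True
  have cl: "c [x, y] \<in> carrier V" if "x \<in> carrier G" "y \<in> carrier G" for x y
    using cochain_closed[OF True, of "[x, y]"] that by (auto simp: tuples_2)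
  have iff: "coboundary_map G V \<rho> 2 c [g, h, k] = \<zero>\<^bsub>V\<^esub> \<longleftrightarrow>
      \<rho> g (c [h, k]) \<oplus>\<^bsub>V\<^esub> c [g, h \<otimes> k] = c [g \<otimes> h, k] \<oplus>\<^bsub>V\<^esub> c [g, h]"
    if "g \<in> carrier G" "h \<in> carrier G" "k \<in> carrier G" for g h k
    using True that cl by (simp add: coboundary_map_2 V.minus_eq_zero_iff)
  have "c \<in> cocycles G V \<rho> 2 \<longleftrightarrow> (\<forall>xs\<in>tuples G (Suc 2). coboundary_map G V \<rho> 2 c xs = \<zero>\<^bsub>V\<^esub>)"
    using True hom_in_carrier[OF coboundary_map_hom True]
    by (auto simp: cocycles_def kernel_def one_cochains carrier_cochains fun_eq_iff PiE_def extensional_def)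
  then show ?thesis using True iff tuples_3 by (auto simp: numeral_3_eq_3 numeral_2_eq_2)
qed (auto simp: cocycles_def kernel_def)

end

context principal_series_rep
begin

text \<open>
  The inverse of \<open>2\<close> modulo \<open>p\<close>, needed because \<open>comb \<circ> coord\<close> is multiplication by \<open>2\<close>.
\<close>

definition half :: int where "half = (int p + 1) div 2"

lemma double_half: "[half * 2 = 1] (mod int p)"
proof -
  have "odd p" using prime_odd_nat[OF prime_p] p_ne_2 prime_ge_2_nat[OF prime_p] by simp
  then have "half * 2 = int p + 1" unfolding half_def by (elim oddE) simp
  then show ?thesis by (simp add: cong_iff_dvd_diff)
qed

lemma comb_half:
  assumes u: "u \<in> carrier V" and f: "\<And>x. x \<in> X \<Longrightarrow> [f x = half * coord u x] (mod int p)"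
  shows "comb f = u"
proof -
  have "comb f = comb (\<lambda>x. half * coord u x)" using f by (rule comb_cong)
  also have "\<dots> = [half] \<cdot>\<^bsub>V\<^esub> ([(2::int)] \<cdot>\<^bsub>V\<^esub> u)" using u by (simp add: comb_mult comb_coord)
  also have "\<dots> = V.lc (\<lambda>_. u) {()} (\<lambda>_. half * 2)"
    using u by (simp add: V.lc_mult V.lc_insert)
  also have "\<dots> = V.lc (\<lambda>_. u) {()} (\<lambda>_. 1)"
    using u double_half by (intro V.lc_torsion[of _ _ "int p"]) (auto simp: torsion)
  also have "\<dots> = u" using u by (simp add: V.lc_insert)
  finally show ?thesis .
qed

lemma coord_diff_eq:
  assumes "u \<in> carrier V" "v \<in> carrier V" "x \<in> X" "u \<ominus>\<^bsub>V\<^esub> v = w'"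
  shows "[coord w' x = coord u x - coord v x] (mod int p)"
proof -
  have w': "w' \<in> carrier V" using assms by auto
  have "w' \<oplus>\<^bsub>V\<^esub> v = u" using assms(1,2) by (simp add: assms(4)[symmetric] V.minus_eq V.a_assoc V.l_neg)
  then have "[coord u x = coord w' x + coord v x] (mod int p)" using coord_add[OF w' assms(2,3)] by simp
  then show ?thesis by (simp add: cong_iff_dvd_diff algebra_simps dvd_diff_commute)
qed

lemma restrict_cochain: "(\<And>xs. xs \<in> tuples G n \<Longrightarrow> f xs \<in> carrier V) \<Longrightarrow>
    (\<lambda>xs\<in>tuples G n. f xs) \<in> carrier (cochains G V n)"
  by (auto simp: carrier_cochains)

lemma cochain_eqI:
  assumes "c \<in> carrier (cochains G V n)" "d \<in> carrier (cochains G V n)"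
    and "\<And>xs. xs \<in> tuples G n \<Longrightarrow> c xs = d xs"
  shows "c = d"
  using assms by (auto simp: carrier_cochains intro: PiE_ext)

lemma coboundary_map_closed: "f \<in> carrier (cochains G V n) \<Longrightarrow>
    coboundary_map G V \<rho> n f \<in> carrier (cochains G V (Suc n))"
  using coboundary_map_hom by (rule hom_in_carrier)

subsection \<open>Degree one\<close>

lemma coboundary_1_cocycle:
  assumes f: "f \<in> carrier (cochains G V 0)"
  shows "coboundary_map G V \<rho> 0 f \<in> cocycles G V \<rho> 1"
  unfolding cocycles_1
proof (intro conjI ballI)
  show "coboundary_map G V \<rho> 0 f \<in> carrier (cochains G V 1)"
    using coboundary_map_closed[OF f] by simp
  fix g h assume "g \<in> carrier G" "h \<in> carrier G"
  moreover have "f [] \<in> carrier V" using cochain_closed[OF f] by (simp add: tuples_0)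
  ultimately show "coboundary_map G V \<rho> 0 f [g \<otimes> h]
      = \<rho> g (coboundary_map G V \<rho> 0 f [h]) \<oplus>\<^bsub>V\<^esub> coboundary_map G V \<rho> 0 f [g]"
    using f \<rho>_int_pow[of g "f []" "-1"]
    by (simp add: coboundary_map_0 \<rho>_mult \<rho>_add V.minus_eq V.a_assoc V.r_neg1)
qed

text \<open>
  Through \<open>coord\<close>, cocycles with values in \<open>V\<close> become scalar cocycles on the action groupoid.
\<close>

lemma cocycle_1_scalar:
  assumes c: "c \<in> cocycles G V \<rho> 1"
  shows "cocycle1 (int p) (\<lambda>g x. coord (c [g]) (act g x))"
  unfolding cocycle1_def
proof (intro ballI)
  fix g h x assume gx: "g \<in> carrier G" "h \<in> carrier G" "x \<in> X"
  have cl: "c [x] \<in> carrier V" if "x \<in> carrier G" for x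
    using c that by (rule cocycles_1_closed)
  have "c [g \<otimes> h] = \<rho> g (c [h]) \<oplus>\<^bsub>V\<^esub> c [g]" using c gx unfolding cocycles_1 by blast
  then have "[coord (c [g \<otimes> h]) (act g (act h x))
      = coord (\<rho> g (c [h])) (act g (act h x)) + coord (c [g]) (act g (act h x))] (mod int p)"
    using coord_add[of "\<rho> g (c [h])" "c [g]" "act g (act h x)"] gx cl by simp
  also have "[coord (\<rho> g (c [h])) (act g (act h x)) + coord (c [g]) (act g (act h x))
      = coord (c [h]) (act h x) + coord (c [g]) (act g (act h x))] (mod int p)"
    using gx cl by (intro cong_add coord_\<rho> cong_refl) auto
  finally show "[coord (c [g \<otimes> h]) (act (g \<otimes> h) x)
      = coord (c [g]) (act g (act h x)) + coord (c [h]) (act h x)] (mod int p)"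
    using gx by (simp add: act_mult add.commute)
qed

text \<open>
  The isomorphism to \<open>F\<^sub>p\<close> is the class at \<open>t\<close> of the coordinate at \<open>x0\<close>. A cocycle in its kernel is a coboundary
  of a function on \<open>X\<close>, hence of a vector. A cocycle outside the kernel is the image in \<open>V\<close> of the coinduced one:
  by \<open>coord_comb\<close> its class is twice the class of the latter, minus the class of its sum over \<open>X\<close>, which is \<open>0\<close>.
\<close>

theorem cohomology_1:
  "group (group_cohomology 1 G V \<rho>)" "group_cohomology 1 G V \<rho> \<cong> add_monoid (residue_ring (int p))"
proof -
  define \<phi> where "\<phi> c = coord (c [t]) x0" for c :: "_ list \<Rightarrow> _"
  have cl: "c [g] \<in> carrier V" if "c \<in> cocycles G V \<rho> 1" "g \<in> carrier G" for c g
    using that by (rule cocycles_1_closed)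
  have add: "[\<phi> (c \<otimes>\<^bsub>cochains G V 1\<^esub> d) = \<phi> c + \<phi> d] (mod int p)"
    if "c \<in> cocycles G V \<rho> 1" "d \<in> cocycles G V \<rho> 1" for c d
    using coord_add[of "c [t]" "d [t]" x0] cl that
    by (simp add: \<phi>_def mult_cochains tuples_Suc tuples_0)
  have cob0: "int p dvd \<phi> c" if c: "c \<in> coboundaries G V \<rho> 1" for c
  proof -
    obtain f where f: "f \<in> carrier (cochains G V 0)" "c = coboundary_map G V \<rho> 0 f"
      using c by auto
    have f0: "f [] \<in> carrier V" using cochain_closed[OF f(1)] by (simp add: tuples_0)
    have "[\<phi> c = coord (\<rho> t (f [])) x0 - coord (f []) x0] (mod int p)"
      unfolding \<phi>_def using f f0 by (intro coord_diff_eq) (auto simp: coboundary_map_0)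
    also have "[coord (\<rho> t (f [])) x0 - coord (f []) x0 = coord (f []) x0 - coord (f []) x0] (mod int p)"
      using coord_\<rho>[of t "f []" x0] f0 by (intro cong_diff cong_refl) simp
    finally show ?thesis by (simp add: cong_0_iff)
  qed
  have cob1: "c \<in> coboundaries G V \<rho> 1" if c: "c \<in> cocycles G V \<rho> 1" and d: "int p dvd \<phi> c" for c
  proof -
    obtain a where a: "\<And>g x. \<lbrakk>g \<in> carrier G; x \<in> X\<rbrakk> \<Longrightarrow>
        [coord (c [g]) (act g x) = a (act g x) - a x] (mod int p)"
      using cocycle1_coboundary[OF cocycle_1_scalar[OF c]] d by (auto simp: \<phi>_def cong_0_iff)
    define v where "v = comb (\<lambda>x. - half * a x)"
    define f where "f = (\<lambda>xs\<in>tuples G 0. v)"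
    have f: "f \<in> carrier (cochains G V 0)" unfolding f_def by (rule restrict_cochain) (simp add: v_def)
    have fv: "f [] = v" by (simp add: f_def tuples_0)
    have "c = coboundary_map G V \<rho> 0 f"
    proof (rule cochain_eqI[of _ 1])
      show "c \<in> carrier (cochains G V 1)" using c unfolding cocycles_1 by blast
      show "coboundary_map G V \<rho> 0 f \<in> carrier (cochains G V 1)" using coboundary_map_closed[OF f] by simp
      fix xs assume "xs \<in> tuples G 1"
      then obtain g where g: "g \<in> carrier G" "xs = [g]" by (auto simp: tuples_Suc tuples_0)
      have "\<rho> g v \<ominus>\<^bsub>V\<^esub> v = comb (\<lambda>y. - half * a (act (inv g) y) - (- half * a y))"
        unfolding v_def comb_diff using g by (simp add: \<rho>_comb)
      also have "\<dots> = c [g]"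
      proof (rule comb_half)
        fix y assume y: "y \<in> X"
        have "[half * coord (c [g]) y = half * (a y - a (act (inv g) y))] (mod int p)"
          using a[of g "act (inv g) y"] g y by (intro cong_scalar_left) simp
        then show "[- half * a (act (inv g) y) - (- half * a y) = half * coord (c [g]) y] (mod int p)"
          by (subst cong_sym_eq) (simp add: algebra_simps)
      qed (use cl c g in auto)
      finally show "c xs = coboundary_map G V \<rho> 0 f xs"
        using g f by (simp add: coboundary_map_0 fv)
    qed
    then show ?thesis using f by simp
  qed
  have nontrivial: "\<exists>c\<in>cocycles G V \<rho> 1. \<not> int p dvd \<phi> c"
  proof -
    obtain C where C: "cocycle1 (int p) C" "[C t x0 = 1] (mod int p)" "[(\<Sum>x\<in>X. C t x) = 0] (mod int p)"
      using exists_cocycle1 by blast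
    define c where "c = (\<lambda>xs\<in>tuples G 1. comb (\<lambda>y. C (hd xs) (act (inv (hd xs)) y)))"
    have cg: "c [g] = comb (\<lambda>y. C g (act (inv g) y))" if "g \<in> carrier G" for g
      using that by (simp add: c_def tuples_Suc tuples_0)
    have "c \<in> cocycles G V \<rho> 1"
      unfolding cocycles_1
    proof (intro conjI ballI)
      show "c \<in> carrier (cochains G V 1)" unfolding c_def by (rule restrict_cochain) simp
      fix g h assume gh: "g \<in> carrier G" "h \<in> carrier G"
      have "c [g \<otimes> h] = comb (\<lambda>y. C h (act (inv h) (act (inv g) y)) + C g (act (inv g) y))"
        unfolding cg[OF m_closed[OF gh]]
      proof (rule comb_cong)
        fix y assume y: "y \<in> X"
        define x where "x = act (inv h) (act (inv g) y)"
        have x: "x \<in> X" "act (inv (g \<otimes> h)) y = x" "act (inv g) y = act h x"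
          using gh y by (simp_all add: x_def inv_mult_group act_mult)
        show "[C (g \<otimes> h) (act (inv (g \<otimes> h)) y)
            = C h (act (inv h) (act (inv g) y)) + C g (act (inv g) y)] (mod int p)"
          using C(1) gh x by (simp add: x(3) cocycle1_def add.commute)
      qed
      then show "c [g \<otimes> h] = \<rho> g (c [h]) \<oplus>\<^bsub>V\<^esub> c [g]"
        using gh by (simp add: cg \<rho>_comb comb_add)
    qed
    moreover have "\<not> int p dvd \<phi> c"
    proof -
      have tx: "act (inv t) x0 = x0" by (simp add: act_inv_fixed)
      have "[\<phi> c = 2 * C t (act (inv t) x0) - (\<Sum>y\<in>X. C t (act (inv t) y))] (mod int p)"
        unfolding \<phi>_def cg[OF t(1)] by (rule coord_comb) simp
      also have "(\<Sum>y\<in>X. C t (act (inv t) y)) = (\<Sum>x\<in>X. C t x)"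
        by (rule sum_act) simp
      also have "[2 * C t (act (inv t) x0) - (\<Sum>x\<in>X. C t x) = 2 * 1 - 0] (mod int p)"
        unfolding tx by (intro cong_diff cong_scalar_left C)
      finally have "[\<phi> c = 2 * 1] (mod int p)" by simp
      moreover have "\<not> int p dvd 2 * 1"
        by (rule not_p_dvd_double) (use prime_gt_1_nat[OF prime_p] in simp)
      ultimately show ?thesis by (simp add: cong_dvd_iff)
    qed
    ultimately show ?thesis by blast
  qed
  have cob: "coboundaries G V \<rho> 1 = {c \<in> cocycles G V \<rho> 1. int p dvd \<phi> c}"
    using cob0 cob1 coboundary_1_cocycle by auto
  show "group (group_cohomology 1 G V \<rho>)" "group_cohomology 1 G V \<rho> \<cong> add_monoid (residue_ring (int p))"
    using cohomology_iso_Zp[OF add nontrivial cob] by auto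
qed

subsection \<open>Degree two\<close>

lemma coboundary_2_cocycle:
  assumes f: "f \<in> carrier (cochains G V 1)"
  shows "coboundary_map G V \<rho> 1 f \<in> cocycles G V \<rho> 2"
  unfolding cocycles_2
proof (intro conjI ballI)
  show "coboundary_map G V \<rho> 1 f \<in> carrier (cochains G V 2)"
    using coboundary_map_closed[OF f] by (simp add: numeral_2_eq_2)
  fix g h k assume gh: "g \<in> carrier G" "h \<in> carrier G" "k \<in> carrier G"
  have cl: "f [x] \<in> carrier V" if "x \<in> carrier G" for x
    using cochain_closed[OF f, of "[x]"] that by (auto simp: tuples_Suc tuples_0)
  have \<rho>m: "\<rho> x (\<ominus>\<^bsub>V\<^esub> v) = \<ominus>\<^bsub>V\<^esub> \<rho> x v" if "x \<in> carrier G" "v \<in> carrier V" for x v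
    using \<rho>_int_pow[of x v "-1"] that by simp
  define a b c d e where "a = \<rho> g (\<rho> h (f [k]))" "b = \<rho> g (f [h \<otimes> k])" "c = \<rho> g (f [h])"
    "d = f [g \<otimes> (h \<otimes> k)]" "e = f [g \<otimes> h]"
  have "a \<in> carrier V" "b \<in> carrier V" "c \<in> carrier V" "d \<in> carrier V" "e \<in> carrier V"
    using gh cl by (auto simp: a_b_c_d_e_def)
  note V_closed = this cl[OF gh(1)] V.a_closed V.a_inv_closed
  have "(a \<ominus>\<^bsub>V\<^esub> b \<oplus>\<^bsub>V\<^esub> c) \<oplus>\<^bsub>V\<^esub> (b \<ominus>\<^bsub>V\<^esub> d \<oplus>\<^bsub>V\<^esub> f [g])
      = (a \<oplus>\<^bsub>V\<^esub> c \<oplus>\<^bsub>V\<^esub> (\<ominus>\<^bsub>V\<^esub> d \<oplus>\<^bsub>V\<^esub> f [g])) \<oplus>\<^bsub>V\<^esub> (b \<oplus>\<^bsub>V\<^esub> \<ominus>\<^bsub>V\<^esub> b)"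
    by (simp only: V.minus_eq V.a_ac V_closed)
  also have "\<dots> = (a \<oplus>\<^bsub>V\<^esub> c \<oplus>\<^bsub>V\<^esub> (\<ominus>\<^bsub>V\<^esub> d \<oplus>\<^bsub>V\<^esub> f [g])) \<oplus>\<^bsub>V\<^esub> (e \<oplus>\<^bsub>V\<^esub> \<ominus>\<^bsub>V\<^esub> e)"
    by (simp only: V.r_neg V_closed)
  also have "\<dots> = (a \<ominus>\<^bsub>V\<^esub> d \<oplus>\<^bsub>V\<^esub> e) \<oplus>\<^bsub>V\<^esub> (c \<ominus>\<^bsub>V\<^esub> e \<oplus>\<^bsub>V\<^esub> f [g])"
    by (simp only: V.minus_eq V.a_ac V_closed)
  finally have "(a \<ominus>\<^bsub>V\<^esub> b \<oplus>\<^bsub>V\<^esub> c) \<oplus>\<^bsub>V\<^esub> (b \<ominus>\<^bsub>V\<^esub> d \<oplus>\<^bsub>V\<^esub> f [g])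
      = (a \<ominus>\<^bsub>V\<^esub> d \<oplus>\<^bsub>V\<^esub> e) \<oplus>\<^bsub>V\<^esub> (c \<ominus>\<^bsub>V\<^esub> e \<oplus>\<^bsub>V\<^esub> f [g])" .
  then show "\<rho> g (coboundary_map G V \<rho> 1 f [h, k]) \<oplus>\<^bsub>V\<^esub> coboundary_map G V \<rho> 1 f [g, h \<otimes> k]
      = coboundary_map G V \<rho> 1 f [g \<otimes> h, k] \<oplus>\<^bsub>V\<^esub> coboundary_map G V \<rho> 1 f [g, h]"
    using gh cl by (simp add: a_b_c_d_e_def coboundary_map_1[OF f] \<rho>_add \<rho>m V.minus_eq \<rho>_mult m_assoc del: One_nat_def)
qed

lemma cocycle_2_scalar:
  assumes c: "c \<in> cocycles G V \<rho> 2"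
  shows "cocycle2 (int p) (\<lambda>g h x. coord (c [g, h]) (act g (act h x)))"
  unfolding cocycle2_def
proof (intro ballI)
  fix g h k x assume gx: "g \<in> carrier G" "h \<in> carrier G" "k \<in> carrier G" "x \<in> X"
  have cl: "c [x, y] \<in> carrier V" if "x \<in> carrier G" "y \<in> carrier G" for x y
    using c cochain_closed[of c 2 "[x, y]"] that by (auto simp: cocycles_2 tuples_2)
  define y where "y = act g (act h (act k x))"
  have y: "y \<in> X" using gx by (simp add: y_def)
  have "[coord (c [h, k]) (act h (act k x)) + coord (c [g, h \<otimes> k]) y
      = coord (\<rho> g (c [h, k])) y + coord (c [g, h \<otimes> k]) y] (mod int p)"
    unfolding y_def using gx cl by (intro cong_add cong_refl cong_sym[OF coord_\<rho>]) auto
  also have "[coord (\<rho> g (c [h, k])) y + coord (c [g, h \<otimes> k]) y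
      = coord (\<rho> g (c [h, k]) \<oplus>\<^bsub>V\<^esub> c [g, h \<otimes> k]) y] (mod int p)"
    using gx cl y by (intro cong_sym[OF coord_add]) auto
  also have "\<rho> g (c [h, k]) \<oplus>\<^bsub>V\<^esub> c [g, h \<otimes> k] = c [g \<otimes> h, k] \<oplus>\<^bsub>V\<^esub> c [g, h]"
    using c gx by (simp add: cocycles_2)
  also have "[coord (c [g \<otimes> h, k] \<oplus>\<^bsub>V\<^esub> c [g, h]) y = coord (c [g \<otimes> h, k]) y + coord (c [g, h]) y] (mod int p)"
    using gx cl y by (intro coord_add) auto
  finally show "[coord (c [h, k]) (act h (act k x)) + coord (c [g, h \<otimes> k]) (act g (act (h \<otimes> k) x))
      = coord (c [g \<otimes> h, k]) (act (g \<otimes> h) (act k x)) + coord (c [g, h]) (act g (act h (act k x)))] (mod int p)"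
    using gx by (simp add: y_def act_mult)
qed

text \<open>
  The argument is that of \<open>cohomology_1\<close>, with the class of a two-cocycle on the cyclic group generated by \<open>t\<close>
  in place of the value at \<open>t\<close>.
\<close>

theorem cohomology_2:
  "group (group_cohomology 2 G V \<rho>)" "group_cohomology 2 G V \<rho> \<cong> add_monoid (residue_ring (int p))"
proof -
  define \<phi> where "\<phi> c = (\<Sum>i<ord t. coord (c [t [^] i, t]) x0)" for c :: "_ list \<Rightarrow> _"
  have cl: "c [g, h] \<in> carrier V" if "c \<in> cocycles G V \<rho> 2" "g \<in> carrier G" "h \<in> carrier G" for c g h
    using that cochain_closed[of c 2 "[g, h]"] by (auto simp: cocycles_2 tuples_2)
  have tx: "act (t [^] (i::nat)) x0 = x0" "act (inv (t [^] i)) x0 = x0" "act (inv t) x0 = x0" for i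
    by (auto intro!: act_pow_fixed act_inv_fixed)
  have add: "[\<phi> (c \<otimes>\<^bsub>cochains G V 2\<^esub> d) = \<phi> c + \<phi> d] (mod int p)"
    if "c \<in> cocycles G V \<rho> 2" "d \<in> cocycles G V \<rho> 2" for c d
    unfolding \<phi>_def sum.distrib[symmetric]
  proof (rule cong_sum)
    fix i :: nat
    show "[coord ((c \<otimes>\<^bsub>cochains G V 2\<^esub> d) [t [^] i, t]) x0
        = coord (c [t [^] i, t]) x0 + coord (d [t [^] i, t]) x0] (mod int p)"
      using coord_add[of "c [t [^] i, t]" "d [t [^] i, t]" x0] cl that
      by (simp add: mult_cochains tuples_2)
  qed
  have cob0: "int p dvd \<phi> c" if c: "c \<in> coboundaries G V \<rho> 2" for c
  proof -
    obtain f where f: "f \<in> carrier (cochains G V 1)" "c = coboundary_map G V \<rho> 1 f"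
      using c by (auto simp: numeral_2_eq_2)
    have fcl: "f [x] \<in> carrier V" if "x \<in> carrier G" for x
      using cochain_closed[OF f(1), of "[x]"] that by (auto simp: tuples_Suc tuples_0)
    define F where "F g = coord (f [g]) x0" for g
    have "[\<phi> c = (\<Sum>i<ord t. F t + (F (t [^] i) - F (t [^] Suc i)))] (mod int p)"
      unfolding \<phi>_def
    proof (rule cong_sum)
      fix i :: nat
      let ?g = "t [^] i"
      have g: "?g \<in> carrier G" by simp
      have "c [?g, t] = (\<rho> ?g (f [t]) \<oplus>\<^bsub>V\<^esub> f [?g]) \<ominus>\<^bsub>V\<^esub> f [?g \<otimes> t]"
        using f(2) coboundary_map_1[OF f(1) g t(1)] fcl g by (simp add: V.minus_eq V.a_ac del: One_nat_def)
      then have "[coord (c [?g, t]) x0 = coord (\<rho> ?g (f [t]) \<oplus>\<^bsub>V\<^esub> f [?g]) x0 - coord (f [?g \<otimes> t]) x0] (mod int p)"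
        using fcl g by (intro coord_diff_eq) auto
      also have "[coord (\<rho> ?g (f [t]) \<oplus>\<^bsub>V\<^esub> f [?g]) x0 - coord (f [?g \<otimes> t]) x0
          = (coord (\<rho> ?g (f [t])) x0 + coord (f [?g]) x0) - coord (f [?g \<otimes> t]) x0] (mod int p)"
        using fcl g by (intro cong_diff coord_add cong_refl) auto
      also have "[(coord (\<rho> ?g (f [t])) x0 + coord (f [?g]) x0) - coord (f [?g \<otimes> t]) x0
          = (coord (f [t]) x0 + coord (f [?g]) x0) - coord (f [?g \<otimes> t]) x0] (mod int p)"
        using coord_\<rho>[of ?g "f [t]" x0] fcl g by (intro cong_diff cong_add cong_refl) (simp add: tx)
      finally show "[coord (c [?g, t]) x0 = F t + (F ?g - F (t [^] Suc i))] (mod int p)"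
        by (simp add: F_def algebra_simps)
    qed
    also have "(\<Sum>i<ord t. F t + (F (t [^] i) - F (t [^] Suc i)))
        = int (ord t) * F t + (F (t [^] (0::nat)) - F (t [^] ord t))"
      using sum_lessThan_telescope'[of "\<lambda>i. F (t [^] i)" "ord t"] by (simp add: sum.distrib)
    also have "\<dots> = int (ord t) * F t" by (simp add: pow_ord_eq_1)
    finally show ?thesis using p_dvd_ord by (simp add: cong_dvd_iff)
  qed
  have cob1: "c \<in> coboundaries G V \<rho> 2" if c: "c \<in> cocycles G V \<rho> 2" and d: "int p dvd \<phi> c" for c
  proof -
    have "(\<Sum>i<ord t. coord (c [t [^] i, t]) (act (t [^] i) (act t x0))) = \<phi> c"
      by (simp add: \<phi>_def tx)
    then obtain A where A: "\<And>g h x. \<lbrakk>g \<in> carrier G; h \<in> carrier G; x \<in> X\<rbrakk> \<Longrightarrow>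
        [coord (c [g, h]) (act g (act h x)) = A h x - A (g \<otimes> h) x + A g (act h x)] (mod int p)"
      using cocycle2_coboundary[OF cocycle_2_scalar[OF c]] d by (auto simp: cong_0_iff)
    define B where "B g y = half * A g (act (inv g) y)" for g y
    define f where "f = (\<lambda>xs\<in>tuples G 1. comb (B (hd xs)))"
    have f: "f \<in> carrier (cochains G V 1)" unfolding f_def by (rule restrict_cochain) simp
    have fg: "f [g] = comb (B g)" if "g \<in> carrier G" for g
      using that by (simp add: f_def tuples_Suc tuples_0)
    have "c = coboundary_map G V \<rho> 1 f"
    proof (rule cochain_eqI[of _ 2])
      show "c \<in> carrier (cochains G V 2)" using c by (simp add: cocycles_2)
      show "coboundary_map G V \<rho> 1 f \<in> carrier (cochains G V 2)"
        using coboundary_map_closed[OF f] by (simp add: numeral_2_eq_2)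
      fix xs assume "xs \<in> tuples G 2"
      then obtain g h where gh: "g \<in> carrier G" "h \<in> carrier G" "xs = [g, h]" by (auto simp: tuples_2)
      have "coboundary_map G V \<rho> 1 f [g, h] = comb (\<lambda>y. B h (act (inv g) y) - B (g \<otimes> h) y + B g y)"
        unfolding coboundary_map_1[OF f gh(1,2)] comb_add comb_diff using gh by (simp add: fg \<rho>_comb)
      also have "\<dots> = c [g, h]"
      proof (rule comb_half)
        fix y assume y: "y \<in> X"
        define x where "x = act (inv h) (act (inv g) y)"
        have x: "x \<in> X" "act (inv (g \<otimes> h)) y = x" "act (inv g) y = act h x" "y = act g (act h x)"
          using gh y by (simp_all add: x_def inv_mult_group act_mult)
        have "[half * coord (c [g, h]) y = half * (A h x - A (g \<otimes> h) x + A g (act h x))] (mod int p)"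
          unfolding x(4) using A[OF gh(1,2) x(1)] by (rule cong_scalar_left)
        moreover have "B h (act (inv g) y) - B (g \<otimes> h) y + B g y
            = half * (A h x - A (g \<otimes> h) x + A g (act h x))"
          using gh x(1) by (simp add: B_def x(2,3) algebra_simps)
        ultimately show "[B h (act (inv g) y) - B (g \<otimes> h) y + B g y = half * coord (c [g, h]) y] (mod int p)"
          by (simp add: cong_sym_eq)
      qed (use cl c gh in auto)
      finally show "c xs = coboundary_map G V \<rho> 1 f xs" using gh by simp
    qed
    then show ?thesis using f by (simp add: numeral_2_eq_2)
  qed
  have nontrivial: "\<exists>c\<in>cocycles G V \<rho> 2. \<not> int p dvd \<phi> c"
  proof -
    obtain C where C: "cocycle2 (int p) C" "\<not> int p dvd (\<Sum>i<ord t. C (t [^] i) t x0)"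
      "[(\<Sum>i<ord t. \<Sum>x\<in>X. C (t [^] i) t x) = 0] (mod int p)"
      using exists_cocycle2 by blast
    define E where "E g h y = C g h (act (inv h) (act (inv g) y))" for g h y
    define c where "c = (\<lambda>xs\<in>tuples G 2. comb (E (hd xs) (hd (tl xs))))"
    have cg: "c [g, h] = comb (E g h)" if "g \<in> carrier G" "h \<in> carrier G" for g h
      using that by (simp add: c_def tuples_2)
    have "c \<in> cocycles G V \<rho> 2"
      unfolding cocycles_2
    proof (intro conjI ballI)
      show "c \<in> carrier (cochains G V 2)" unfolding c_def by (rule restrict_cochain) simp
      fix g h k assume gh: "g \<in> carrier G" "h \<in> carrier G" "k \<in> carrier G"
      have "comb (\<lambda>y. E h k (act (inv g) y) + E g (h \<otimes> k) y) = comb (\<lambda>y. E (g \<otimes> h) k y + E g h y)"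
      proof (rule comb_cong)
        fix y assume y: "y \<in> X"
        define x where "x = act (inv k) (act (inv h) (act (inv g) y))"
        have x: "x \<in> X" and y: "y = act g (act h (act k x))" using gh y by (simp_all add: x_def)
        show "[E h k (act (inv g) y) + E g (h \<otimes> k) y = E (g \<otimes> h) k y + E g h y] (mod int p)"
          using C(1) gh x unfolding E_def y cocycle2_def by (simp add: inv_mult_group act_mult)
      qed
      then show "\<rho> g (c [h, k]) \<oplus>\<^bsub>V\<^esub> c [g, h \<otimes> k] = c [g \<otimes> h, k] \<oplus>\<^bsub>V\<^esub> c [g, h]"
        using gh by (simp add: cg \<rho>_comb comb_add)
    qed
    moreover have "\<not> int p dvd \<phi> c"
    proof -
      have "[\<phi> c = (\<Sum>i<ord t. 2 * C (t [^] i) t x0 - (\<Sum>x\<in>X. C (t [^] i) t x))] (mod int p)"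
        unfolding \<phi>_def
      proof (rule cong_sum)
        fix i :: nat
        let ?g = "t [^] i"
        have "[coord (c [?g, t]) x0 = 2 * E ?g t x0 - (\<Sum>y\<in>X. E ?g t y)] (mod int p)"
          unfolding cg[OF nat_pow_closed[OF t(1)] t(1)] by (rule coord_comb) simp
        also have "(\<Sum>y\<in>X. E ?g t y) = (\<Sum>y\<in>X. C ?g t (act (inv t) y))"
          unfolding E_def by (rule sum_act) simp
        also have "\<dots> = (\<Sum>x\<in>X. C ?g t x)" by (rule sum_act) simp
        finally show "[coord (c [?g, t]) x0 = 2 * C ?g t x0 - (\<Sum>x\<in>X. C ?g t x)] (mod int p)"
          by (simp add: E_def tx)
      qed
      also have "(\<Sum>i<ord t. 2 * C (t [^] i) t x0 - (\<Sum>x\<in>X. C (t [^] i) t x))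
          = 2 * (\<Sum>i<ord t. C (t [^] i) t x0) - (\<Sum>i<ord t. \<Sum>x\<in>X. C (t [^] i) t x)"
        by (simp only: sum_subtractf sum_distrib_left)
      also have "[2 * (\<Sum>i<ord t. C (t [^] i) t x0) - (\<Sum>i<ord t. \<Sum>x\<in>X. C (t [^] i) t x)
          = 2 * (\<Sum>i<ord t. C (t [^] i) t x0) - 0] (mod int p)"
        by (intro cong_diff cong_refl C)
      finally show ?thesis
        using not_p_dvd_double[OF C(2)] by (simp add: cong_dvd_iff)
    qed
    ultimately show ?thesis by blast
  qed
  have sub: "coboundaries G V \<rho> 2 \<subseteq> cocycles G V \<rho> 2"
    using coboundary_2_cocycle by (auto simp: numeral_2_eq_2)
  have cob: "coboundaries G V \<rho> 2 = {c \<in> cocycles G V \<rho> 2. int p dvd \<phi> c}"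
    using cob0 cob1 sub by blast
  show "group (group_cohomology 2 G V \<rho>)" "group_cohomology 2 G V \<rho> \<cong> add_monoid (residue_ring (int p))"
    using cohomology_iso_Zp[OF add nontrivial cob] by auto
qed

end

section \<open>The group algebra and its blocks\<close>

text \<open>
  The powers of \<open>z\<close> are eventually periodic with some period \<open>d\<close>; a multiple of \<open>d\<close> in the periodic range is an
  idempotent exponent.
\<close>

lemma (in monoid) idempotent_power:
  assumes "finite (carrier G)" and z: "z \<in> carrier G"
  shows "\<exists>n>0. z [^] n \<otimes> z [^] n = z [^] (n::nat)"
proof -
  have "range (\<lambda>i::nat. z [^] i) \<subseteq> carrier G" using z by auto
  then have "finite (range (\<lambda>i::nat. z [^] i))" using assms(1) finite_subset by blast
  then have "\<not> inj_on (\<lambda>i::nat. z [^] i) UNIV"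
    using finite_imageD[of "\<lambda>i::nat. z [^] i" UNIV] by auto
  then obtain i j :: nat where ij: "i < j" "z [^] i = z [^] j"
    unfolding inj_on_def by (metis linorder_neqE_nat)
  define d where "d = j - i"
  have step: "z [^] (m + d) = z [^] m" if "i \<le> m" for m
  proof -
    have "z [^] (m + d) = z [^] (m - i) \<otimes> z [^] j"
      using that ij z by (simp add: nat_pow_mult d_def)
    also have "\<dots> = z [^] m" using that z by (simp add: ij(2)[symmetric] nat_pow_mult)
    finally show ?thesis .
  qed
  have steps: "z [^] (m + k * d) = z [^] m" if "i \<le> m" for m k
  proof (induction k)
    case (Suc k)
    have "z [^] (m + Suc k * d) = z [^] ((m + k * d) + d)" by (simp add: algebra_simps)
    also have "\<dots> = z [^] m" using that Suc step[of "m + k * d"] by simp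
    finally show ?case .
  qed simp
  define n where "n = Suc i * d"
  have d: "0 < d" using ij by (simp add: d_def)
  then have "i \<le> n" by (cases d) (auto simp: n_def)
  then have "z [^] n \<otimes> z [^] n = z [^] n"
    using steps[of n "Suc i"] z by (simp only: nat_pow_mult n_def[symmetric])
  then show ?thesis using d by (auto simp: n_def)
qed

locale finite_group_mod_p = group G for G (structure) +
  fixes p :: nat
  assumes finite_G: "finite (carrier G)" and prime_p: "prime p"
begin

abbreviation "Fp \<equiv> residue_ring (int p)"

abbreviation "FpG \<equiv> group_algebra Fp G"

lemma p_gt_1: "1 < int p"
  using prime_gt_1_nat[OF prime_p] by simp

sublocale Fp: residues "int p" Fp
  using p_gt_1 by unfold_locales auto

text \<open>
  Elements of the group algebra are represented by arbitrary integer functions, and \<open>red\<close> is the reduction modulo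
  \<open>p\<close>. The ring axioms then follow from those of the integral convolution \<open>conv\<close>.
\<close>

definition red :: "('a \<Rightarrow> int) \<Rightarrow> 'a \<Rightarrow> int" where
  "red a = (\<lambda>g\<in>carrier G. a g mod int p)"

definition conv :: "('a \<Rightarrow> int) \<Rightarrow> ('a \<Rightarrow> int) \<Rightarrow> 'a \<Rightarrow> int" where
  "conv a b g = (\<Sum>h\<in>carrier G. a h * b (inv h \<otimes> g))"

lemma carrier_FpG: "carrier FpG = carrier G \<rightarrow>\<^sub>E {0..int p - 1}"
  by (simp add: group_algebra_def Fp.res_carrier_eq)

lemma finite_FpG: "finite (carrier FpG)"
  unfolding carrier_FpG using finite_G by (intro finite_PiE) auto

lemma red_closed [simp]: "red a \<in> carrier FpG"
  using p_gt_1 by (auto simp: carrier_FpG red_def)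

lemma red_id: "a \<in> carrier FpG \<Longrightarrow> red a = a"
  unfolding carrier_FpG by (rule PiE_ext[of _ "carrier G" "\<lambda>_. {0..int p - 1}"])
    (use red_closed in \<open>auto simp: red_def carrier_FpG PiE_def Pi_iff\<close>)

lemma red_eq: "(\<And>g. g \<in> carrier G \<Longrightarrow> [a g = b g] (mod int p)) \<Longrightarrow> red a = red b"
  by (auto simp: red_def cong_def)

lemma red_cong: "g \<in> carrier G \<Longrightarrow> [red a g = a g] (mod int p)"
  by (simp add: red_def)

lemma finsum_Fp:
  "f \<in> S \<rightarrow> carrier Fp \<Longrightarrow> (\<Oplus>\<^bsub>Fp\<^esub>x\<in>S. f x) = (\<Sum>x\<in>S. f x) mod int p"
proof (induction S rule: infinite_finite_induct)
  case (infinite S)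
  then show ?case by (simp add: Fp.res_zero_eq)
next
  case empty
  then show ?case by (simp add: Fp.res_zero_eq)
next
  case (insert x S)
  have "(\<Oplus>\<^bsub>Fp\<^esub>x\<in>insert x S. f x) = f x \<oplus>\<^bsub>Fp\<^esub> (\<Oplus>\<^bsub>Fp\<^esub>x\<in>S. f x)"
    using insert by (intro Fp.finsum_insert) auto
  then show ?case using insert by (simp add: Fp.res_add_eq mod_add_right_eq)
qed

lemma mult_FpG:
  assumes a: "a \<in> carrier FpG" and b: "b \<in> carrier FpG"
  shows "a \<otimes>\<^bsub>FpG\<^esub> b = red (conv a b)"
proof -
  have "(\<Oplus>\<^bsub>Fp\<^esub>h\<in>carrier G. a h \<otimes>\<^bsub>Fp\<^esub> b (inv h \<otimes> g)) = conv a b g mod int p" if g: "g \<in> carrier G" for g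
  proof -
    have "(\<Oplus>\<^bsub>Fp\<^esub>h\<in>carrier G. a h \<otimes>\<^bsub>Fp\<^esub> b (inv h \<otimes> g))
        = (\<Sum>h\<in>carrier G. a h \<otimes>\<^bsub>Fp\<^esub> b (inv h \<otimes> g)) mod int p"
      using a b g by (intro finsum_Fp) (auto simp: group_algebra_def intro!: Fp.m_closed)
    also have "\<dots> = conv a b g mod int p"
      by (simp add: conv_def Fp.res_mult_eq mod_sum_eq)
    finally show ?thesis .
  qed
  then show ?thesis by (auto simp: group_algebra_def red_def intro!: restrict_ext)
qed

lemma add_FpG: "a \<oplus>\<^bsub>FpG\<^esub> b = red (\<lambda>g. a g + b g)"
  by (simp add: group_algebra_def red_def Fp.res_add_eq)

lemma zero_FpG: "\<zero>\<^bsub>FpG\<^esub> = red (\<lambda>g. 0)"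
  by (simp add: group_algebra_def red_def Fp.res_zero_eq)

lemma one_FpG: "\<one>\<^bsub>FpG\<^esub> = red (\<lambda>g. if g = \<one> then 1 else 0)"
  using p_gt_1 by (auto simp: group_algebra_def red_def Fp.res_zero_eq Fp.res_one_eq intro!: restrict_ext)

lemma conv_cong:
  assumes "\<And>g. g \<in> carrier G \<Longrightarrow> [a g = a' g] (mod int p)" "\<And>g. g \<in> carrier G \<Longrightarrow> [b g = b' g] (mod int p)"
    and "g \<in> carrier G"
  shows "[conv a b g = conv a' b' g] (mod int p)"
  unfolding conv_def using assms by (intro cong_sum cong_mult) auto

lemma red_conv_red [simp]: "red (conv (red a) b) = red (conv a b)" "red (conv a (red b)) = red (conv a b)"
  by (auto intro!: red_eq conv_cong red_cong)

lemma red_add_red [simp]: "red (\<lambda>g. red a g + b g) = red (\<lambda>g. a g + b g)"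
  "red (\<lambda>g. a g + red b g) = red (\<lambda>g. a g + b g)"
  by (auto intro!: red_eq cong_add red_cong)

lemma sum_translate:
  fixes f :: "'a \<Rightarrow> int"
  shows "k \<in> carrier G \<Longrightarrow> (\<Sum>h\<in>carrier G. f (k \<otimes> h)) = (\<Sum>h\<in>carrier G. f h)"
proof (rule sum.reindex_bij_betw)
  assume "k \<in> carrier G"
  then show "bij_betw ((\<otimes>) k) (carrier G) (carrier G)"
    by (intro bij_betw_byWitness[of _ "(\<otimes>) (inv k)"]) (auto simp flip: m_assoc)
qed

lemma conv_assoc:
  assumes g: "g \<in> carrier G" shows "conv (conv a b) c g = conv a (conv b c) g"
proof -
  have "conv (conv a b) c g = (\<Sum>h\<in>carrier G. \<Sum>k\<in>carrier G. a k * (b (inv k \<otimes> h) * c (inv h \<otimes> g)))"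
    by (simp add: conv_def sum_distrib_right mult.assoc)
  also have "\<dots> = (\<Sum>k\<in>carrier G. a k * (\<Sum>h\<in>carrier G. b (inv k \<otimes> h) * c (inv h \<otimes> g)))"
    by (subst sum.swap) (simp add: sum_distrib_left)
  also have "\<dots> = (\<Sum>k\<in>carrier G. a k * (\<Sum>h\<in>carrier G. b h * c (inv h \<otimes> (inv k \<otimes> g))))"
  proof (rule sum.cong)
    fix k assume k: "k \<in> carrier G"
    have "(\<Sum>h\<in>carrier G. b (inv k \<otimes> h) * c (inv h \<otimes> g))
        = (\<Sum>h\<in>carrier G. b (inv k \<otimes> (k \<otimes> h)) * c (inv (k \<otimes> h) \<otimes> g))"
      using sum_translate[OF k, of "\<lambda>h. b (inv k \<otimes> h) * c (inv h \<otimes> g)"] by simp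
    also have "\<dots> = (\<Sum>h\<in>carrier G. b h * c (inv h \<otimes> (inv k \<otimes> g)))"
    proof (rule sum.cong)
      fix h assume h: "h \<in> carrier G"
      have "inv k \<otimes> (k \<otimes> h) = h" "inv (k \<otimes> h) \<otimes> g = inv h \<otimes> (inv k \<otimes> g)"
        using k h g by (simp_all add: inv_mult_group m_assoc) (simp flip: m_assoc)
      then show "b (inv k \<otimes> (k \<otimes> h)) * c (inv (k \<otimes> h) \<otimes> g) = b h * c (inv h \<otimes> (inv k \<otimes> g))" by simp
    qed simp
    finally show "a k * (\<Sum>h\<in>carrier G. b (inv k \<otimes> h) * c (inv h \<otimes> g))
        = a k * (\<Sum>h\<in>carrier G. b h * c (inv h \<otimes> (inv k \<otimes> g)))" by simp
  qed simp
  also have "\<dots> = conv a (conv b c) g" by (simp add: conv_def)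
  finally show ?thesis .
qed

lemma conv_one_left: "g \<in> carrier G \<Longrightarrow> conv (\<lambda>g. if g = \<one> then 1 else 0) a g = a g"
  using finite_G by (simp add: conv_def if_distrib[of "\<lambda>x. x * _"] cong: if_cong)

lemma conv_one_right: 
  assumes g: "g \<in> carrier G" shows "conv a (\<lambda>g. if g = \<one> then 1 else 0) g = a g"
proof -
  have "conv a (\<lambda>g. if g = \<one> then 1 else 0) g = (\<Sum>h\<in>carrier G. if h = g then a h else 0)"
    unfolding conv_def
  proof (rule sum.cong)
    fix h assume h: "h \<in> carrier G"
    have "inv h \<otimes> g = \<one> \<longleftrightarrow> h = g"
      using g h by (metis inv_equality inv_inv inv_closed l_inv)
    then show "a h * (if inv h \<otimes> g = \<one> then 1 else 0) = (if h = g then a h else 0)" by simp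
  qed simp
  then show ?thesis using finite_G g by simp
qed

lemma red_mult: "red a \<otimes>\<^bsub>FpG\<^esub> red b = red (conv a b)"
  by (simp add: mult_FpG)

lemma red_add: "red a \<oplus>\<^bsub>FpG\<^esub> red b = red (\<lambda>g. a g + b g)"
  by (simp add: add_FpG)

lemma ring_FpG: "ring FpG"
proof (rule ringI)
  show "abelian_group FpG"
  proof (rule abelian_groupI)
    fix a assume a: "a \<in> carrier FpG"
    have "red (\<lambda>g. - a g) \<oplus>\<^bsub>FpG\<^esub> a = red (\<lambda>g. - a g) \<oplus>\<^bsub>FpG\<^esub> red a" using a by (simp add: red_id)
    also have "\<dots> = \<zero>\<^bsub>FpG\<^esub>" by (simp only: red_add zero_FpG) simp
    finally show "\<exists>b\<in>carrier FpG. b \<oplus>\<^bsub>FpG\<^esub> a = \<zero>\<^bsub>FpG\<^esub>" by (meson red_closed)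
  qed (auto simp: add_FpG zero_FpG algebra_simps red_id)
  show "monoid FpG"
  proof (rule monoidI)
    fix a b c assume "a \<in> carrier FpG" "b \<in> carrier FpG" "c \<in> carrier FpG"
    then obtain a' b' c' where "a = red a'" "b = red b'" "c = red c'" by (metis red_id)
    then show "a \<otimes>\<^bsub>FpG\<^esub> b \<otimes>\<^bsub>FpG\<^esub> c = a \<otimes>\<^bsub>FpG\<^esub> (b \<otimes>\<^bsub>FpG\<^esub> c)"
      by (auto simp: red_mult conv_assoc intro!: red_eq)
  next
    fix a assume a: "a \<in> carrier FpG"
    have "red (\<lambda>g. if g = \<one> then 1 else 0) \<otimes>\<^bsub>FpG\<^esub> red a = red a"
      unfolding red_mult by (intro red_eq) (simp add: conv_one_left)
    then show "\<one>\<^bsub>FpG\<^esub> \<otimes>\<^bsub>FpG\<^esub> a = a" using a by (simp add: one_FpG red_id)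
    have "red a \<otimes>\<^bsub>FpG\<^esub> red (\<lambda>g. if g = \<one> then 1 else 0) = red a"
      unfolding red_mult by (intro red_eq) (simp add: conv_one_right)
    then show "a \<otimes>\<^bsub>FpG\<^esub> \<one>\<^bsub>FpG\<^esub> = a" using a by (simp add: one_FpG red_id)
  qed (auto simp: mult_FpG one_FpG)
  fix a b c assume "a \<in> carrier FpG" "b \<in> carrier FpG" "c \<in> carrier FpG"
  then obtain a' b' c' where *: "a = red a'" "b = red b'" "c = red c'" by (metis red_id)
  show "(a \<oplus>\<^bsub>FpG\<^esub> b) \<otimes>\<^bsub>FpG\<^esub> c = a \<otimes>\<^bsub>FpG\<^esub> c \<oplus>\<^bsub>FpG\<^esub> b \<otimes>\<^bsub>FpG\<^esub> c"
    "c \<otimes>\<^bsub>FpG\<^esub> (a \<oplus>\<^bsub>FpG\<^esub> b) = c \<otimes>\<^bsub>FpG\<^esub> a \<oplus>\<^bsub>FpG\<^esub> c \<otimes>\<^bsub>FpG\<^esub> b"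
    unfolding * red_mult red_add by (auto intro!: red_eq simp: conv_def algebra_simps sum.distrib)
qed

lemma class_function_central:
  assumes z: "\<And>k g. \<lbrakk>k \<in> carrier G; g \<in> carrier G\<rbrakk> \<Longrightarrow> z (k \<otimes> g) = z (g \<otimes> k)" and a: "a \<in> carrier FpG"
  shows "red z \<otimes>\<^bsub>FpG\<^esub> a = a \<otimes>\<^bsub>FpG\<^esub> red z"
proof -
  have "conv z a g = conv a z g" if g: "g \<in> carrier G" for g
  proof -
    have "g \<otimes> inv (inv h \<otimes> g) = h" "inv (g \<otimes> inv h) \<otimes> g = h" if "h \<in> carrier G" for h
      using g that by (simp add: inv_mult_group flip: m_assoc, simp add: inv_mult_group m_assoc)
    then have "bij_betw (\<lambda>h. inv h \<otimes> g) (carrier G) (carrier G)"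
      using g by (intro bij_betw_byWitness[of _ "\<lambda>k. g \<otimes> inv k"]) auto
    from sum.reindex_bij_betw[OF this, of "\<lambda>h. a h * z (inv h \<otimes> g)"]
    have "conv a z g = (\<Sum>h\<in>carrier G. a (inv h \<otimes> g) * z (inv (inv h \<otimes> g) \<otimes> g))"
      by (simp add: conv_def)
    also have "\<dots> = (\<Sum>h\<in>carrier G. z h * a (inv h \<otimes> g))"
    proof (rule sum.cong)
      fix h assume h: "h \<in> carrier G"
      have "z (inv (inv h \<otimes> g) \<otimes> g) = z (inv g \<otimes> (h \<otimes> g))"
        using h g by (simp add: inv_mult_group m_assoc)
      also have "\<dots> = z (h \<otimes> g \<otimes> inv g)" using h g by (intro z) auto
      also have "\<dots> = z h" using h g by (simp add: m_assoc)
      finally show "a (inv h \<otimes> g) * z (inv (inv h \<otimes> g) \<otimes> g) = z h * a (inv h \<otimes> g)" by simp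
    qed simp
    finally show ?thesis by (simp add: conv_def)
  qed
  then have "red (conv z a) = red (conv a z)" by (intro red_eq) simp
  then show ?thesis using a by (simp add: mult_FpG)
qed

end

locale finite_torsion_rep = torsion_rep + assumes finite_carrier: "finite (carrier G)"
begin

sublocale finite_group_mod_p G p
  by unfold_locales (auto simp: finite_carrier prime_p)

definition aact where "aact a v = V.lc (\<lambda>g. \<rho> g v) (carrier G) a"

lemma aact_closed [simp]: "v \<in> carrier V \<Longrightarrow> aact a v \<in> carrier V"
  by (auto simp: aact_def)

lemma aact_cong: "\<lbrakk>v \<in> carrier V; \<And>g. g \<in> carrier G \<Longrightarrow> [a g = b g] (mod int p)\<rbrakk> \<Longrightarrow> aact a v = aact b v"
  unfolding aact_def by (rule V.lc_torsion[of _ _ "int p"]) (auto simp: torsion)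

lemma aact_red [simp]: "v \<in> carrier V \<Longrightarrow> aact (red a) v = aact a v"
  by (intro aact_cong red_cong)

lemma aact_zero [simp]: "aact a \<zero>\<^bsub>V\<^esub> = \<zero>\<^bsub>V\<^esub>"
proof -
  have "aact a \<zero>\<^bsub>V\<^esub> = V.lc (\<lambda>g. \<zero>\<^bsub>V\<^esub>) (carrier G) a"
    unfolding aact_def by (intro V.lc_cong) auto
  also have "\<dots> = V.lc (\<lambda>g. \<zero>\<^bsub>V\<^esub>) (carrier G) (\<lambda>g. 0)"
    by (intro V.lc_cong) auto
  finally show ?thesis by simp
qed

lemma \<rho>_aact:
  assumes k: "k \<in> carrier G" and v: "v \<in> carrier V"
  shows "\<rho> k (aact a v) = aact (\<lambda>g. a (inv k \<otimes> g)) v"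
proof -
  have bij: "bij_betw ((\<otimes>) k) (carrier G) (carrier G)"
    using k by (intro bij_betw_byWitness[of _ "(\<otimes>) (inv k)"]) (auto simp flip: m_assoc)
  then have im: "(\<otimes>) k ` carrier G = carrier G" and inj: "inj_on ((\<otimes>) k) (carrier G)"
    by (auto simp: bij_betw_def)
  have "aact (\<lambda>g. a (inv k \<otimes> g)) v
      = V.lc (\<lambda>g. \<rho> g v) ((\<otimes>) k ` carrier G) (\<lambda>g. a (inv k \<otimes> g))"
    by (simp add: aact_def im)
  also have "\<dots> = V.lc (\<lambda>g. \<rho> (k \<otimes> g) v) (carrier G) (\<lambda>g. a (inv k \<otimes> (k \<otimes> g)))"
    using inj v by (subst V.lc_reindex) (auto simp: im)
  also have "\<dots> = V.lc (\<lambda>g. \<rho> k (\<rho> g v)) (carrier G) a"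
    using k v by (intro V.lc_cong) (auto simp: \<rho>_mult simp flip: m_assoc)
  also have "\<dots> = \<rho> k (aact a v)" using k v by (simp add: aact_def \<rho>_lc)
  finally show ?thesis by simp
qed

lemma aact_int_mult: "v \<in> carrier V \<Longrightarrow> aact (\<lambda>g. k * a g) v = [k] \<cdot>\<^bsub>V\<^esub> aact a v"
  unfolding aact_def by (intro V.lc_mult) auto

lemma aact_conv:
  assumes v: "v \<in> carrier V" shows "aact (conv a b) v = aact a (aact b v)"
proof -
  have e: "(\<lambda>g. \<rho> g v) \<in> carrier G \<rightarrow> carrier V" using v by auto
  have "aact (conv a b) v = (\<Oplus>\<^bsub>V\<^esub>h\<in>carrier G. V.lc (\<lambda>g. \<rho> g v) (carrier G) (\<lambda>g. a h * b (inv h \<otimes> g)))"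
    unfolding aact_def conv_def using e finite_carrier by (intro V.lc_sum)
  also have "\<dots> = (\<Oplus>\<^bsub>V\<^esub>h\<in>carrier G. [a h] \<cdot>\<^bsub>V\<^esub> \<rho> h (aact b v))"
    using v e by (intro V.finsum_cong') (auto simp: aact_int_mult \<rho>_aact simp flip: aact_def)
  also have "\<dots> = aact a (aact b v)" by (simp add: aact_def[of a] V.lc_def)
  finally show ?thesis .
qed

lemma aact_mult: "\<lbrakk>a \<in> carrier FpG; b \<in> carrier FpG; v \<in> carrier V\<rbrakk> \<Longrightarrow> aact (a \<otimes>\<^bsub>FpG\<^esub> b) v = aact a (aact b v)"
  by (simp add: mult_FpG aact_conv)

end

text \<open>
  Let \<open>f\<close> be an idempotent power of \<open>z\<close>. The block idempotent \<open>e\<close> is the sum of the orthogonal central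
  idempotents \<open>e f\<close> and \<open>e - e f\<close>. The first is not \<open>0\<close> because \<open>z\<close>, and hence \<open>f\<close>, acts injectively on \<open>T\<close>, on
  which \<open>e\<close> is the identity; so the second is \<open>0\<close> by primitivity. Then \<open>f\<close> acts on \<open>V\<close> like \<open>e\<close>,
  as the identity, and \<open>z\<close> acts injectively.
\<close>

lemma block_central_injective:
  fixes G (structure)
  assumes "finite_torsion_rep G T p \<tau>" and "finite_torsion_rep G V p \<rho>"
  defines "A \<equiv> group_algebra (residue_ring (int p)) G"
  assumes e: "block_idempotent A e"
    and eT: "\<And>u. u \<in> carrier T \<Longrightarrow> finite_torsion_rep.aact G T \<tau> e u = u"
    and eV: "\<And>u. u \<in> carrier V \<Longrightarrow> finite_torsion_rep.aact G V \<rho> e u = u"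
    and T: "carrier T \<noteq> {\<zero>\<^bsub>T\<^esub>}"
    and z: "z \<in> carrier A" "\<And>a. a \<in> carrier A \<Longrightarrow> z \<otimes>\<^bsub>A\<^esub> a = a \<otimes>\<^bsub>A\<^esub> z"
    and zT: "\<And>u. \<lbrakk>u \<in> carrier T; finite_torsion_rep.aact G T \<tau> z u = \<zero>\<^bsub>T\<^esub>\<rbrakk> \<Longrightarrow> u = \<zero>\<^bsub>T\<^esub>"
    and v: "v \<in> carrier V" "finite_torsion_rep.aact G V \<rho> z v = \<zero>\<^bsub>V\<^esub>"
  shows "v = \<zero>\<^bsub>V\<^esub>"
proof -
  interpret T: finite_torsion_rep G T p \<tau> by fact
  interpret V: finite_torsion_rep G V p \<rho> by fact
  interpret A: ring A unfolding A_def by (rule T.ring_FpG)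
  note aact_mult = T.aact_mult[folded A_def] V.aact_mult[folded A_def]
  obtain n :: nat where n: "0 < n" and nn: "z [^]\<^bsub>A\<^esub> n \<otimes>\<^bsub>A\<^esub> z [^]\<^bsub>A\<^esub> n = z [^]\<^bsub>A\<^esub> n"
    using A.idempotent_power[OF _ z(1)] T.finite_FpG by (auto simp: A_def)
  define f where "f = z [^]\<^bsub>A\<^esub> n"
  have f: "f \<in> carrier A" "f \<otimes>\<^bsub>A\<^esub> f = f" using z nn by (simp_all add: f_def)
  have comm: "f \<otimes>\<^bsub>A\<^esub> a = a \<otimes>\<^bsub>A\<^esub> f" if a: "a \<in> carrier A" for a
  proof -
    have "z [^]\<^bsub>A\<^esub> m \<otimes>\<^bsub>A\<^esub> a = a \<otimes>\<^bsub>A\<^esub> z [^]\<^bsub>A\<^esub> m" for m :: nat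
    proof (induction m)
      case (Suc m)
      have "z [^]\<^bsub>A\<^esub> m \<otimes>\<^bsub>A\<^esub> z \<otimes>\<^bsub>A\<^esub> a = z [^]\<^bsub>A\<^esub> m \<otimes>\<^bsub>A\<^esub> a \<otimes>\<^bsub>A\<^esub> z"
        using a z by (simp add: A.m_assoc)
      then show ?case using a z Suc by (simp add: A.m_assoc)
    qed (use a in simp)
    then show ?thesis by (simp add: f_def)
  qed
  have eA: "e \<in> carrier A" "e \<otimes>\<^bsub>A\<^esub> e = e" "\<And>a. a \<in> carrier A \<Longrightarrow> e \<otimes>\<^bsub>A\<^esub> a = a \<otimes>\<^bsub>A\<^esub> e"
    using e by (auto simp: block_idempotent_def central_idempotent_def)
  define e1 where "e1 = e \<otimes>\<^bsub>A\<^esub> f"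
  define e2 where "e2 = e \<ominus>\<^bsub>A\<^esub> e1"
  have e1: "e1 \<in> carrier A" "e1 \<otimes>\<^bsub>A\<^esub> e1 = e1" "e \<otimes>\<^bsub>A\<^esub> e1 = e1" "e1 \<otimes>\<^bsub>A\<^esub> e = e1"
  proof -
    show cl: "e1 \<in> carrier A" using eA(1,2) f by (simp add: e1_def)
    show ee: "e \<otimes>\<^bsub>A\<^esub> e1 = e1" using eA(1,2) f by (simp add: e1_def flip: A.m_assoc)
    then show "e1 \<otimes>\<^bsub>A\<^esub> e = e1" using eA(3)[OF cl] by simp
    have "e1 \<otimes>\<^bsub>A\<^esub> e1 = e1 \<otimes>\<^bsub>A\<^esub> e \<otimes>\<^bsub>A\<^esub> f" using eA(1,2) f cl by (simp add: e1_def A.m_assoc)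
    also have "\<dots> = e \<otimes>\<^bsub>A\<^esub> (f \<otimes>\<^bsub>A\<^esub> f)" using \<open>e1 \<otimes>\<^bsub>A\<^esub> e = e1\<close> eA(1,2) f by (simp add: e1_def A.m_assoc)
    finally show "e1 \<otimes>\<^bsub>A\<^esub> e1 = e1" using f by (simp add: e1_def)
  qed
  have e1c: "e1 \<otimes>\<^bsub>A\<^esub> a = a \<otimes>\<^bsub>A\<^esub> e1" if a: "a \<in> carrier A" for a
  proof -
    have "e1 \<otimes>\<^bsub>A\<^esub> a = e \<otimes>\<^bsub>A\<^esub> (a \<otimes>\<^bsub>A\<^esub> f)" using a eA(1,2) f comm[OF a] by (simp add: e1_def A.m_assoc)
    also have "\<dots> = a \<otimes>\<^bsub>A\<^esub> e1" using a eA(1) f eA(3)[OF a] by (simp add: e1_def flip: A.m_assoc)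
    finally show ?thesis .
  qed
  have c1: "central_idempotent A e1" unfolding central_idempotent_def using e1 e1c by blast
  have e2cl: "e2 \<in> carrier A" using eA(1,2) e1(1) by (simp add: e2_def)
  have c2: "central_idempotent A e2"
    unfolding central_idempotent_def
  proof (intro conjI ballI)
    show "e2 \<in> carrier A" by (rule e2cl)
    show "e2 \<otimes>\<^bsub>A\<^esub> e2 = e2"
      using eA(1,2) e1 by (simp add: e2_def A.minus_eq A.l_distr A.r_distr A.l_minus A.r_minus A.r_neg A.l_neg)
    fix a assume a: "a \<in> carrier A"
    then show "e2 \<otimes>\<^bsub>A\<^esub> a = a \<otimes>\<^bsub>A\<^esub> e2"
      using eA(1) e1 eA(3)[OF a] e1c[OF a] by (simp add: e2_def A.minus_eq A.l_distr A.r_distr A.l_minus A.r_minus)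
  qed
  have e12: "e1 \<otimes>\<^bsub>A\<^esub> e2 = \<zero>\<^bsub>A\<^esub>"
    using eA(1) e1 by (simp add: e2_def A.minus_eq A.r_distr A.r_minus A.r_neg)
  have sum: "e = e1 \<oplus>\<^bsub>A\<^esub> e2"
    using eA(1) e1(1) by (simp add: e2_def A.minus_eq A.a_lcomm[of e1] A.r_neg)
  have e1nz: "e1 \<noteq> \<zero>\<^bsub>A\<^esub>"
  proof
    assume 0: "e1 = \<zero>\<^bsub>A\<^esub>"
    obtain u where u: "u \<in> carrier T" "u \<noteq> \<zero>\<^bsub>T\<^esub>" using T T.V.zero_closed by blast
    have pow: "T.aact (z [^]\<^bsub>A\<^esub> m) u \<noteq> \<zero>\<^bsub>T\<^esub>" for m :: nat
    proof (induction m)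
      case 0
      have "T.aact \<one>\<^bsub>A\<^esub> u = T.aact \<one>\<^bsub>A\<^esub> (T.aact e u)" using eT u by simp
      also have "\<dots> = T.aact e u" using aact_mult(1)[of "\<one>\<^bsub>A\<^esub>" e u] eA(1) A.one_closed A.l_one[of e] u by simp
      finally show ?case using eT u by simp
    next
      case (Suc m)
      have "z [^]\<^bsub>A\<^esub> Suc m = z \<otimes>\<^bsub>A\<^esub> z [^]\<^bsub>A\<^esub> m" using z A.nat_pow_Suc2 by blast
      then have "T.aact (z [^]\<^bsub>A\<^esub> Suc m) u = T.aact z (T.aact (z [^]\<^bsub>A\<^esub> m) u)"
        using aact_mult(1)[of z "z [^]\<^bsub>A\<^esub> m" u] z u A.nat_pow_closed[OF z(1)] by simp
      then show ?case using zT[of "T.aact (z [^]\<^bsub>A\<^esub> m) u"] Suc u by auto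
    qed
    have "T.aact e1 u = T.aact e (T.aact f u)"
      using aact_mult(1)[of e f u] eA(1) f u by (simp add: e1_def)
    also have "\<dots> = T.aact f u" using eT u by simp
    finally have "T.aact \<zero>\<^bsub>A\<^esub> u \<noteq> \<zero>\<^bsub>T\<^esub>" using pow[of n] 0 by (simp add: f_def)
    moreover have "T.aact \<zero>\<^bsub>A\<^esub> u = \<zero>\<^bsub>T\<^esub>" using u by (simp add: A_def T.zero_FpG) (simp add: T.aact_def)
    ultimately show False by simp
  qed
  have "e2 = \<zero>\<^bsub>A\<^esub>" using e c1 c2 e12 sum e1nz unfolding block_idempotent_def by blast
  then have ef: "e = e \<otimes>\<^bsub>A\<^esub> f" using sum e1(1) by (simp add: e1_def)
  obtain m where m: "n = Suc m" using n by (cases n) auto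
  have "V.aact f v = V.aact (z [^]\<^bsub>A\<^esub> m) (V.aact z v)"
    using aact_mult(2)[of "z [^]\<^bsub>A\<^esub> m" z v] z v A.nat_pow_closed[OF z(1), of m] by (simp add: f_def m)
  also have "\<dots> = \<zero>\<^bsub>V\<^esub>" using v by simp
  finally have "V.aact e (V.aact f v) = \<zero>\<^bsub>V\<^esub>" by simp
  moreover have "V.aact e (V.aact f v) = V.aact e v"
    using aact_mult(2)[of e f v] ef eA(1) f(1) v by simp
  ultimately show ?thesis using eV v by simp
qed

section \<open>Modules in the principal block\<close>

lemma (in abelian_group) lc_const:
  "\<lbrakk>finite I; u \<in> carrier G\<rbrakk> \<Longrightarrow> lc (\<lambda>_. u) I f = [(\<Sum>i\<in>I. f i)] \<cdot> u"
  by (induction I rule: finite_induct) (auto simp: lc_insert add.int_pow_mult)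

context
  fixes G (structure) and V (structure) and \<rho> and p :: nat
  assumes p: "prime p" and rep: "linear_rep (residue_ring (int p)) G V \<rho>"
begin

text \<open>
  The scalars of a module over \<open>F\<^sub>p\<close> act as integer multiples, so that a module over \<open>F\<^sub>p\<close> is nothing but an
  abelian group killed by \<open>p\<close>.
\<close>

lemma linear_rep_smult:
  assumes a: "0 \<le> a" "a < int p" and v: "v \<in> carrier V"
  shows "a \<odot>\<^bsub>V\<^esub> v = [a] \<cdot>\<^bsub>V\<^esub> v"
proof -
  have "Module.module (residue_ring (int p)) V" using rep by (simp add: linear_rep_def)
  then interpret V: abelian_group V by (rule module.axioms(2))
  interpret linear_rep "residue_ring (int p)" G V \<rho> by (rule rep)
  interpret R: residues "int p" "residue_ring (int p)"
    using prime_gt_1_nat[OF p] by unfold_locales auto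
  have "int n \<odot>\<^bsub>V\<^esub> v = [int n] \<cdot>\<^bsub>V\<^esub> v" if "int n < int p" for n
    using that
  proof (induction n)
    case 0
    have "\<zero>\<^bsub>residue_ring (int p)\<^esub> \<odot>\<^bsub>V\<^esub> v = \<zero>\<^bsub>V\<^esub>" by (rule smult_l_null[OF v])
    then show ?case using V.int_mult_0 by (simp add: R.res_zero_eq)
  next
    case (Suc n)
    have "int (Suc n) = int n \<oplus>\<^bsub>residue_ring (int p)\<^esub> \<one>\<^bsub>residue_ring (int p)\<^esub>"
      using Suc.prems by (simp add: R.res_add_eq R.res_one_eq)
    moreover have "int n \<in> carrier (residue_ring (int p))" using Suc.prems by (simp add: R.res_carrier_eq)
    ultimately have "int (Suc n) \<odot>\<^bsub>V\<^esub> v = int n \<odot>\<^bsub>V\<^esub> v \<oplus>\<^bsub>V\<^esub> v"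
      using v by (simp add: smult_l_distr)
    then show ?case using Suc v V.add.int_pow_mult[of v "int n" 1] by (simp add: add.commute)
  qed
  from this[of "nat a"] show ?thesis using a by simp
qed

lemma linear_rep_torsion: "torsion_rep G V p \<rho>"
proof -
  have "Module.module (residue_ring (int p)) V" using rep by (simp add: linear_rep_def)
  then interpret V: abelian_group V by (rule module.axioms(2))
  interpret linear_rep "residue_ring (int p)" G V \<rho> by (rule rep)
  interpret R: residues "int p" "residue_ring (int p)"
    using prime_gt_1_nat[OF p] by unfold_locales auto
  interpret G: group G using group_hom by (rule group_hom.axioms(1))
  show ?thesis
  proof unfold_locales
    fix v assume v: "v \<in> carrier V"
    define n where "n = int p - 1"
    have n: "0 \<le> n" "n < int p" using prime_gt_1_nat[OF p] by (auto simp: n_def)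
    have "n \<oplus>\<^bsub>residue_ring (int p)\<^esub> \<one>\<^bsub>residue_ring (int p)\<^esub> = \<zero>\<^bsub>residue_ring (int p)\<^esub>"
      by (simp add: R.res_add_eq R.res_one_eq R.res_zero_eq n_def)
    moreover have "n \<in> carrier (residue_ring (int p))" using n by (simp add: R.res_carrier_eq)
    ultimately have "n \<odot>\<^bsub>V\<^esub> v \<oplus>\<^bsub>V\<^esub> v = \<zero>\<^bsub>V\<^esub>"
      using v smult_l_distr[of n "\<one>\<^bsub>residue_ring (int p)\<^esub>" v] smult_l_null[OF v] by simp
    then show "[int p] \<cdot>\<^bsub>V\<^esub> v = \<zero>\<^bsub>V\<^esub>"
      using n v V.add.int_pow_mult[of v n 1] by (simp add: linear_rep_smult) (simp add: n_def)
  next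
    fix g v assume "g \<in> carrier G" "v \<in> carrier V"
    then show "\<rho> g v \<in> carrier V" using element_image by blast
  next
    fix v assume "v \<in> carrier V"
    then show "\<rho> \<one> v = v" using id_eq_one by (metis restrict_apply')
  qed (auto simp: p composition_rule rep_add)
qed

end

lemma algebra_act_eq:
  fixes G (structure) and V (structure)
  assumes p: "prime p" and rep: "linear_rep (residue_ring (int p)) G V \<rho>" and fin: "finite_torsion_rep G V p \<rho>"
    and a: "a \<in> carrier (group_algebra (residue_ring (int p)) G)" and v: "v \<in> carrier V"
  shows "algebra_act G V \<rho> a v = finite_torsion_rep.aact G V \<rho> a v"
proof -
  interpret finite_torsion_rep G V p \<rho> by (rule fin)
  show ?thesis
    unfolding algebra_act_def aact_def V.lc_def
  proof (rule V.finsum_cong')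
    fix g assume g: "g \<in> carrier G"
    then have "0 \<le> a g" "a g < int p" using a by (auto simp: carrier_FpG)
    then show "a g \<odot>\<^bsub>V\<^esub> \<rho> g v = [a g] \<cdot>\<^bsub>V\<^esub> \<rho> g v"
      using v g by (simp add: linear_rep_smult[OF p rep])
  qed (use v in auto)
qed

lemma trivial_linear_rep:
  assumes "group G" "cring R"
  shows "linear_rep R G (regular_module R) (trivial_action (carrier R))"
proof -
  interpret R: cring R by fact
  interpret G: group G by fact
  have add: "abelian_group (regular_module R)"
    by (rule abelian_groupI) (auto simp: regular_module_def R.a_ac intro: R.add.l_inv_ex)
  interpret B: group "BijGroup (carrier R)" by (rule group_BijGroup)
  have "(\<lambda>g. \<lambda>x\<in>carrier R. x) \<in> hom G (BijGroup (carrier R))"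
  proof (rule homI)
    fix g h
    have one: "(\<lambda>x\<in>carrier R. x) = \<one>\<^bsub>BijGroup (carrier R)\<^esub>" by (simp add: BijGroup_def)
    show "(\<lambda>x\<in>carrier R. x) \<in> carrier (BijGroup (carrier R))" by (simp add: one)
    show "(\<lambda>x\<in>carrier R. x) = (\<lambda>x\<in>carrier R. x) \<otimes>\<^bsub>BijGroup (carrier R)\<^esub> (\<lambda>x\<in>carrier R. x)"
      by (simp only: one B.l_one B.one_closed)
  qed
  then have act: "group_action G (carrier R) (trivial_action (carrier R))"
    by (simp add: group_action_def group_hom_def group_hom_axioms_def trivial_action_def G.is_group B.is_group)
  have "Module.module R (regular_module R)"
    by (intro module.intro add assms module_axioms.intro)
      (auto simp: regular_module_def R.l_distr R.r_distr R.m_assoc)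
  then show ?thesis
    using act by (auto simp: linear_rep_def linear_rep_axioms_def) (auto simp: regular_module_def trivial_action_def)
qed

context doubly_transitive_gset
begin

text \<open>
  The indicator function of the conjugate of \<open>H\<close> at the point \<open>x\<close>, and the sum of these functions over all points.
  Since \<open>H\<close> is normal in the stabilizer of \<open>x0\<close>, the conjugate depends only on the point, and the sum is a class
  function.
\<close>

definition hconj :: "'x \<Rightarrow> 'a \<Rightarrow> int" where
  "hconj x g = of_bool (inv (sect x) \<otimes> (g \<otimes> sect x) \<in> H)"

definition hclass :: "'a \<Rightarrow> int" where "hclass g = (\<Sum>x\<in>X. hconj x g)"

lemma H_conj_iff:
  assumes b: "b \<in> carrier G" "act b x0 = x0" and c: "c \<in> carrier G"
  shows "inv b \<otimes> (c \<otimes> b) \<in> H \<longleftrightarrow> c \<in> H"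
proof
  assume "inv b \<otimes> (c \<otimes> b) \<in> H"
  from H_conj[OF inv_closed[OF b(1)] act_inv_fixed[OF b(1) _ b(2)] this]
  have "inv (inv b) \<otimes> (inv b \<otimes> (c \<otimes> b) \<otimes> inv b) \<in> H" by simp
  moreover have "inv (inv b) \<otimes> (inv b \<otimes> (c \<otimes> b) \<otimes> inv b) = b \<otimes> inv b \<otimes> c \<otimes> (b \<otimes> inv b)"
    using b c by (simp only: m_assoc m_closed inv_closed inv_inv)
  ultimately show "c \<in> H" using b c by simp
qed (use H_conj b in auto)

lemma hconj_act:
  assumes k: "k \<in> carrier G" and g: "g \<in> carrier G" and y: "y \<in> X"
  shows "hconj (act k y) (k \<otimes> g) = hconj y (g \<otimes> k)"
proof -
  define s s' b where "s = sect (act k y)" and "s' = sect y" and "b = jump k y"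
  have cl: "s \<in> carrier G" "s' \<in> carrier G" "b \<in> carrier G" "act b x0 = x0"
    using k y by (auto simp: s_def s'_def b_def)
  have e: "k \<otimes> s' = s \<otimes> b" using k y by (simp add: s_def s'_def b_def sect_jump)
  have "inv s' = inv (k \<otimes> s') \<otimes> k" using k cl by (simp add: inv_mult_group m_assoc)
  then have i: "inv s' = inv b \<otimes> inv s \<otimes> k" using cl by (simp add: e inv_mult_group)
  have "inv s' \<otimes> (g \<otimes> k \<otimes> s') = inv b \<otimes> inv s \<otimes> k \<otimes> (g \<otimes> (k \<otimes> s'))"
    using i k g cl by (simp add: m_assoc)
  also have "\<dots> = inv b \<otimes> (inv s \<otimes> (k \<otimes> g \<otimes> s) \<otimes> b)"
    using e k g cl by (simp add: m_assoc)
  finally show ?thesis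
    using H_conj_iff[OF cl(3,4), of "inv s \<otimes> (k \<otimes> g \<otimes> s)"] k g cl
    by (simp add: hconj_def flip: s_def s'_def)
qed

lemma hclass_class_function:
  assumes "k \<in> carrier G" "g \<in> carrier G"
  shows "hclass (k \<otimes> g) = hclass (g \<otimes> k)"
proof -
  have "hclass (k \<otimes> g) = (\<Sum>y\<in>X. hconj (act k y) (k \<otimes> g))"
    unfolding hclass_def using assms(1) by (rule sum_act[symmetric])
  then show ?thesis using assms by (simp add: hconj_act hclass_def)
qed

text \<open>
  The augmentation is \<open>card X * card H\<close>, and \<open>card X\<close> is \<open>2\<close> modulo \<open>p\<close>.
\<close>

lemma sum_hclass: "\<not> int p dvd (\<Sum>g\<in>carrier G. hclass g)"
proof -
  have "(\<Sum>g\<in>carrier G. hconj x g) = int (card H)" if x: "x \<in> X" for x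
  proof -
    define s where "s = sect x"
    have s: "s \<in> carrier G" using x by (simp add: s_def)
    have c: "inv s \<otimes> (s \<otimes> (g \<otimes> inv s) \<otimes> s) = g" "s \<otimes> (inv s \<otimes> (g \<otimes> s) \<otimes> inv s) = g" if "g \<in> carrier G" for g
    proof -
      have "inv s \<otimes> (s \<otimes> (g \<otimes> inv s) \<otimes> s) = inv s \<otimes> s \<otimes> g \<otimes> (inv s \<otimes> s)"
        using s that by (simp only: m_assoc m_closed inv_closed)
      then show "inv s \<otimes> (s \<otimes> (g \<otimes> inv s) \<otimes> s) = g" using s that by simp
      have "s \<otimes> (inv s \<otimes> (g \<otimes> s) \<otimes> inv s) = s \<otimes> inv s \<otimes> g \<otimes> (s \<otimes> inv s)"
        using s that by (simp only: m_assoc m_closed inv_closed)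
      then show "s \<otimes> (inv s \<otimes> (g \<otimes> s) \<otimes> inv s) = g" using s that by simp
    qed
    have "bij_betw (\<lambda>g. inv s \<otimes> (g \<otimes> s)) (carrier G) (carrier G)"
      using s c by (intro bij_betw_byWitness[of _ "\<lambda>g. s \<otimes> (g \<otimes> inv s)"]) (auto simp: m_assoc)
    from sum.reindex_bij_betw[OF this, of "\<lambda>g. of_bool (g \<in> H) :: int"]
    have "(\<Sum>g\<in>carrier G. hconj x g) = (\<Sum>g\<in>carrier G. of_bool (g \<in> H))"
      by (simp add: hconj_def s_def)
    also have "\<dots> = int (card H)"
    proof -
      have "carrier G \<inter> H = H" by (auto simp: H_def)
      then show ?thesis using finite_G by (simp add: of_bool_def sum.If_cases)
    qed
    finally show ?thesis .
  qed
  then have "(\<Sum>g\<in>carrier G. hclass g) = int (card X) * int (card H)"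
    unfolding hclass_def by (subst sum.swap) simp
  also have "[int (card X) * int (card H) = int 2 * int (card H)] (mod int p)"
    using card_X by (intro cong_scalar_right) (simp only: cong_int_iff)
  finally show ?thesis
    using not_p_dvd_double[of "int (card H)"] card_H by (simp add: cong_dvd_iff int_dvd_int_iff)
qed

text \<open>
  The central element \<open>hclass\<close> acts on the trivial module by its augmentation, hence injectively, and therefore
  also on \<open>V\<close>. So the sum of the elements of some conjugate of \<open>H\<close> does not kill \<open>V\<close>, and translating its image
  produces a nonzero vector fixed by \<open>H\<close>. On the vectors fixed by \<open>H\<close> the element \<open>t [^] P\<close> acts trivially, so \<open>t\<close>
  is unipotent and fixes a nonzero vector; \<open>H\<close> and \<open>t\<close> generate the stabilizer of \<open>x0\<close>.
\<close>

lemma principal_block_borel_fixed: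
  fixes V (structure)
  assumes rep: "linear_rep (residue_ring (int p)) G V \<rho>" and block: "in_principal_block (residue_ring (int p)) G V \<rho>"
    and nz: "carrier V \<noteq> {\<zero>\<^bsub>V\<^esub>}"
  shows "\<exists>v\<in>carrier V. v \<noteq> \<zero>\<^bsub>V\<^esub> \<and> (\<forall>b\<in>carrier G. act b x0 = x0 \<longrightarrow> \<rho> b v = v)"
proof -
  let ?R = "residue_ring (int p)"
  let ?T = "regular_module ?R" and ?\<tau> = "trivial_action (carrier ?R)"
  interpret R: residues "int p" ?R
    using prime_gt_1_nat[OF prime_p] by unfold_locales auto
  interpret V: torsion_rep G V p \<rho> by (rule linear_rep_torsion[OF prime_p rep])
  have Trep: "linear_rep ?R G ?T ?\<tau>" by (rule trivial_linear_rep) (rule is_group R.cring)+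
  interpret T: torsion_rep G ?T p ?\<tau> by (rule linear_rep_torsion[OF prime_p Trep])
  have fin: "finite_torsion_rep G V p \<rho>" "finite_torsion_rep G ?T p ?\<tau>"
    using V.torsion_rep_axioms T.torsion_rep_axioms finite_G
    by (auto simp: finite_torsion_rep_def finite_torsion_rep_axioms_def)
  interpret V: finite_torsion_rep G V p \<rho> by (rule fin)
  interpret T: finite_torsion_rep G ?T p ?\<tau> by (rule fin)
  obtain e where e: "block_idempotent (group_algebra ?R G) e"
    and eT: "lies_in_block G ?T ?\<tau> e" and eV: "lies_in_block G V \<rho> e"
    using block by (auto simp: in_principal_block_def)
  have ecl: "e \<in> carrier (group_algebra ?R G)"
    using e by (simp add: block_idempotent_def central_idempotent_def)
  have eT': "T.aact e u = u" if "u \<in> carrier ?T" for u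
    using eT that algebra_act_eq[OF prime_p Trep fin(2) ecl that] by (simp add: lies_in_block_def)
  have eV': "V.aact e u = u" if "u \<in> carrier V" for u
    using eV that algebra_act_eq[OF prime_p rep fin(1) ecl that] by (simp add: lies_in_block_def)
  have Tnz: "carrier ?T \<noteq> {\<zero>\<^bsub>?T\<^esub>}"
  proof -
    have "1 \<in> carrier ?T" "\<zero>\<^bsub>?T\<^esub> = 0" using prime_gt_1_nat[OF prime_p]
      by (auto simp: regular_module_def R.res_carrier_eq R.res_zero_eq)
    then show ?thesis by auto
  qed
  have Tz: "u = \<zero>\<^bsub>?T\<^esub>" if u: "u \<in> carrier ?T" "T.aact (V.red hclass) u = \<zero>\<^bsub>?T\<^esub>" for u
  proof (rule ccontr)
    assume "u \<noteq> \<zero>\<^bsub>?T\<^esub>"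
    have "T.aact (V.red hclass) u = T.aact hclass u" by (rule T.aact_red[OF u(1)])
    also have "\<dots> = T.V.lc (\<lambda>_. u) (carrier G) hclass"
      unfolding T.aact_def using u
      by (intro T.V.lc_cong) (auto simp: trivial_action_def regular_module_def)
    also have "\<dots> = [(\<Sum>g\<in>carrier G. hclass g)] \<cdot>\<^bsub>?T\<^esub> u"
      using u finite_G by (simp add: T.V.lc_const)
    finally have "int p dvd (\<Sum>g\<in>carrier G. hclass g)"
      using T.torsion_dvd[OF u(1) \<open>u \<noteq> \<zero>\<^bsub>?T\<^esub>\<close>] u by simp
    then show False using sum_hclass by simp
  qed
  obtain v where v: "v \<in> carrier V" "v \<noteq> \<zero>\<^bsub>V\<^esub>" using nz V.V.zero_closed by blast
  have "V.aact (V.red hclass) v \<noteq> \<zero>\<^bsub>V\<^esub>"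
    using block_central_injective[OF fin(2,1) e eT' eV' Tnz V.red_closed
        V.class_function_central[of hclass, OF hclass_class_function] Tz v(1)] v(2) by blast
  then have "V.aact hclass v \<noteq> \<zero>\<^bsub>V\<^esub>" using v by simp
  then obtain x where x: "x \<in> X" "V.aact (hconj x) v \<noteq> \<zero>\<^bsub>V\<^esub>"
    using V.V.lc_sum_zero[of "\<lambda>g. \<rho> g v" "carrier G" X hconj] v
    unfolding V.aact_def hclass_def by auto
  define s where "s = sect x"
  have s: "s \<in> carrier G" using x by (simp add: s_def)
  define u where "u = \<rho> (inv s) (V.aact (hconj x) v)"
  have u: "u \<in> carrier V" using s v by (simp add: u_def)
  have "\<rho> s u = V.aact (hconj x) v" using s v by (simp add: u_def flip: V.\<rho>_mult)
  then have unz: "u \<noteq> \<zero>\<^bsub>V\<^esub>" using x s by auto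
  have u_eq: "u = V.aact (\<lambda>g. of_bool (g \<otimes> s \<in> H)) v"
    unfolding u_def V.\<rho>_aact[OF inv_closed[OF s] v(1)]
  proof (rule V.aact_cong[OF v(1)])
    fix g assume g: "g \<in> carrier G"
    have "inv s \<otimes> (inv (inv s) \<otimes> g \<otimes> s) = inv s \<otimes> s \<otimes> (g \<otimes> s)"
      using s g by (simp only: m_assoc m_closed inv_closed inv_inv)
    then have "hconj x (inv (inv s) \<otimes> g) = of_bool (g \<otimes> s \<in> H)"
      using s g by (simp add: hconj_def flip: s_def)
    then show "[hconj x (inv (inv s) \<otimes> g) = of_bool (g \<otimes> s \<in> H)] (mod int p)" by simp
  qed
  have Hcl: "h \<in> carrier G" if "h \<in> H" for h using that by (simp add: H_def)
  have fixed: "\<rho> h u = u" if h: "h \<in> H" for h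
    unfolding u_eq V.\<rho>_aact[OF Hcl[OF h] v(1)]
  proof (rule V.aact_cong[OF v(1)])
    fix g assume g: "g \<in> carrier G"
    have "inv h \<otimes> g \<otimes> s \<in> H \<longleftrightarrow> g \<otimes> s \<in> H"
    proof
      assume "inv h \<otimes> g \<otimes> s \<in> H"
      from H_mult[OF h this] have "h \<otimes> (inv h \<otimes> g \<otimes> s) \<in> H" .
      moreover have "h \<otimes> (inv h \<otimes> g \<otimes> s) = h \<otimes> inv h \<otimes> (g \<otimes> s)"
        using Hcl[OF h] g s by (simp only: m_assoc m_closed inv_closed)
      ultimately show "g \<otimes> s \<in> H" using Hcl[OF h] g s by simp
    next
      assume "g \<otimes> s \<in> H"
      then show "inv h \<otimes> g \<otimes> s \<in> H" using H_mult[OF H_inv[OF h]] Hcl[OF h] g s by (simp add: m_assoc)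
    qed
    then show "[of_bool (inv h \<otimes> g \<otimes> s \<in> H) = (of_bool (g \<otimes> s \<in> H) :: int)] (mod int p)" by simp
  qed
  define W where "W = {y \<in> carrier V. \<forall>h\<in>H. \<rho> h y = y}"
  have W: "subgroup W (add_monoid V)"
  proof (rule V.V.add.subgroupI)
    show "W \<subseteq> carrier V" "W \<noteq> {}" using u fixed by (auto simp: W_def)
    fix a assume a: "a \<in> W"
    then show "\<ominus>\<^bsub>V\<^esub> a \<in> W"
      using V.\<rho>_int_pow[of _ a "-1"] Hcl by (auto simp: W_def V.int_neg1)
    fix b assume "b \<in> W"
    with a show "a \<oplus>\<^bsub>V\<^esub> b \<in> W" using Hcl by (auto simp: W_def V.\<rho>_add)
  qed
  have Wt: "\<rho> t y \<in> W" if y: "y \<in> W" for y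
  proof -
    have yV: "y \<in> carrier V" using y by (simp add: W_def)
    have "\<rho> h (\<rho> t y) = \<rho> t y" if h: "h \<in> H" for h
    proof -
      have "h \<otimes> t = t \<otimes> (inv t \<otimes> (h \<otimes> t))" using Hcl[OF h] by (simp flip: m_assoc)
      then have "\<rho> h (\<rho> t y) = \<rho> t (\<rho> (inv t \<otimes> (h \<otimes> t)) y)"
        using Hcl[OF h] yV by (simp flip: V.\<rho>_mult)
      also have "\<rho> (inv t \<otimes> (h \<otimes> t)) y = y"
        using y H_conj[OF t(1,2) h] by (simp add: W_def)
      finally show ?thesis .
    qed
    then show ?thesis using yV by (simp add: W_def)
  qed
  obtain k where k: "P = p ^ k" using P(1) by blast
  have "\<exists>y\<in>W. y \<noteq> \<zero>\<^bsub>V\<^esub> \<and> \<rho> t y = y"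
    using V.unipotent_of_prime_power_order[OF t(1) W Wt _ unz _ p_ne_2, of k] u fixed t_pow_P_H
    by (auto simp: W_def k)
  then obtain y where y: "y \<in> W" "y \<noteq> \<zero>\<^bsub>V\<^esub>" "\<rho> t y = y" by blast
  have yV: "y \<in> carrier V" using y by (simp add: W_def)
  have tpow: "\<rho> (t [^] (i::nat)) y = y" for i
    by (induction i) (use y(3) yV in \<open>auto simp: V.\<rho>_mult\<close>)
  have "\<rho> b y = y" if b: "b \<in> carrier G" "act b x0 = x0" for b
  proof -
    define i where "i = nat (\<theta> b mod int P)"
    have i: "[int i = \<theta> b] (mod int P)" using P_gt_1 by (simp add: i_def)
    define h where "h = b \<otimes> inv (t [^] i)"
    have ti: "act (t [^] i) x0 = x0" by (rule act_pow_fixed) auto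
    have "[\<theta> h = \<theta> b + \<theta> (inv (t [^] i))] (mod int P)"
      unfolding h_def using b ti by (intro \<theta>_mult) (auto simp: act_inv_fixed)
    also have "[\<theta> b + \<theta> (inv (t [^] i)) = \<theta> b + - \<theta> (t [^] i)] (mod int P)"
      using ti by (intro cong_add \<theta>_inv cong_refl) auto
    also have "[\<theta> b + - \<theta> (t [^] i) = \<theta> b + - int i] (mod int P)"
      using \<theta>_pow by (intro cong_add cong_refl) (simp add: cong_minus_minus_iff)
    also have "[\<theta> b + - int i = \<theta> b + - \<theta> b] (mod int P)"
      using i by (intro cong_add cong_refl) (simp add: cong_minus_minus_iff)
    finally have "int P dvd \<theta> h" by (simp add: cong_0_iff)
    then have hH: "h \<in> H" using b ti by (simp add: H_def h_def act_mult act_inv_fixed)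
    have "b = h \<otimes> t [^] i" using b by (simp add: h_def m_assoc)
    then have "\<rho> b y = \<rho> h (\<rho> (t [^] i) y)" using Hcl[OF hH] yV by (simp add: V.\<rho>_mult)
    then show ?thesis using y hH by (simp add: tpow W_def)
  qed
  then show ?thesis using y yV by blast
qed

text \<open>
  It remains to see that a nonprincipal irreducible module has no nonzero fixed vectors: such a vector \<open>u\<close> would
  span the module, and its multiples form the principal module.
\<close>

theorem cohomology_principal_block:
  fixes V (structure)
  assumes irr: "irreducible_rep (residue_ring (int p)) G V \<rho>"
    and nonprincipal: "\<not> rep_isomorphic (residue_ring (int p)) G V \<rho> (regular_module (residue_ring (int p)))
      (trivial_action (carrier (residue_ring (int p))))"
    and block: "in_principal_block (residue_ring (int p)) G V \<rho>"
  shows "group (group_cohomology 1 G V \<rho>)" "group_cohomology 1 G V \<rho> \<cong> add_monoid (residue_ring (int p))"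
    "group (group_cohomology 2 G V \<rho>)" "group_cohomology 2 G V \<rho> \<cong> add_monoid (residue_ring (int p))"
proof -
  let ?R = "residue_ring (int p)"
  interpret R: residues "int p" ?R
    using prime_gt_1_nat[OF prime_p] by unfold_locales auto
  have rep: "linear_rep ?R G V \<rho>" by (rule irreducible_rep.axioms(1)[OF irr])
  interpret V: torsion_rep G V p \<rho> by (rule linear_rep_torsion[OF prime_p rep])
  interpret irreducible_rep ?R G V \<rho> by (rule irr)
  have irred: "W = {\<zero>\<^bsub>V\<^esub>} \<or> W = carrier V"
    if W: "subgroup W (add_monoid V)" "\<And>g u. \<lbrakk>g \<in> carrier G; u \<in> W\<rbrakk> \<Longrightarrow> \<rho> g u \<in> W" for W
  proof (rule irreducible)
    have "a \<odot>\<^bsub>V\<^esub> u \<in> W" if a: "a \<in> carrier ?R" and u: "u \<in> W" for a u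
    proof -
      have "u \<in> carrier V" using u subgroup.subset[OF W(1)] by auto
      then have "a \<odot>\<^bsub>V\<^esub> u = [a] \<cdot>\<^bsub>V\<^esub> u"
        using a by (intro linear_rep_smult[OF prime_p rep]) (auto simp: R.res_carrier_eq)
      also have "\<dots> \<in> W"
        using group.subgroup_int_pow_closed[OF V.V.a_group W(1) u, of a] by (simp add: add_pow_def)
      finally show ?thesis .
    qed
    then show "submodule W ?R V"
      using W(1) by (simp add: submodule_def submodule_axioms_def)
  qed (use W in auto)
  have no_fixed: "u = \<zero>\<^bsub>V\<^esub>" if u: "u \<in> carrier V" "\<And>g. g \<in> carrier G \<Longrightarrow> \<rho> g u = u" for u
  proof (rule ccontr)
    assume unz: "u \<noteq> \<zero>\<^bsub>V\<^esub>"
    have W: "range (\<lambda>k::int. [k] \<cdot>\<^bsub>V\<^esub> u) = carrier V"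
    proof -
      have "subgroup (range (\<lambda>k::int. [k] \<cdot>\<^bsub>V\<^esub> u)) (add_monoid V)"
      proof (rule V.V.add.subgroupI)
        show "range (\<lambda>k::int. [k] \<cdot>\<^bsub>V\<^esub> u) \<subseteq> carrier V" "range (\<lambda>k::int. [k] \<cdot>\<^bsub>V\<^esub> u) \<noteq> {}" using u by auto
        fix a assume "a \<in> range (\<lambda>k::int. [k] \<cdot>\<^bsub>V\<^esub> u)"
        then obtain k :: int where a: "a = [k] \<cdot>\<^bsub>V\<^esub> u" by auto
        then have "\<ominus>\<^bsub>V\<^esub> a = [(- k)] \<cdot>\<^bsub>V\<^esub> u" using u by (simp add: V.V.add.int_pow_neg)
        then show "\<ominus>\<^bsub>V\<^esub> a \<in> range (\<lambda>k::int. [k] \<cdot>\<^bsub>V\<^esub> u)" by blast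
        fix b assume "b \<in> range (\<lambda>k::int. [k] \<cdot>\<^bsub>V\<^esub> u)"
        then obtain l :: int where "b = [l] \<cdot>\<^bsub>V\<^esub> u" by auto
        then have "a \<oplus>\<^bsub>V\<^esub> b = [(k + l)] \<cdot>\<^bsub>V\<^esub> u" using u a by (simp add: V.V.add.int_pow_mult)
        then show "a \<oplus>\<^bsub>V\<^esub> b \<in> range (\<lambda>k::int. [k] \<cdot>\<^bsub>V\<^esub> u)" by blast
      qed
      moreover have "u \<in> range (\<lambda>k::int. [k] \<cdot>\<^bsub>V\<^esub> u)"
        using u by (intro range_eqI[of _ _ 1]) simp
      moreover have "\<rho> g a \<in> range (\<lambda>k::int. [k] \<cdot>\<^bsub>V\<^esub> u)"
        if "g \<in> carrier G" "a \<in> range (\<lambda>k::int. [k] \<cdot>\<^bsub>V\<^esub> u)" for g a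
        using that u by (auto simp: V.\<rho>_int_pow)
      ultimately show ?thesis
        using irred[of "range (\<lambda>k::int. [k] \<cdot>\<^bsub>V\<^esub> u)"] unz by blast
    qed
    have eq: "[k] \<cdot>\<^bsub>V\<^esub> u = [l] \<cdot>\<^bsub>V\<^esub> u \<longleftrightarrow> [k = l] (mod int p)" for k l :: int
    proof
      assume "[k] \<cdot>\<^bsub>V\<^esub> u = [l] \<cdot>\<^bsub>V\<^esub> u"
      then have "[(k - l)] \<cdot>\<^bsub>V\<^esub> u = \<zero>\<^bsub>V\<^esub>"
        using u V.V.add.int_pow_mult[of u k "- l"] by (simp add: V.V.add.int_pow_neg V.V.r_neg)
      then show "[k = l] (mod int p)" using V.torsion_dvd[OF u(1) unz] by (simp add: cong_iff_dvd_diff)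
    next
      assume kl: "[k = l] (mod int p)"
      have "V.V.lc (\<lambda>_. u) {()} (\<lambda>_. k) = V.V.lc (\<lambda>_. u) {()} (\<lambda>_. l)"
        using u kl by (intro V.V.lc_torsion[of _ _ "int p"]) (auto simp: V.torsion)
      then show "[k] \<cdot>\<^bsub>V\<^esub> u = [l] \<cdot>\<^bsub>V\<^esub> u" using u by (simp add: V.V.lc_const)
    qed
    define f where "f v = (SOME k::int. v = [k] \<cdot>\<^bsub>V\<^esub> u) mod int p" for v
    have f: "f ([k] \<cdot>\<^bsub>V\<^esub> u) = k mod int p" for k :: int
    proof -
      have "[k] \<cdot>\<^bsub>V\<^esub> u = [(SOME l::int. [k] \<cdot>\<^bsub>V\<^esub> u = [l] \<cdot>\<^bsub>V\<^esub> u)] \<cdot>\<^bsub>V\<^esub> u" by (rule someI) (rule refl)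
      then show ?thesis by (simp add: eq f_def cong_def)
    qed
    have "rep_isomorphic ?R G V \<rho> (regular_module ?R) (trivial_action (carrier ?R))"
      unfolding rep_isomorphic_def
    proof (intro exI[of _ f] conjI ballI)
      show "bij_betw f (carrier V) (carrier (regular_module ?R))"
      proof (rule bij_betw_byWitness[of _ "\<lambda>k. [k] \<cdot>\<^bsub>V\<^esub> u"])
        show "\<forall>a\<in>carrier V. [f a] \<cdot>\<^bsub>V\<^esub> u = a" unfolding W[symmetric] by (auto simp: f eq)
        show "\<forall>a'\<in>carrier (regular_module ?R). f ([a'] \<cdot>\<^bsub>V\<^esub> u) = a'"
          by (auto simp: f regular_module_def R.res_carrier_eq)
        show "f ` carrier V \<subseteq> carrier (regular_module ?R)"
          using prime_gt_0_nat[OF prime_p] by (auto simp: f_def regular_module_def R.res_carrier_eq)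
        show "(\<lambda>k. [k] \<cdot>\<^bsub>V\<^esub> u) ` carrier (regular_module ?R) \<subseteq> carrier V" using u by auto
      qed
    next
      fix x y assume "x \<in> carrier V" "y \<in> carrier V"
      then obtain k l :: int where x: "x = [k] \<cdot>\<^bsub>V\<^esub> u" and y: "y = [l] \<cdot>\<^bsub>V\<^esub> u" unfolding W[symmetric] by auto
      have "f (x \<oplus>\<^bsub>V\<^esub> y) = (k + l) mod int p" using u f[of "k + l"] by (simp add: x y V.V.add.int_pow_mult)
      then show "f (x \<oplus>\<^bsub>V\<^esub> y) = f x \<oplus>\<^bsub>regular_module ?R\<^esub> f y"
        by (simp add: x y f regular_module_def R.res_add_eq mod_add_eq)
    next
      fix a x assume a: "a \<in> carrier ?R" and x: "x \<in> carrier V"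
      then obtain k :: int where k: "x = [k] \<cdot>\<^bsub>V\<^esub> u" unfolding W[symmetric] by auto
      have "a \<odot>\<^bsub>V\<^esub> x = [a] \<cdot>\<^bsub>V\<^esub> x"
        using a x by (intro linear_rep_smult[OF prime_p rep]) (auto simp: R.res_carrier_eq)
      also have "\<dots> = [(a * k)] \<cdot>\<^bsub>V\<^esub> u" using u by (simp add: k V.V.add.int_pow_pow mult.commute)
      finally have "f (a \<odot>\<^bsub>V\<^esub> x) = (a * k) mod int p" by (simp add: f)
      then show "f (a \<odot>\<^bsub>V\<^esub> x) = a \<odot>\<^bsub>regular_module ?R\<^esub> f x"
        by (simp add: k f regular_module_def R.res_mult_eq mod_mult_right_eq)
    next
      fix g x assume g: "g \<in> carrier G" and x: "x \<in> carrier V"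
      then obtain k :: int where k: "x = [k] \<cdot>\<^bsub>V\<^esub> u" unfolding W[symmetric] by auto
      have "\<rho> g x = x" using u g by (simp add: k V.\<rho>_int_pow)
      moreover have "f x \<in> carrier ?R" using prime_gt_0_nat[OF prime_p] by (simp add: f_def R.res_carrier_eq)
      ultimately show "f (\<rho> g x) = trivial_action (carrier ?R) g (f x)"
        by (simp add: trivial_action_def)
    qed
    then show False using nonprincipal by blast
  qed
  obtain v0 where v0: "v0 \<in> carrier V" "v0 \<noteq> \<zero>\<^bsub>V\<^esub>"
    "\<And>b. \<lbrakk>b \<in> carrier G; act b x0 = x0\<rbrakk> \<Longrightarrow> \<rho> b v0 = v0"
    using principal_block_borel_fixed[OF rep block nonzero] by blast
  interpret principal_series_rep G X act p P x0 x1 t w \<theta> V \<rho> v0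
    by unfold_locales (use v0 irred no_fixed in auto)
  show "group (group_cohomology 1 G V \<rho>)" "group_cohomology 1 G V \<rho> \<cong> add_monoid (residue_ring (int p))"
    "group (group_cohomology 2 G V \<rho>)" "group_cohomology 2 G V \<rho> \<cong> add_monoid (residue_ring (int p))"
    by (fact cohomology_1 cohomology_2)+
qed

end

section \<open>The projective special linear group acting on the projective line\<close>

subsection \<open>Two by two matrices\<close>

definition vec2 :: "'f \<Rightarrow> 'f \<Rightarrow> 'f::field ^ 2" where "vec2 x y = vector [x, y]"

definition mat2 :: "'f \<Rightarrow> 'f \<Rightarrow> 'f \<Rightarrow> 'f \<Rightarrow> 'f::field ^ 2 ^ 2" where
  "mat2 a b c d = vector [vec2 a b, vec2 c d]"

lemma vec2_nth [simp]: "vec2 x y $ 1 = x" "vec2 x y $ 2 = y"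
  by (simp_all add: vec2_def)

lemma mat2_nth [simp]: "mat2 a b c d $ 1 = vec2 a b" "mat2 a b c d $ 2 = vec2 c d"
  by (simp_all add: mat2_def)

lemma vec2_eta: "v = vec2 (v $ 1) (v $ 2)"
  by (simp add: vec_eq_iff forall_2)

lemma mat2_eta: "A = mat2 (A $ 1 $ 1) (A $ 1 $ 2) (A $ 2 $ 1) (A $ 2 $ 2)"
  by (simp add: vec_eq_iff forall_2)

lemma vec2_eq_iff [simp]: "vec2 x y = vec2 x' y' \<longleftrightarrow> x = x' \<and> y = y'"
  by (auto simp: vec_eq_iff forall_2)

lemma mat2_eq_iff [simp]: "mat2 a b c d = mat2 a' b' c' d' \<longleftrightarrow> a = a' \<and> b = b' \<and> c = c' \<and> d = d'"
  by (auto simp: vec_eq_iff forall_2)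

lemma mat2_mult: "mat2 a b c d ** mat2 a' b' c' d' =
    mat2 (a * a' + b * c') (a * b' + b * d') (c * a' + d * c') (c * b' + d * d')"
  by (simp add: vec_eq_iff forall_2 matrix_matrix_mult_def sum_2)

lemma mat2_mult_vec: "mat2 a b c d *v vec2 x y = vec2 (a * x + b * y) (c * x + d * y)"
  by (simp add: vec_eq_iff forall_2 matrix_vector_mult_def sum_2)

lemma det_mat2: "det (mat2 a b c d) = a * d - b * c"
  by (simp add: det_2)

lemma mat_eq_mat2: "mat c = mat2 c 0 0 c"
  by (simp add: vec_eq_iff forall_2 mat_def)

lemma smult_vec2: "k *s vec2 x y = vec2 (k * x) (k * y)"
  by (simp add: vec_eq_iff forall_2)

lemma vec2_zero: "0 = vec2 0 0"
  by (simp add: vec_eq_iff forall_2)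

lemma mat_mult_left: "mat c ** (A :: 'f::field ^ 2 ^ 2) = mat2 (c * A $ 1 $ 1) (c * A $ 1 $ 2) (c * A $ 2 $ 1) (c * A $ 2 $ 2)"
  by (subst mat2_eta[of A]) (simp add: mat_eq_mat2 mat2_mult)

lemma mat_mult_commute: "mat c ** A = (A :: 'f::field ^ 2 ^ 2) ** mat c"
proof -
  have "A ** mat c = mat2 (c * A $ 1 $ 1) (c * A $ 1 $ 2) (c * A $ 2 $ 1) (c * A $ 2 $ 2)"
    by (subst mat2_eta[of A]) (simp add: mat_eq_mat2 mat2_mult mult.commute)
  then show ?thesis by (simp add: mat_mult_left)
qed

lemma matrix_smult_vec: "(A :: 'f::field ^ 2 ^ 2) *v (k *s v) = k *s (A *v v)"
  by (subst (1 2) mat2_eta[of A], subst (1 2) vec2_eta[of v])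
    (simp add: mat2_mult_vec smult_vec2 algebra_simps)

lemma mat_mult_vec: "(mat c ** (A :: 'f::field ^ 2 ^ 2)) *v v = c *s (A *v v)"
  by (subst mat_mult_left, subst (2) mat2_eta[of A], subst (1 2) vec2_eta[of v])
    (simp add: mat2_mult_vec smult_vec2 algebra_simps)

subsection \<open>The group\<close>

lemma carrier_SL2: "A \<in> carrier SL2 \<longleftrightarrow> det A = 1"
  and mult_SL2: "A \<otimes>\<^bsub>SL2\<^esub> B = A ** B"
  and one_SL2: "\<one>\<^bsub>SL2\<^esub> = mat 1"
  by (simp_all add: SL2_def)

lemma group_SL2: "group (SL2 :: ('f::{field,finite} ^ 2 ^ 2) monoid)"
proof (rule groupI)
  fix A :: "'f ^ 2 ^ 2" assume "A \<in> carrier SL2"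
  then have d: "A $ 1 $ 1 * A $ 2 $ 2 - A $ 1 $ 2 * A $ 2 $ 1 = 1" by (simp add: carrier_SL2 det_2)
  have "mat2 (A $ 2 $ 2) (- A $ 1 $ 2) (- A $ 2 $ 1) (A $ 1 $ 1) ** A = mat 1"
    by (subst (5) mat2_eta[of A]) (use d in \<open>simp add: mat2_mult mat_eq_mat2 algebra_simps\<close>)
  moreover have "mat2 (A $ 2 $ 2) (- A $ 1 $ 2) (- A $ 2 $ 1) (A $ 1 $ 1) \<in> carrier SL2"
    using d by (simp add: carrier_SL2 det_mat2 algebra_simps)
  ultimately show "\<exists>B\<in>carrier SL2. B \<otimes>\<^bsub>SL2\<^esub> A = \<one>\<^bsub>SL2\<^esub>"
    by (auto simp: mult_SL2 one_SL2)
qed (auto simp: carrier_SL2 mult_SL2 one_SL2 det_mul matrix_mul_assoc)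

lemma SL2_scalars_iff: "A \<in> SL2_scalars \<longleftrightarrow> (\<exists>c. A = mat c \<and> c * c = 1)"
  by (auto simp: SL2_scalars_def carrier_SL2 mat_eq_mat2 det_mat2)

lemma SL2_scalars_eq: "SL2_scalars = {mat c | c. c * c = 1}"
  by (auto simp: SL2_scalars_iff)

lemma normal_scalars: "(SL2_scalars :: ('f::{field,finite} ^ 2 ^ 2) set) \<lhd> SL2"
proof -
  interpret group "SL2 :: ('f ^ 2 ^ 2) monoid" by (rule group_SL2)
  have sub: "subgroup (SL2_scalars :: ('f ^ 2 ^ 2) set) SL2"
  proof (rule subgroupI)
    show "SL2_scalars \<subseteq> carrier SL2" by (auto simp: SL2_scalars_def)
    have "mat 1 \<in> (SL2_scalars :: ('f ^ 2 ^ 2) set)" unfolding SL2_scalars_iff by (rule exI[of _ 1]) simp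
    then show "(SL2_scalars :: ('f ^ 2 ^ 2) set) \<noteq> {}" by blast
    fix A :: "'f ^ 2 ^ 2" assume A: "A \<in> SL2_scalars"
    then obtain c where c: "A = mat c" "c * c = 1" unfolding SL2_scalars_iff by blast
    have "A ** A = mat 1" by (simp add: c mat_eq_mat2 mat2_mult)
    moreover have "A \<in> carrier SL2" using A by (simp add: SL2_scalars_def)
    ultimately have "inv\<^bsub>SL2\<^esub> A = A" by (intro inv_equality) (simp_all add: mult_SL2 one_SL2)
    then show "inv\<^bsub>SL2\<^esub> A \<in> SL2_scalars" using A by simp
    fix B :: "'f ^ 2 ^ 2" assume "B \<in> SL2_scalars"
    then obtain d where d: "B = mat d" "d * d = 1" unfolding SL2_scalars_iff by blast
    have "A ** B = mat (c * d)" by (simp add: c d mat_eq_mat2 mat2_mult)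
    moreover have "(c * d) * (c * d) = 1" using c(2) d(2) by (simp add: mult.left_commute mult.assoc)
    ultimately show "A \<otimes>\<^bsub>SL2\<^esub> B \<in> SL2_scalars" unfolding SL2_scalars_iff mult_SL2 by blast
  qed
  show ?thesis
  proof (rule normalI[OF sub], intro ballI)
    fix A :: "'f ^ 2 ^ 2" assume "A \<in> carrier SL2"
    show "SL2_scalars #>\<^bsub>SL2\<^esub> A = A <#\<^bsub>SL2\<^esub> SL2_scalars"
      by (auto simp: r_coset_def l_coset_def mult_SL2 SL2_scalars_eq mat_mult_commute)
  qed
qed

text \<open>
  The class of a matrix in \<open>PSL\<^sub>2\<close>; \<open>lift\<close> below chooses a representative, which is determined up to sign.
\<close>

definition proj :: "'f::{field,finite} ^ 2 ^ 2 \<Rightarrow> ('f ^ 2 ^ 2) set" where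
  "proj A = SL2_scalars #>\<^bsub>SL2\<^esub> A"

lemma group_PSL2: "group (PSL2 :: ('f::{field,finite} ^ 2 ^ 2) set monoid)"
  unfolding PSL2_def by (rule normal.factorgroup_is_group[OF normal_scalars])

lemma carrier_PSL2: "carrier PSL2 = proj ` carrier SL2"
  by (auto simp: PSL2_def FactGroup_def RCOSETS_def proj_def)

lemma proj_closed [simp]: "det A = 1 \<Longrightarrow> proj A \<in> carrier PSL2"
  by (auto simp: carrier_PSL2 carrier_SL2)

lemma proj_mult: "\<lbrakk>det A = 1; det B = 1\<rbrakk> \<Longrightarrow> proj A \<otimes>\<^bsub>PSL2\<^esub> proj B = proj (A ** B)"
  using normal.rcos_sum[OF normal_scalars, of A B]
  by (simp add: PSL2_def FactGroup_def proj_def carrier_SL2 mult_SL2)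

lemma mem_proj: "B \<in> proj A \<longleftrightarrow> (\<exists>c. B = mat c ** A \<and> c * c = 1)"
  by (auto simp: proj_def r_coset_def SL2_scalars_eq mult_SL2)

lemma self_mem_proj: "A \<in> proj A"
  unfolding mem_proj by (rule exI[of _ 1]) simp

lemma proj_one: "\<one>\<^bsub>PSL2\<^esub> = proj (mat 1 :: 'f::{field,finite} ^ 2 ^ 2)"
proof -
  interpret group "PSL2 :: ('f ^ 2 ^ 2) set monoid" by (rule group_PSL2)
  have "proj (mat 1) \<otimes>\<^bsub>PSL2\<^esub> proj (mat 1) = proj (mat 1 :: 'f ^ 2 ^ 2)" by (simp add: proj_mult)
  moreover have "proj (mat 1 :: 'f ^ 2 ^ 2) \<in> carrier PSL2" by simp
  ultimately show ?thesis using l_cancel_one' by metis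
qed

definition lift :: "('f::{field,finite} ^ 2 ^ 2) set \<Rightarrow> 'f ^ 2 ^ 2" where
  "lift Q = (SOME A. det A = 1 \<and> Q = proj A)"

lemma lift:
  assumes "Q \<in> carrier PSL2" shows "det (lift Q) = 1" "proj (lift Q) = Q"
proof -
  have "\<exists>A. det A = 1 \<and> Q = proj A" using assms by (auto simp: carrier_PSL2 carrier_SL2)
  from someI_ex[OF this] show "det (lift Q) = 1" "proj (lift Q) = Q" by (simp_all add: lift_def)
qed

lemma lift_proj: "det A = 1 \<Longrightarrow> \<exists>c. lift (proj A) = mat c ** A \<and> c * c = 1"
  using lift(2)[of "proj A"] self_mem_proj[of "lift (proj A)"] mem_proj by (metis proj_closed)

subsection \<open>The projective line\<close>

text \<open>
  Points of the projective line are represented by the set of all vectors on a line through the origin. The image of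
  such a set does not change when the matrix is multiplied by a nonzero scalar, so the action of \<open>PSL\<^sub>2\<close>
  can be defined with arbitrary lifts.
\<close>

definition line :: "'f::field ^ 2 \<Rightarrow> ('f ^ 2) set" where
  "line v = range (\<lambda>k. k *s v)"

definition proj_line :: "('f::field ^ 2) set set" where
  "proj_line = {line v | v. v \<noteq> 0}"

definition proj_act :: "('f::{field,finite} ^ 2 ^ 2) set \<Rightarrow> ('f ^ 2) set \<Rightarrow> ('f ^ 2) set" where
  "proj_act Q l = (\<lambda>v. lift Q *v v) ` l"

lemma self_mem_line: "v \<in> line v"
  unfolding line_def by (rule range_eqI[of _ _ 1]) simp

lemma line_smult: assumes "k \<noteq> 0" shows "line (k *s v) = line v"
proof (intro equalityI subsetI)
  fix w assume "w \<in> line v"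
  then obtain l where "w = l *s v" by (auto simp: line_def)
  then have "w = (l / k) *s (k *s v)" using assms by simp
  then show "w \<in> line (k *s v)" unfolding line_def by blast
qed (auto simp: line_def)

lemma line_eq_iff: 
  assumes "v \<noteq> 0" shows "line v = line w \<longleftrightarrow> (\<exists>k. v = k *s w)"
proof
  assume "line v = line w"
  then show "\<exists>k. v = k *s w" using self_mem_line[of v] by (auto simp: line_def)
next
  assume "\<exists>k. v = k *s w"
  then obtain k where "v = k *s w" by blast
  then show "line v = line w" using assms line_smult[of k w] by auto
qed

lemma image_line: "(\<lambda>v. A *v v) ` line v = line (A *v v)"
  by (auto simp: line_def matrix_smult_vec image_iff)

lemma det_inj:
  assumes "det (A :: 'f::field ^ 2 ^ 2) = 1" "v \<noteq> 0" shows "A *v v \<noteq> 0"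
proof
  assume 0: "A *v v = 0"
  obtain a b c d where A: "A = mat2 a b c d" using mat2_eta by blast
  obtain x y where v: "v = vec2 x y" using vec2_eta by blast
  have e: "a * x + b * y = 0" "c * x + d * y = 0" "a * d - b * c = 1"
    using 0 assms by (simp_all add: A v mat2_mult_vec vec2_zero det_mat2)
  have "(a * d - b * c) * x = d * (a * x + b * y) - b * (c * x + d * y)"
    "(a * d - b * c) * y = a * (c * x + d * y) - c * (a * x + b * y)"
    by (simp_all add: algebra_simps)
  then have "x = 0" "y = 0" unfolding e by simp_all
  then show False using assms by (simp add: v vec2_zero)
qed

lemma proj_act_line:
  assumes "det A = 1" shows "proj_act (proj A) (line v) = line (A *v v)"
proof -
  obtain c where c: "lift (proj A) = mat c ** A" "c * c = 1" using lift_proj[OF assms] by blast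
  then have "c \<noteq> 0" by auto
  then show ?thesis unfolding proj_act_def image_line c(1) mat_mult_vec by (rule line_smult)
qed

lemma gset_PSL2: "gset (PSL2 :: ('f::{field,finite} ^ 2 ^ 2) set monoid) proj_line proj_act"
proof (intro gset.intro group_PSL2 gset_axioms.intro)
  fix g :: "('f ^ 2 ^ 2) set" and x :: "('f ^ 2) set" assume "g \<in> carrier PSL2" "x \<in> proj_line"
  then obtain A v where "g = proj A" "det A = 1" "x = line v" "v \<noteq> 0"
    by (auto simp: carrier_PSL2 carrier_SL2 proj_line_def)
  then show "proj_act g x \<in> proj_line" using det_inj by (auto simp: proj_act_line proj_line_def)
next
  fix x :: "('f ^ 2) set" assume "x \<in> proj_line"
  then show "proj_act \<one>\<^bsub>PSL2\<^esub> x = x" by (auto simp: proj_line_def proj_one proj_act_line)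
next
  fix g h :: "('f ^ 2 ^ 2) set" and x :: "('f ^ 2) set"
  assume "g \<in> carrier PSL2" "h \<in> carrier PSL2" "x \<in> proj_line"
  then obtain A B v where "g = proj A" "det A = 1" "h = proj B" "det B = 1" "x = line v"
    by (auto simp: carrier_PSL2 carrier_SL2 proj_line_def)
  then show "proj_act (g \<otimes>\<^bsub>PSL2\<^esub> h) x = proj_act g (proj_act h x)"
    by (simp add: proj_mult proj_act_line det_mul matrix_vector_mul_assoc)
qed

abbreviation "e1 \<equiv> vec2 1 0"
abbreviation "e2 \<equiv> vec2 0 1"

lemma line_e1_iff: "vec2 x y \<noteq> 0 \<Longrightarrow> line (vec2 x y) = line e1 \<longleftrightarrow> y = 0"
  by (auto simp: line_eq_iff smult_vec2)

lemma line_e2_iff: "vec2 x y \<noteq> 0 \<Longrightarrow> line (vec2 x y) = line e2 \<longleftrightarrow> x = 0"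
  by (auto simp: line_eq_iff smult_vec2)

lemma proj_line_eq: "proj_line = insert (line e1) ((\<lambda>a. line (vec2 a 1)) ` (UNIV :: 'f::field set))"
proof (intro equalityI subsetI)
  fix l :: "('f ^ 2) set" assume "l \<in> proj_line"
  then obtain v where v: "l = line v" "v \<noteq> 0" by (auto simp: proj_line_def)
  obtain x y where xy: "v = vec2 x y" using vec2_eta by blast
  show "l \<in> insert (line e1) ((\<lambda>a. line (vec2 a 1)) ` UNIV)"
  proof (cases "y = 0")
    case True
    then show ?thesis using v line_e1_iff[of x y] by (simp add: xy)
  next
    case False
    then have "vec2 x y = y *s vec2 (x / y) 1" by (simp add: smult_vec2)
    then have "l = line (vec2 (x / y) 1)" using False v by (simp add: xy line_smult)
    then show ?thesis by blast
  qed
qed (auto simp: proj_line_def vec2_zero)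

lemma card_proj_line: "card (proj_line :: ('f::{field,finite} ^ 2) set set) = CARD('f) + 1"
proof -
  have "inj (\<lambda>a :: 'f. line (vec2 a 1))"
    by (rule injI) (auto simp: line_eq_iff vec2_zero smult_vec2)
  moreover have "line e1 \<notin> (\<lambda>a :: 'f. line (vec2 a 1)) ` UNIV"
    by (auto simp: line_eq_iff vec2_zero smult_vec2)
  ultimately show ?thesis by (simp add: proj_line_eq card_image)
qed

lemma proj_line_doubly_transitive:
  assumes "x \<in> proj_line" "y \<in> proj_line" "x \<noteq> y"
  shows "\<exists>g\<in>carrier PSL2. proj_act g (line e1) = x \<and> proj_act g (line e2) = (y :: ('f::{field,finite} ^ 2) set)"
proof -
  obtain v w where v: "x = line v" "v \<noteq> 0" and w: "y = line w" "w \<noteq> 0"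
    using assms by (auto simp: proj_line_def)
  obtain a c where ac: "v = vec2 a c" using vec2_eta by blast
  obtain b d where bd: "w = vec2 b d" using vec2_eta by blast
  define D where "D = a * d - b * c"
  have D: "D \<noteq> 0"
  proof
    assume "D = 0"
    then have e: "a * d = b * c" by (simp add: D_def)
    have "\<exists>k. v = k *s w"
    proof (cases "b = 0")
      case True
      then have "d \<noteq> 0" "a = 0" using w e by (auto simp: bd vec2_zero)
      then show ?thesis using True by (intro exI[of _ "c / d"]) (simp add: ac bd smult_vec2)
    next
      case False
      then show ?thesis using e by (intro exI[of _ "a / b"]) (simp add: ac bd smult_vec2 field_simps)
    qed
    then show False using assms v w line_eq_iff by blast
  qed
  define A where "A = mat2 a (b / D) c (d / D)"
  have A: "det A = 1" using D by (simp add: A_def det_mat2 field_simps) (simp add: D_def)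
  have "A *v e1 = v" "A *v e2 = (1 / D) *s w" by (simp_all add: A_def mat2_mult_vec ac bd smult_vec2)
  then have "proj_act (proj A) (line e1) = x" "proj_act (proj A) (line e2) = y"
    using A D by (simp_all add: proj_act_line v w line_smult)
  then show ?thesis using proj_closed[OF A] by blast
qed

lemma fixes_e1_iff: "det (mat2 a b c d) = 1 \<Longrightarrow> proj_act (proj (mat2 a b c d)) (line e1) = line e1 \<longleftrightarrow> c = 0"
  using det_inj[of "mat2 a b c d" e1] by (simp add: proj_act_line mat2_mult_vec line_e1_iff vec2_zero)

lemma fixes_e2_iff: "det (mat2 a b c d) = 1 \<Longrightarrow> proj_act (proj (mat2 a b c d)) (line e2) = line e2 \<longleftrightarrow> b = 0"
  using det_inj[of "mat2 a b c d" e2] by (simp add: proj_act_line mat2_mult_vec line_e2_iff vec2_zero)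

subsection \<open>Discrete logarithms\<close>

text \<open>
  The multiplicative group of a finite field is cyclic; to use this for a type, the type is made a ring with carrier.
\<close>

lemma exists_primitive_element:
  "\<exists>\<gamma> :: 'f::{field,finite}. \<gamma> \<noteq> 0 \<and> (\<forall>a. a \<noteq> 0 \<longrightarrow> (\<exists>i. a = \<gamma> ^ i)) \<and>
     (\<forall>n. \<gamma> ^ n = 1 \<longleftrightarrow> CARD('f) - 1 dvd n)"
proof -
  let ?R = "\<lparr>carrier = UNIV, monoid.mult = (*), one = 1, ring.zero = 0, ring.add = (+)\<rparr> :: 'f ring"
  have "cring ?R"
    by (intro cringI abelian_groupI comm_monoidI)
      (auto simp: algebra_simps intro: exI[of _ "- x" for x])
  then interpret R: field ?R
    by (rule cring.cring_fieldI2) (auto intro: right_inverse)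
  have car: "carrier (mult_of ?R) = UNIV - {0}"
    by auto
  have pow: "a [^]\<^bsub>mult_of ?R\<^esub> (n::nat) = a ^ n" for a :: 'f and n
    by (induction n) (auto simp: nat_pow_def mult_of_def mult.commute)
  interpret M: group "mult_of ?R" by (rule R.field_mult_group)
  have fin: "finite (carrier ?R)" by simp
  obtain \<gamma> where \<gamma>: "\<gamma> \<in> carrier (mult_of ?R)" "carrier (mult_of ?R) = {\<gamma> [^]\<^bsub>?R\<^esub> i | i::nat. i \<in> UNIV}"
    using R.finite_field_mult_group_has_gen[OF fin] by blast
  have powR: "\<gamma> [^]\<^bsub>?R\<^esub> (i::nat) = \<gamma> ^ i" for i using pow by (simp add: nat_pow_mult_of)
  have fM: "finite (carrier (mult_of ?R))" by simp
  have "UNIV - {0} = {\<gamma> [^]\<^bsub>mult_of ?R\<^esub> i | i::nat. i \<in> UNIV}" using \<gamma>(2) by (simp add: car powR pow)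
  also have "\<dots> = (\<lambda>i. \<gamma> [^]\<^bsub>mult_of ?R\<^esub> i) ` {0..M.ord \<gamma> - 1}"
    using M.ord_elems[OF fM \<gamma>(1)] by blast
  finally have "card (UNIV - {0::'f}) = card {0..M.ord \<gamma> - 1}"
    using card_image[OF M.ord_inj[OF \<gamma>(1)]] by simp
  moreover have "0 < M.ord \<gamma>" using M.ord_ge_1[OF fM \<gamma>(1)] by simp
  ultimately have ord: "M.ord \<gamma> = CARD('f) - 1" by simp
  show ?thesis
  proof (intro exI[of _ \<gamma>] conjI allI impI)
    show "\<gamma> \<noteq> 0" using \<gamma>(1) car by blast
    fix a :: 'f assume "a \<noteq> 0"
    then have "a \<in> carrier (mult_of ?R)" using car by blast
    then show "\<exists>i. a = \<gamma> ^ i" using \<gamma>(2) powR by auto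
  next
    fix n
    show "\<gamma> ^ n = 1 \<longleftrightarrow> CARD('f) - 1 dvd n"
      using M.pow_eq_id[OF \<gamma>(1), of n] by (simp add: pow ord)
  qed
qed

subsection \<open>Double transitivity and the torus\<close>

text \<open>
  The torus is the group of diagonal matrices, generated by the class of a primitive element \<open>\<gamma>\<close>, and \<open>\<theta>\<close> is the
  discrete logarithm of the upper left entry modulo the \<open>p\<close>-part \<open>P\<close> of \<open>q - 1\<close>. It does not depend on the sign of
  the matrix because the logarithm of a square root of \<open>1\<close> is \<open>0\<close> modulo the odd number \<open>P\<close>. The order of \<open>t\<close>
  lies between \<open>(q - 1) / 2\<close> and \<open>q - 1\<close> with respect to divisibility, so it has the same \<open>p\<close>-part as \<open>q - 1\<close>.
\<close>

theorem PSL2_doubly_transitive: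
  assumes p: "prime p" "p \<noteq> 2" "p dvd CARD('f::{field,finite}) - 1"
  shows "\<exists>P t w \<theta>. doubly_transitive_gset (PSL2 :: ('f ^ 2 ^ 2) set monoid) proj_line proj_act
    p P (line e1) (line e2) t w \<theta>"
proof -
  let ?G = "PSL2 :: ('f ^ 2 ^ 2) set monoid"
  interpret gset ?G proj_line proj_act by (rule gset_PSL2)
  define q where "q = CARD('f)"
  have q2: "2 \<le> q" using card_mono[of UNIV "{0, 1 :: 'f}"] by (simp add: q_def)
  obtain \<gamma> :: 'f where \<gamma>0: "\<gamma> \<noteq> 0" and gen: "\<And>a. a \<noteq> 0 \<Longrightarrow> \<exists>i. a = \<gamma> ^ i"
    and ord\<gamma>: "\<And>n. \<gamma> ^ n = 1 \<longleftrightarrow> q - 1 dvd n"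
    using exists_primitive_element[where 'f = 'f] unfolding q_def by blast
  define k where "k = multiplicity p (q - 1)"
  define P where "P = p ^ k"
  have k: "0 < k" using p q2 by (simp add: k_def q_def prime_multiplicity_gt_zero_iff)
  have Pq: "P dvd q - 1" by (simp add: P_def k_def multiplicity_dvd)
  have copP2: "coprime P 2"
    using p prime_odd_nat[OF p(1)] prime_gt_1_nat[OF p(1)] by (simp add: P_def)
  define dlog where "dlog a = (SOME i. a = \<gamma> ^ i)" for a
  have dlog: "\<gamma> ^ dlog a = a" if "a \<noteq> 0" for a
    using someI_ex[OF gen[OF that]] by (simp add: dlog_def)
  have pow_eq: "[i = j] (mod q - 1)" if "\<gamma> ^ i = \<gamma> ^ j" for i j
  proof -
    have aux: "[i = j] (mod q - 1)" if "\<gamma> ^ i = \<gamma> ^ j" "i \<le> j" for i j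
    proof -
      have "\<gamma> ^ i * \<gamma> ^ (j - i) = \<gamma> ^ j" unfolding power_add[symmetric] using that(2) by simp
      then have "\<gamma> ^ i * \<gamma> ^ (j - i) = \<gamma> ^ i * 1" using that(1) by simp
      then have "\<gamma> ^ (j - i) = 1" using \<gamma>0 by simp
      then have "q - 1 dvd j - i" by (simp add: ord\<gamma>)
      then show ?thesis using that(2) by (metis cong_sym cong_altdef_nat)
    qed
    show ?thesis using aux[of i j] aux[of j i] that by (cases "i \<le> j") (auto intro: cong_sym)
  qed
  have dlog_cong: "[int (dlog a) = int i] (mod int P)" if "a = \<gamma> ^ i" for a i
  proof -
    have "\<gamma> ^ dlog a = \<gamma> ^ i" using that dlog \<gamma>0 by simp
    then have "[dlog a = i] (mod P)" using pow_eq Pq cong_dvd_modulus_nat by blast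
    then show ?thesis by (simp add: cong_int_iff)
  qed
  have dlog_mult: "[int (dlog (a * b)) = int (dlog a) + int (dlog b)] (mod int P)" if "a \<noteq> 0" "b \<noteq> 0" for a b
    using dlog_cong[of "a * b" "dlog a + dlog b"] that dlog by (simp add: power_add)
  have dlog_sq: "[int (dlog c) = 0] (mod int P)" if "c * c = 1" for c
  proof -
    have "c \<noteq> 0" using that by auto
    then have "\<gamma> ^ (2 * dlog c) = 1" using dlog that by (simp add: mult_2 power_add)
    then have "P dvd 2 * dlog c" using ord\<gamma> Pq dvd_trans by blast
    then have "P dvd dlog c" using copP2 by (simp add: coprime_dvd_mult_right_iff)
    then show ?thesis by (simp add: cong_0_iff)
  qed
  define \<theta> where "\<theta> Q = int (dlog (lift Q $ 1 $ 1))" for Q :: "('f ^ 2 ^ 2) set"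
  have \<theta>: "[\<theta> (proj (mat2 a b 0 d)) = int (dlog a)] (mod int P)" if ad: "a * d = 1" for a b d
  proof -
    have "det (mat2 a b 0 d) = 1" using ad by (simp add: det_mat2)
    then obtain c where c: "lift (proj (mat2 a b 0 d)) = mat c ** mat2 a b 0 d" "c * c = 1"
      using lift_proj by blast
    have "[\<theta> (proj (mat2 a b 0 d)) = int (dlog (c * a))] (mod int P)"
      by (simp add: \<theta>_def c mat_mult_left)
    also have "[int (dlog (c * a)) = int (dlog c) + int (dlog a)] (mod int P)"
      using ad c by (intro dlog_mult) auto
    also have "[int (dlog c) + int (dlog a) = 0 + int (dlog a)] (mod int P)"
      using c by (intro cong_add dlog_sq cong_refl)
    finally show ?thesis by simp
  qed
  have borel: "\<exists>a b d. g = proj (mat2 a b 0 d) \<and> a * d = 1"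
    if g: "g \<in> carrier ?G" "proj_act g (line e1) = line e1" for g
  proof -
    obtain A where A: "g = proj A" "det A = 1" using g by (auto simp: carrier_PSL2 carrier_SL2)
    obtain a b c d where "A = mat2 a b c d" using mat2_eta by blast
    moreover from this have "c = 0" using A g fixes_e1_iff by blast
    ultimately show ?thesis using A by (auto simp: det_mat2)
  qed
  define t where "t = proj (mat2 \<gamma> 0 0 (1 / \<gamma>))"
  have tdet: "det (mat2 (\<gamma> ^ i) 0 0 (1 / \<gamma> ^ i)) = 1" for i using \<gamma>0 by (simp add: det_mat2)
  have tcl: "t \<in> carrier ?G" using tdet[of 1] by (simp add: t_def)
  have tpow: "t [^]\<^bsub>?G\<^esub> i = proj (mat2 (\<gamma> ^ i) 0 0 (1 / \<gamma> ^ i))" for i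
  proof (induction i)
    case 0
    then show ?case by (simp add: proj_one mat_eq_mat2)
  next
    case (Suc i)
    then show ?case using tdet[of i] tdet[of 1]
      by (simp add: t_def proj_mult mat2_mult mult.commute)
  qed
  have t_one: "t [^]\<^bsub>?G\<^esub> i = \<one>\<^bsub>?G\<^esub> \<Longrightarrow> q - 1 dvd 2 * i" for i
  proof -
    assume "t [^]\<^bsub>?G\<^esub> i = \<one>\<^bsub>?G\<^esub>"
    then have "mat2 (\<gamma> ^ i) 0 0 (1 / \<gamma> ^ i) \<in> proj (mat 1)"
      using self_mem_proj by (metis tpow proj_one)
    then have "\<gamma> ^ i = 1 / \<gamma> ^ i" by (auto simp: mem_proj mat_eq_mat2 mat2_mult)
    then have "\<gamma> ^ i * \<gamma> ^ i = 1" using \<gamma>0 by (simp add: field_simps)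
    then have "\<gamma> ^ (2 * i) = 1" by (simp only: mult_2 power_add)
    then show "q - 1 dvd 2 * i" by (simp add: ord\<gamma>)
  qed
  have "t [^]\<^bsub>?G\<^esub> (q - 1) = \<one>\<^bsub>?G\<^esub>"
    using ord\<gamma>[of "q - 1"] by (simp add: tpow proj_one mat_eq_mat2)
  then have ord_dvd: "ord t dvd q - 1" using pow_eq_id[OF tcl] by simp
  have "q - 1 dvd 2 * ord t" using t_one[of "ord t"] pow_ord_eq_1[OF tcl] by simp
  then have "P dvd 2 * ord t" using Pq dvd_trans by blast
  then have P_ord: "P dvd ord t" using copP2 by (simp add: coprime_dvd_mult_right_iff)
  obtain r s where "ord t = P * r" "q - 1 = ord t * s" using P_ord ord_dvd by blast
  moreover have "0 < P" using prime_gt_0_nat[OF p(1)] by (simp add: P_def)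
  ultimately have "ord t div P dvd (q - 1) div P" by (simp add: mult.assoc)
  moreover have "\<not> p dvd (q - 1) div P"
    unfolding P_def k_def using q2 p by (intro multiplicity_decompose) (auto simp: not_prime_unit)
  ultimately have p_ord: "\<not> p dvd ord t div P" using dvd_trans by blast
  define w where "w = proj (mat2 0 1 (-1) (0::'f))"
  have wcl: "w \<in> carrier ?G" by (simp add: w_def det_mat2)
  define t' where "t' = proj (mat2 (1 / \<gamma>) 0 0 \<gamma>)"
  have t'cl: "t' \<in> carrier ?G" using \<gamma>0 by (simp add: t'_def det_mat2)
  have "t' \<otimes>\<^bsub>?G\<^esub> t = \<one>\<^bsub>?G\<^esub>"
    using \<gamma>0 by (simp add: t'_def t_def proj_mult det_mat2 mat2_mult proj_one mat_eq_mat2)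
  then have t': "inv\<^bsub>?G\<^esub> t = t'" using tcl t'cl by (rule inv_equality)
  have "w \<otimes>\<^bsub>?G\<^esub> t = t' \<otimes>\<^bsub>?G\<^esub> w"
    using \<gamma>0 by (simp add: t'_def t_def w_def proj_mult det_mat2 mat2_mult)
  then have wt: "w \<otimes>\<^bsub>?G\<^esub> t \<otimes>\<^bsub>?G\<^esub> inv\<^bsub>?G\<^esub> w = inv\<^bsub>?G\<^esub> t"
    using wcl tcl t'cl by (simp add: t' m_assoc)
  have "doubly_transitive_gset ?G proj_line proj_act p P (line e1) (line e2) t w \<theta>"
  proof unfold_locales
    show "finite (carrier ?G)" "finite (proj_line :: ('f ^ 2) set set)" by simp_all
    show "prime p" "p \<noteq> 2" by (fact p)+
    have "card (proj_line :: ('f ^ 2) set set) = (q - 1) + 2" using q2 by (simp add: card_proj_line q_def)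
    moreover have "[(q - 1) + 2 = 0 + 2] (mod p)"
      using p by (intro cong_add cong_refl) (simp add: q_def cong_0_iff)
    ultimately show "[card (proj_line :: ('f ^ 2) set set) = 2] (mod p)" by (simp only: add_0)
    show "line e1 \<in> (proj_line :: ('f ^ 2) set set)" "line e2 \<in> (proj_line :: ('f ^ 2) set set)"
      by (auto simp: proj_line_def vec2_zero)
    show "line e1 \<noteq> line (e2 :: 'f ^ 2)" by (simp add: line_eq_iff vec2_zero smult_vec2)
    show "t \<in> carrier ?G" "w \<in> carrier ?G" by (fact tcl wcl)+
    show "proj_act t (line e1) = line e1" "proj_act t (line e2) = line e2"
      using tdet[of 1] by (simp_all add: t_def fixes_e1_iff fixes_e2_iff)
    show "\<exists>k>0. P = p ^ k" using k P_def by blast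
    show "P dvd ord t" "\<not> p dvd ord t div P" by (fact P_ord p_ord)+
    show "w \<otimes>\<^bsub>?G\<^esub> t \<otimes>\<^bsub>?G\<^esub> inv\<^bsub>?G\<^esub> w = inv\<^bsub>?G\<^esub> t" by (fact wt)
    have "[\<theta> t = int (dlog \<gamma>)] (mod int P)" unfolding t_def using \<gamma>0 by (intro \<theta>) simp
    also have "[int (dlog \<gamma>) = int 1] (mod int P)" by (rule dlog_cong) simp
    finally show "[\<theta> t = 1] (mod int P)" by simp
  next
    fix x y :: "('f ^ 2) set" assume "x \<in> proj_line" "y \<in> proj_line" "x \<noteq> y"
    then show "\<exists>g\<in>carrier ?G. proj_act g (line e1) = x \<and> proj_act g (line e2) = y"
      by (rule proj_line_doubly_transitive)
  next
    fix g assume g: "g \<in> carrier ?G" "proj_act g (line e1) = line e1" "proj_act g (line e2) = line e2"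
    obtain a b d where A: "g = proj (mat2 a b 0 d)" "a * d = 1" using borel[OF g(1,2)] by blast
    then have "b = 0" using g(3) by (simp add: fixes_e2_iff det_mat2)
    have "a \<noteq> 0" using A(2) by auto
    then obtain i where i: "a = \<gamma> ^ i" using gen by blast
    then have "d = 1 / \<gamma> ^ i" using A \<gamma>0 by (simp add: field_simps)
    then have "g = t [^]\<^bsub>?G\<^esub> i" using A i \<open>b = 0\<close> by (simp add: tpow)
    then show "\<exists>i::nat. g = t [^]\<^bsub>?G\<^esub> i" by blast
  next
    fix b c assume b: "b \<in> carrier ?G" "proj_act b (line e1) = line e1"
      and c: "c \<in> carrier ?G" "proj_act c (line e1) = line e1"
    obtain a1 b1 d1 where B: "b = proj (mat2 a1 b1 0 d1)" "a1 * d1 = 1" using borel[OF b] by blast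
    obtain a2 b2 d2 where C: "c = proj (mat2 a2 b2 0 d2)" "a2 * d2 = 1" using borel[OF c] by blast
    have "(a1 * a2) * (d1 * d2) = (a1 * d1) * (a2 * d2)" by (simp add: ac_simps)
    then have m: "(a1 * a2) * (d1 * d2) = 1" by (simp only: B C mult_1)
    have "b \<otimes>\<^bsub>?G\<^esub> c = proj (mat2 (a1 * a2) (a1 * b2 + b1 * d2) 0 (d1 * d2))"
      using B C by (simp add: proj_mult det_mat2 mat2_mult)
    then have "[\<theta> (b \<otimes>\<^bsub>?G\<^esub> c) = int (dlog (a1 * a2))] (mod int P)" using \<theta>[OF m] by simp
    also have "[int (dlog (a1 * a2)) = int (dlog a1) + int (dlog a2)] (mod int P)"
      using B C by (intro dlog_mult) auto
    also have "[int (dlog a1) + int (dlog a2) = \<theta> b + \<theta> c] (mod int P)"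
      unfolding B(1) C(1) by (intro cong_add cong_sym[OF \<theta>] B C)
    finally show "[\<theta> (b \<otimes>\<^bsub>?G\<^esub> c) = \<theta> b + \<theta> c] (mod int P)" .
  next
    fix x :: "('f ^ 2) set" assume x: "x \<in> proj_line" "x \<noteq> line e1"
    then obtain a where a: "x = line (vec2 a 1)" by (auto simp: proj_line_eq)
    let ?h = "proj (mat2 1 a 0 1)"
    have d: "det (mat2 1 a 0 1) = 1" by (simp add: det_mat2)
    have "[\<theta> ?h = int (dlog 1)] (mod int P)" by (rule \<theta>) simp
    also have "[int (dlog 1) = 0] (mod int P)" by (rule dlog_sq) simp
    finally have "int P dvd \<theta> ?h" by (simp add: cong_0_iff)
    moreover have "proj_act ?h (line e1) = line e1" "proj_act ?h (line e2) = x"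
      using d by (simp_all add: proj_act_line mat2_mult_vec a)
    ultimately show "\<exists>h\<in>carrier ?G. proj_act h (line e1) = line e1 \<and> int P dvd \<theta> h \<and> proj_act h (line e2) = x"
      using proj_closed[OF d] by blast
  qed
  then show ?thesis by blast
qed

section \<open>The cohomology of the nonprincipal module\<close>

theorem theorem2:
  fixes p q :: nat
    and L :: "('f::{field,finite} ^ 2 ^ 2) set monoid"
    and Fp :: "int ring"
    and V :: "(int, 'v) module"
    and \<rho> :: "('f ^ 2 ^ 2) set \<Rightarrow> 'v \<Rightarrow> 'v"
  assumes "q = CARD('f)"
    and "prime p" and "p \<noteq> 2" and "p dvd q - 1"
    and "L = PSL2"
    and "Fp = residue_ring (int p)"
    and "irreducible_rep Fp L V \<rho>"
    and "\<not> rep_isomorphic Fp L V \<rho> (regular_module Fp) (trivial_action (carrier Fp))"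
    and "in_principal_block Fp L V \<rho>"
  shows "group_cohomology 1 L V \<rho> \<cong> group_cohomology 2 L V \<rho> \<and>
         group_cohomology 2 L V \<rho> \<cong> add_monoid Fp"
proof -
  have "p dvd CARD('f) - 1" using assms(1,4) by simp
  then obtain P t w \<theta> where
    "doubly_transitive_gset L proj_line proj_act p P (line e1) (line e2) t w \<theta>"
    using PSL2_doubly_transitive[OF assms(2,3)] unfolding assms(5) by blast
  then interpret doubly_transitive_gset L proj_line proj_act p P "line e1" "line e2" t w \<theta> .
  note coh = cohomology_principal_block[OF assms(7-9)[unfolded assms(6)]]
  have "group_cohomology 1 L V \<rho> \<cong> group_cohomology 2 L V \<rho>"
    using iso_trans[OF coh(2) group.iso_sym[OF coh(3,4)]] .
  then show ?thesis using coh(4) assms(6) by simp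
qed

end
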